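(* Let $X$ be a separable Hilbert space and let $A:D(A)\subset X\to X$ be a densely defined linear operator such that: (a) $A$ is self-adjoint; (b) $A$ is accretive, i.e. $\langle Ax,x\rangle\ge 0$ for all $x\in D(A)$; (c) there exists $\lambda>0$ such that $(\lambda I+A)^{-1}:X\to X$ is compact. Let $\{\lambda_k\}_{k\in\mathbb{N}^*}$ be the eigenvalues of $A$ and $\{\varphi_k\}_{k\in\mathbb{N}^*}$ the corresponding eigenfunctions, and suppose that there exists a constant $\alpha>0$ such that $$\sqrt{\lambda_{k+1}}-\sqrt{\lambda_k}\ge\alpha,\qquad\forall k\in\mathbb{N}^*.$$ Let $B:X\to X$ be a bounded linear operator for which there exist $b,q>0$ such that $$\langle B\varphi_1,\varphi_1\rangle\ne 0\quad\text{and}\quad \lambda_k^q|\langle B\varphi_1,\varphi_k\rangle|\ge b\quad\forall k>1.$$ Then there exists a constant $C_K>0$ such that the following holds. For any $T>0$ there exists a constant $R_T>0$ such that, for any $u_0\in X$ with $\|u_0-\varphi_1\|<R_T$, there exists a control $p\in L^2(0,T)$ such that the mild solution $u$ of $$u'(t)+Au(t)+p(t)Bu(t)=0,\quad t\in[0,T],\qquad u(0)=u_0,$$ satisfies $u(T)=\psi_1(T)$, where $\psi_1(t)=e^{-\lambda_1t}\varphi_1$. Furthermore, this control satisfies $$\|p\|_{L^2(0,T)}\le\frac{e^{-\pi^2C_K/T_f}}{e^{2\pi^2C_K/(3T_f)}-1},$$ where $T_f:=\min\{T,T_\alpha\}$ and $T_\alpha:=\frac{\pi^2}{6}\min\{1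,1/\alpha^2\}$.
   Context: $\mathbb{N}^*=\{1,2,\dots\}$. $X$ is infinite-dimensional; the eigenvalues are listed in increasing order and the eigenfunctions $\{\varphi_k\}_{k\in\mathbb{N}^*}$ form an orthonormal basis of $X$ with $A\varphi_k=\lambda_k\varphi_k$. $\varphi_1$ is called the ground state of $A$ and $\psi_1(t)=e^{-\lambda_1t}\varphi_1$, which solves $u'+Au=0$, $u(0)=\varphi_1$, is the ground state solution. The control $p$ is a scalar function of time (with values in the scalar field of $X$). The mild solution of the control problem is the unique $u\in C([0,T];X)$ with $u(t)=e^{-tA}u_0-\int_0^te^{-(t-s)A}p(s)Bu(s)\,ds$ for all $t\in[0,T]$. *)

theory Defs
  imports "HOL-Analysis.Analysis"
begin

text \<open>
  The scalar field is a type of sort \<open>{real_normed_field, euclidean_space}\<close>. Up to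
  isomorphism the only such fields are the reals and the complex numbers, and the
  real inner product of the scalars determines the conjugation:
  \<open>scalar_conj z = 2 Re z - z\<close> with \<open>Re z = inner z 1\<close>.
\<close>

definition scalar_conj :: "'k::{real_normed_field,euclidean_space} \<Rightarrow> 'k"
  where "scalar_conj z = of_real (2 * inner z 1) - z"

lemma scalar_conj_real: "scalar_conj (x::real) = x"
  by (simp add: scalar_conj_def)

lemma scalar_conj_complex: "scalar_conj (z::complex) = cnj z"
  by (simp add: scalar_conj_def complex_eq_iff)

text \<open>
  The norm, the topology and the completeness of the Hilbert space are those of the
  Banach space type \<open>'x\<close>; the inner product is linear in its first argument.
\<close>

locale hilbert_space = vector_space smul
  for smul :: "'k::{real_normed_field,euclidean_space} \<Rightarrow> 'x::banach \<Rightarrow> 'x" +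
  fixes ip :: "'x \<Rightarrow> 'x \<Rightarrow> 'k"
  assumes smul_of_real: "smul (of_real r) x = r *\<^sub>R x"
    and ip_add_left: "ip (x + y) z = ip x z + ip y z"
    and ip_smul_left: "ip (smul c x) y = c * ip x y"
    and ip_commute: "ip y x = scalar_conj (ip x y)"
    and ip_self: "ip x x = of_real ((norm x)\<^sup>2)"

lemma hilbert_space_real:
  "hilbert_space (*\<^sub>R) (inner :: 'x::{real_inner,banach} \<Rightarrow> 'x \<Rightarrow> real)"
  by unfold_locales
    (auto simp: scalar_conj_real inner_commute inner_add_left inner_add_right algebra_simps
      power2_norm_eq_inner)

lemma hilbert_space_complex: "hilbert_space (*) (\<lambda>x y::complex. x * cnj y)"
  by unfold_locales
    (auto simp: scalar_conj_complex scaleR_conv_of_real algebra_simps complex_norm_square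
      simp del: of_real_power)

definition bounded_operator ::
    "('k \<Rightarrow> 'x \<Rightarrow> 'x) \<Rightarrow> ('x::real_normed_vector \<Rightarrow> 'x) \<Rightarrow> bool"
  where "bounded_operator smul B \<longleftrightarrow>
    bounded_linear B \<and> (\<forall>c x. B (smul c x) = smul c (B x))"

definition compact_operator ::
    "('k \<Rightarrow> 'x \<Rightarrow> 'x) \<Rightarrow> ('x::real_normed_vector \<Rightarrow> 'x) \<Rightarrow> bool"
  where "compact_operator smul K \<longleftrightarrow>
    bounded_operator smul K \<and> (\<forall>M. bounded M \<longrightarrow> compact (closure (K ` M)))"

text \<open>
  An unbounded operator is given by its domain \<open>D\<close> and a total function \<open>A\<close> of which
  only the values on \<open>D\<close> are relevant.
\<close>

definition densely_defined_operator ::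
    "('k::field \<Rightarrow> 'x \<Rightarrow> 'x) \<Rightarrow> 'x::real_normed_vector set \<Rightarrow> ('x \<Rightarrow> 'x) \<Rightarrow> bool"
  where "densely_defined_operator smul D A \<longleftrightarrow>
    module.subspace smul D \<and> closure D = UNIV \<and>
    (\<forall>x\<in>D. \<forall>y\<in>D. A (x + y) = A x + A y) \<and>
    (\<forall>c. \<forall>x\<in>D. A (smul c x) = smul c (A x))"

definition operator_graph :: "'x set \<Rightarrow> ('x \<Rightarrow> 'x) \<Rightarrow> ('x \<times> 'x) set"
  where "operator_graph D A = {(x, A x) | x. x \<in> D}"

definition adjoint_graph ::
    "('x \<Rightarrow> 'x \<Rightarrow> 'k) \<Rightarrow> 'x set \<Rightarrow> ('x \<Rightarrow> 'x) \<Rightarrow> ('x \<times> 'x) set"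
  where "adjoint_graph ip D A = {(y, z). \<forall>x\<in>D. ip (A x) y = ip x z}"

definition self_adjoint :: "('x \<Rightarrow> 'x \<Rightarrow> 'k) \<Rightarrow> 'x set \<Rightarrow> ('x \<Rightarrow> 'x) \<Rightarrow> bool"
  where "self_adjoint ip D A \<longleftrightarrow> adjoint_graph ip D A = operator_graph D A"

definition accretive ::
    "('x \<Rightarrow> 'x \<Rightarrow> 'k::real_normed_field) \<Rightarrow> 'x set \<Rightarrow> ('x \<Rightarrow> 'x) \<Rightarrow> bool"
  where "accretive ip D A \<longleftrightarrow> (\<forall>x\<in>D. \<exists>r\<ge>0. ip (A x) x = of_real r)"

definition has_compact_resolvent ::
    "('k \<Rightarrow> 'x \<Rightarrow> 'x) \<Rightarrow> 'x::real_normed_vector set \<Rightarrow> ('x \<Rightarrow> 'x) \<Rightarrow> bool"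
  where "has_compact_resolvent smul D A \<longleftrightarrow>
    (\<exists>l>0. bij_betw (\<lambda>x. l *\<^sub>R x + A x) D UNIV \<and>
           compact_operator smul (inv_into D (\<lambda>x. l *\<^sub>R x + A x)))"

text \<open>
  Sequences indexed by the positive integers are functions on \<open>nat\<close> whose value at \<open>0\<close>
  is irrelevant. Completeness of the orthonormal system forces \<open>lam\<close> to list every
  eigenvalue of \<open>A\<close>, with its multiplicity.
\<close>

definition orthonormal_basis ::
    "('k::field \<Rightarrow> 'x \<Rightarrow> 'x) \<Rightarrow> ('x \<Rightarrow> 'x \<Rightarrow> 'k) \<Rightarrow> (nat \<Rightarrow> 'x::real_normed_vector) \<Rightarrow> bool"
  where "orthonormal_basis smul ip phi \<longleftrightarrow>
    (\<forall>j\<ge>1. \<forall>k\<ge>1. ip (phi j) (phi k) = (if j = k then 1 else 0)) \<and>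
    closure (module.span smul (phi ` {1..})) = UNIV"

definition ordered_eigenbasis ::
    "('k::field \<Rightarrow> 'x \<Rightarrow> 'x) \<Rightarrow> ('x \<Rightarrow> 'x \<Rightarrow> 'k) \<Rightarrow> 'x::real_normed_vector set \<Rightarrow> ('x \<Rightarrow> 'x) \<Rightarrow>
      (nat \<Rightarrow> real) \<Rightarrow> (nat \<Rightarrow> 'x) \<Rightarrow> bool"
  where "ordered_eigenbasis smul ip D A lam phi \<longleftrightarrow>
    orthonormal_basis smul ip phi \<and>
    (\<forall>k\<ge>1. phi k \<in> D \<and> A (phi k) = lam k *\<^sub>R phi k) \<and>
    (\<forall>k\<ge>1. lam k \<le> lam (k + 1))"

definition C0_semigroup ::
    "('k \<Rightarrow> 'x \<Rightarrow> 'x) \<Rightarrow> (real \<Rightarrow> 'x::real_normed_vector \<Rightarrow> 'x) \<Rightarrow> bool"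
  where "C0_semigroup smul S \<longleftrightarrow>
    (\<forall>t\<ge>0. bounded_operator smul (S t)) \<and>
    (\<forall>x. S 0 x = x) \<and>
    (\<forall>s\<ge>0. \<forall>t\<ge>0. \<forall>x. S (s + t) x = S s (S t x)) \<and>
    (\<forall>x. ((\<lambda>t. S t x) \<longlongrightarrow> x) (at_right 0))"

definition generator_graph ::
    "(real \<Rightarrow> 'x::real_normed_vector \<Rightarrow> 'x) \<Rightarrow> ('x \<times> 'x) set"
  where "generator_graph S =
    {(x, y). ((\<lambda>h. (1 / h) *\<^sub>R (S h x - x)) \<longlongrightarrow> y) (at_right 0)}"

text \<open>
  \<open>exp_semigroup smul D A t\<close> is the operator \<open>e\<^sup>-\<^sup>t\<^sup>A\<close>, that is, the value at time \<open>t\<close> of the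
  C0-semigroup generated by \<open>-A\<close>. A semigroup is determined by its generator at all
  times \<open>t \<ge> 0\<close>, so the choice operator only leaves the irrelevant values at negative
  times open.
\<close>

definition exp_semigroup ::
    "('k \<Rightarrow> 'x \<Rightarrow> 'x) \<Rightarrow> 'x set \<Rightarrow> ('x \<Rightarrow> 'x) \<Rightarrow> real \<Rightarrow> 'x::real_normed_vector \<Rightarrow> 'x"
  where "exp_semigroup smul D A =
    (SOME S. C0_semigroup smul S \<and> generator_graph S = operator_graph D (\<lambda>x. - A x))"

text \<open>Elements of \<open>L\<^sup>2(0,T)\<close> are represented by functions.\<close>

definition L2_function :: "real \<Rightarrow> (real \<Rightarrow> 'k::real_normed_vector) \<Rightarrow> bool"
  where "L2_function T p \<longleftrightarrow>
    p \<in> borel_measurable (lebesgue_on {0..T}) \<and>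
    integrable (lebesgue_on {0..T}) (\<lambda>s. (norm (p s))\<^sup>2)"

definition L2_function_norm :: "real \<Rightarrow> (real \<Rightarrow> 'k::real_normed_vector) \<Rightarrow> real"
  where "L2_function_norm T p = sqrt (\<integral>s. (norm (p s))\<^sup>2 \<partial>lebesgue_on {0..T})"

text \<open>
  Integrability is demanded explicitly because the Bochner integral of a
  non-integrable function is \<open>0\<close> by convention.
\<close>

definition mild_solution ::
    "('k \<Rightarrow> 'x \<Rightarrow> 'x) \<Rightarrow> 'x::{banach,second_countable_topology} set \<Rightarrow> ('x \<Rightarrow> 'x) \<Rightarrow> ('x \<Rightarrow> 'x) \<Rightarrow>
      real \<Rightarrow> (real \<Rightarrow> 'k) \<Rightarrow> 'x \<Rightarrow> (real \<Rightarrow> 'x) \<Rightarrow> bool"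
  where "mild_solution smul D A B T p u0 u \<longleftrightarrow>
    continuous_on {0..T} u \<and>
    (\<forall>t\<in>{0..T}.
      integrable (lebesgue_on {0..t})
        (\<lambda>s. exp_semigroup smul D A (t - s) (smul (p s) (B (u s)))) \<and>
      u t = exp_semigroup smul D A t u0
        - (\<integral>s. exp_semigroup smul D A (t - s) (smul (p s) (B (u s))) \<partial>lebesgue_on {0..t}))"

end

theory Submission
  imports Defs "HOL-Computational_Algebra.Polynomial"
begin

text \<open>
  Put \<open>w(t) = e\<^sup>\<lambda>\<^sup>t u(t)\<close> with \<open>\<lambda> = lam 1\<close>. The ground state solution becomes the equilibrium
  \<open>phi 1\<close> of \<open>w' + (A - \<lambda>) w + p B w = 0\<close>, whose free semigroup is a contraction with decay rates
  \<open>\<mu> k = lam k - lam 1 \<ge> 0\<close>. Since \<open>R\<^sub>T\<close> may depend on \<open>T\<close>, it is enough to reach \<open>phi 1\<close> exactly at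
  time \<open>T\<close> by controls whose supremum norm is below any prescribed positive number, for all initial
  states close enough to \<open>phi 1\<close>: the right-hand side of the norm estimate is such a number, so
  \<open>C\<^sub>K = 1\<close> will do.

  Exact controllability is obtained from infinitely many approximate steps. One step starts from
  \<open>phi 1 + v\<close> with \<open>v\<close> small and lasts for a time \<open>2\<tau>\<close> (\<open>low_mode_control\<close>,
  \<open>one_control_step\<close>). Fix a cutoff \<open>m\<close>. The gap of the square roots makes the \<open>\<mu> k\<close> differ by
  at least \<open>\<alpha>\<^sup>2\<close> and leaves at most \<open>m\<close> of them below \<open>\<alpha>\<^sup>2 m\<^sup>2\<close>. During the first half of the step
  the control annihilates these finitely many modes of the linearised equation; in the second half
  the control is off and all other modes decay by \<open>exp (- \<alpha>\<^sup>2 m\<^sup>2 \<tau>)\<close>. Annihilating a mode prescribes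
  the exponential moment \<open>\<integral> e\<^sup>\<mu>\<^sup>s p(s) ds\<close>. For a control that is constant on \<open>m\<close> intervals of length
  \<open>h = \<tau> / m\<close> these prescriptions are Lagrange interpolation conditions at the nodes
  \<open>exp (\<mu> k * h)\<close> (\<open>moment_problem\<close>). Up to polynomial factors the interpolating
  polynomial has coefficients of size \<open>(c m / \<tau>)\<^sup>m\<close> with a constant \<open>c\<close>, and the lower bound on the
  coordinates of \<open>B (phi 1)\<close> costs a further power of \<open>m\<close>.
  With \<open>m\<close> proportional to \<open>x\<^sup>2\<close> the cost is at most \<open>exp (C x\<^sup>3)\<close> (\<open>control_cost_bound\<close>), whereas
  the gain is \<open>exp (- \<tau> x\<^sup>4)\<close>. The error of the linearisation is quadratic in \<open>v\<close>.

  Now let the durations shrink like \<open>(5/6)\<^sup>j\<close> while \<open>x\<close> grows like \<open>(6/5)\<^sup>j\<close>. Then \<open>x\<^sup>3\<close> and \<open>\<tau> x\<^sup>4\<close>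
  both grow like \<open>(6/5)\<^sup>3\<^sup>j\<close>, and a large initial value of \<open>x\<close> makes the cost exponent a small
  fraction of the gain exponent. As \<open>(6/5)\<^sup>3 < 2\<close>, the quadratic error is affordable as well, and the
  deviation after \<open>j\<close> steps is at most \<open>\<epsilon> exp (- L (6/5)\<^sup>3\<^sup>j)\<close> (\<open>superexponential_step\<close>). The
  concatenated control stays below \<open>\<epsilon>\<close>, the durations add up to \<open>T\<close>, and continuity of \<open>w\<close> at \<open>T\<close>
  gives \<open>w(T) = phi 1\<close> (\<open>local_controllability\<close>). Solutions exist and are unique because the
  perturbation \<open>p B\<close> is so small that the Duhamel operator is a contraction on \<open>[0,T]\<close>.

  It remains to know \<open>e\<^sup>-\<^sup>t\<^sup>A\<close>, which is specified only through its generator. The diagonal semigroup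
  with multipliers \<open>exp (- lam k * t)\<close> has the required generator, and every such semigroup agrees
  with it on the eigenvectors (\<open>exp_semigroup_eq_heat\<close>).
\<close>

section \<open>Inner product spaces over an abstract scalar field\<close>

lemma scalar_conj_of_real [simp]: "scalar_conj (of_real r :: 'k::{real_normed_field,euclidean_space}) = of_real r"
proof -
  have "inner (1::'k) 1 = 1"
    using dot_square_norm[of "1::'k"] by simp
  then show ?thesis
    by (simp add: scalar_conj_def of_real_def algebra_simps flip: scaleR_add_left)
qed

lemma scalar_conj_zero [simp]: "scalar_conj (0 :: 'k::{real_normed_field,euclidean_space}) = 0"
  by (simp add: scalar_conj_def)

text \<open>
  Conjugation is the reflection of the scalar field in the real line, hence an isometry. Together
  with its real linearity this treats real and complex scalars at once.
\<close>
lemma norm_scalar_conj [simp]: "norm (scalar_conj (z :: 'k::{real_normed_field,euclidean_space})) = norm z"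
proof -
  have one: "inner (1::'k) 1 = 1"
    using dot_square_norm[of "1::'k"] by simp
  have "(norm (scalar_conj z))\<^sup>2 = (norm z)\<^sup>2"
    unfolding scalar_conj_def power2_norm_eq_inner of_real_def
    by (simp add: one inner_diff_left inner_diff_right inner_commute algebra_simps power2_eq_square)
  then show ?thesis
    by (simp add: power2_eq_iff_nonneg)
qed

lemma scalar_conj_scaleR: "scalar_conj (r *\<^sub>R z) = r *\<^sub>R scalar_conj (z :: 'k::{real_normed_field,euclidean_space})"
  by (simp add: scalar_conj_def of_real_def algebra_simps)

lemma scalar_conj_add: "scalar_conj (y + z) = scalar_conj y + scalar_conj (z :: 'k::{real_normed_field,euclidean_space})"
  by (simp add: scalar_conj_def inner_add_left algebra_simps)

context hilbert_space
begin

lemma ip_zero_left [simp]: "ip 0 y = 0"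
  using ip_add_left[of 0 0 y] by simp

lemma ip_zero_right [simp]: "ip y 0 = 0"
  using ip_commute[of y 0] by simp

lemma ip_add_right: "ip z (x + y) = ip z x + ip z y"
  by (metis ip_add_left ip_commute scalar_conj_add)

lemma smul_scaleR: "smul (r *\<^sub>R c) x = r *\<^sub>R smul c x"
proof -
  have "smul (r *\<^sub>R c) x = smul (of_real r * c) x"
    by (simp add: scaleR_conv_of_real)
  also have "\<dots> = smul (of_real r) (smul c x)" by simp
  finally show ?thesis by (simp only: smul_of_real)
qed

lemma smul_scaleR_right: "smul c (r *\<^sub>R x) = r *\<^sub>R smul c x"
proof -
  have "smul c (r *\<^sub>R x) = smul (c * of_real r) x"
    by (simp flip: smul_of_real)
  then show ?thesis
    by (simp add: mult.commute[of c] flip: scaleR_conv_of_real smul_scaleR)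
qed

lemma ip_scaleR_left: "ip (r *\<^sub>R x) y = r *\<^sub>R ip x y"
  by (simp add: ip_smul_left scaleR_conv_of_real flip: smul_of_real)

lemma ip_scaleR_right: "ip x (r *\<^sub>R y) = r *\<^sub>R ip x y"
  by (metis ip_commute ip_scaleR_left scalar_conj_scaleR)

lemma ip_minus_left: "ip (- x) y = - ip x y"
  using ip_scaleR_left[of "-1" x y] by simp

lemma ip_diff_left: "ip (x - y) z = ip x z - ip y z"
  using ip_add_left[of x "- y" z] by (simp add: ip_minus_left)

lemma ip_diff_right: "ip z (x - y) = ip z x - ip z y"
  using ip_add_right[of z x "- y"] ip_scaleR_right[of z "-1" y] by simp

lemma ip_sum_left: "ip (\<Sum>i\<in>I. f i) z = (\<Sum>i\<in>I. ip (f i) z)"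
  by (induction I rule: infinite_finite_induct) (simp_all add: ip_add_left)

text \<open>
  The sesquilinear expansion of \<open>ip (smul c x) (smul c x)\<close> contains \<open>c * scalar_conj c\<close>; its
  modulus is known because the norm of the field is multiplicative.
\<close>
lemma norm_smul: "norm (smul c x) = norm c * norm x"
proof -
  have "ip (smul c x) (smul c x) = c * scalar_conj (c * ip x x)"
    by (metis ip_commute ip_smul_left)
  also have "c * ip x x = (norm x)\<^sup>2 *\<^sub>R c"
    by (simp add: ip_self scaleR_conv_of_real)
  finally have "norm (ip (smul c x) (smul c x)) = norm (c * ((norm x)\<^sup>2 *\<^sub>R scalar_conj c))"
    by (simp only: scalar_conj_scaleR)
  then have "(norm (smul c x))\<^sup>2 = (norm c * norm x)\<^sup>2"
    by (simp add: ip_self norm_mult power2_eq_square)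
  then show ?thesis
    by (simp add: power2_eq_iff_nonneg)
qed

lemma bounded_bilinear_smul: "bounded_bilinear smul"
proof
  show "\<exists>K. \<forall>a b. norm (smul a b) \<le> norm a * norm b * K"
    by (rule exI[of _ 1]) (simp add: norm_smul)
qed (simp_all add: scale_left_distrib scale_right_distrib smul_scaleR smul_scaleR_right)

lemma norm_add_orthogonal:
  assumes "ip x y = 0"
  shows "(norm (x + y))\<^sup>2 = (norm x)\<^sup>2 + (norm y)\<^sup>2"
proof -
  have "ip y x = 0" using assms ip_commute[of y x] by simp
  then have "ip (x + y) (x + y) = ip x x + ip y y"
    using assms by (simp add: ip_add_left ip_add_right)
  then show ?thesis
    unfolding ip_self of_real_add[symmetric] of_real_eq_iff .
qed

text \<open>
  Bessel's inequality for one vector: \<open>x\<close> splits orthogonally into its projection on \<open>e\<close> and the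
  remainder.
\<close>
lemma norm_ip_unit_le:
  assumes "ip e e = 1"
  shows "norm (ip x e) \<le> norm x"
proof -
  define c where "c = ip x e"
  have "ip (x - smul c e) (smul c e) = scalar_conj (c * (ip e x - ip e (smul c e)))"
    by (metis ip_commute ip_smul_left ip_diff_right)
  moreover have "ip e (smul c e) = ip e x"
    using assms ip_commute[of e "smul c e"] ip_commute[of e x] by (simp add: ip_smul_left c_def)
  ultimately have "ip (x - smul c e) (smul c e) = 0" by simp
  from norm_add_orthogonal[OF this]
  have *: "(norm (smul c e))\<^sup>2 \<le> (norm x)\<^sup>2" by simp
  have "norm e = 1"
    using assms ip_self[of e] by (metis abs_norm_cancel norm_of_real norm_one power2_eq_1_iff norm_power abs_1 real_sqrt_abs real_sqrt_eq_1_iff of_real_eq_1_iff)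
  with * show ?thesis
    by (simp add: norm_smul c_def power2_le_iff_abs_le abs_le_square_iff[symmetric])
qed

lemma norm_ip_le: "norm (ip x y) \<le> norm x * norm y"
proof (cases "y = 0")
  case False
  define e where "e = (1 / norm y) *\<^sub>R y"
  have "ip e e = 1"
    using False by (simp add: e_def ip_scaleR_left ip_scaleR_right ip_self scaleR_conv_of_real power2_eq_square field_simps)
  moreover have "ip x y = norm y *\<^sub>R ip x e"
    using False by (simp add: e_def ip_scaleR_right)
  ultimately show ?thesis
    using norm_ip_unit_le[of e x] False by (simp add: mult.commute)
qed simp

lemma bounded_linear_ip_left: "bounded_linear (\<lambda>x. ip x y)"
  by (rule bounded_linear_intro[where K = "norm y"]) (simp_all add: ip_add_left ip_scaleR_left norm_ip_le)

end

section \<open>Expansions and diagonal operators in an orthonormal basis\<close>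

locale hilbert_basis = hilbert_space smul ip
  for smul :: "'k::{real_normed_field,euclidean_space} \<Rightarrow> 'x::{banach,second_countable_topology} \<Rightarrow> 'x"
    and ip :: "'x \<Rightarrow> 'x \<Rightarrow> 'k" +
  fixes phi :: "nat \<Rightarrow> 'x"
  assumes orthonormal: "orthonormal_basis smul ip phi"
begin

lemma ip_phi: "j \<ge> 1 \<Longrightarrow> k \<ge> 1 \<Longrightarrow> ip (phi j) (phi k) = (if j = k then 1 else 0)"
  using orthonormal by (auto simp: orthonormal_basis_def)

lemma norm_phi [simp]: "k \<ge> 1 \<Longrightarrow> norm (phi k) = 1"
proof -
  assume "k \<ge> 1"
  then have "of_real ((norm (phi k))\<^sup>2) = (of_real 1 :: 'k)"
    by (simp only: ip_self[symmetric] ip_phi of_real_1 if_True simp_thms)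
  then have "(norm (phi k))\<^sup>2 = 1" by (simp only: of_real_eq_iff)
  then show ?thesis by (simp add: power2_eq_1_iff) (use norm_ge_zero[of "phi k"] in linarith)
qed

lemma bounded_operatorI_contraction:
  assumes "\<And>x y. f (x + y) = f x + f y" "\<And>c x. f (smul c x) = smul c (f x)"
    "\<And>x. norm (f x) \<le> norm x"
  shows "bounded_operator smul f"
  unfolding bounded_operator_def
proof safe
  show "bounded_linear f"
  proof (rule bounded_linear_intro[where K = 1])
    fix r x show "f (r *\<^sub>R x) = r *\<^sub>R f x"
      using assms(2)[of "of_real r" x] by (simp only: smul_of_real)
  qed (use assms in auto)
qed (rule assms)

text \<open>
  The vectors on which contractions converge strongly to the identity form a closed subspace, so it
  suffices to test the basis vectors.
\<close>
lemma strong_limit_id: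
  assumes op: "\<And>i. bounded_operator smul (T i)" and le: "\<And>i x. norm (T i x) \<le> norm x"
    and phi: "\<And>k. k \<ge> 1 \<Longrightarrow> ((\<lambda>i. T i (phi k)) \<longlongrightarrow> phi k) F"
  shows "((\<lambda>i. T i x) \<longlongrightarrow> x) F"
proof -
  define V where "V = {x. ((\<lambda>i. T i x) \<longlongrightarrow> x) F}"
  have lin: "bounded_linear (T i)" "T i (smul c x) = smul c (T i x)" for i c x
    using op[of i] by (auto simp: bounded_operator_def)
  note add = linear_add[OF bounded_linear.linear[OF lin(1)]]
  note diff = linear_diff[OF bounded_linear.linear[OF lin(1)]]
  note zero = linear_0[OF bounded_linear.linear[OF lin(1)]]
  have "subspace V"
    unfolding V_def
    by (rule subspaceI)
      (auto simp: add zero lin(2) intro: tendsto_add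
        bounded_linear.tendsto[OF bounded_bilinear.bounded_linear_right[OF bounded_bilinear_smul]])
  moreover have "phi ` {1..} \<subseteq> V"
    using phi by (auto simp: V_def)
  ultimately have "span (phi ` {1..}) \<subseteq> V"
    by (simp add: span_minimal)
  then have dense: "closure V = UNIV"
    using orthonormal closure_mono[of "span (phi ` {1..})" V] by (auto simp: orthonormal_basis_def)
  show ?thesis
  proof (rule tendstoI)
    fix e :: real assume "e > 0"
    then obtain y where y: "y \<in> V" "dist y x < e / 3"
      using dense closure_approachable[of x V] by (metis UNIV_I zero_less_divide_iff zero_less_numeral)
    have "\<forall>\<^sub>F i in F. dist (T i y) y < e / 3"
      using y(1) \<open>e > 0\<close> tendstoD[of "\<lambda>i. T i y" y F "e / 3"] by (simp add: V_def)
    then show "\<forall>\<^sub>F i in F. dist (T i x) x < e"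
    proof eventually_elim
      case (elim i)
      have "dist (T i x) x \<le> dist (T i x) (T i y) + (dist (T i y) y + dist y x)"
        by (meson dist_triangle order_trans add_left_mono)
      moreover have "dist (T i x) (T i y) \<le> dist x y"
        using le[of i "x - y"] by (simp add: dist_norm diff)
      ultimately show ?case using elim y(2) by (simp add: dist_commute)
    qed
  qed
qed

lemma ip_sum_phi:
  assumes "finite F" "F \<subseteq> {1..}" "k \<ge> 1"
  shows "ip (\<Sum>j\<in>F. smul (c j) (phi j)) (phi k) = (if k \<in> F then c k else 0)"
proof -
  have "ip (\<Sum>j\<in>F. smul (c j) (phi j)) (phi k) = (\<Sum>j\<in>F. if j = k then c j else 0)"
    unfolding ip_sum_left by (rule sum.cong) (use assms in \<open>auto simp: ip_smul_left ip_phi subset_iff\<close>)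
  then show ?thesis using assms(1) by simp
qed

lemma norm_sum_phi:
  assumes "finite F" "F \<subseteq> {1..}"
  shows "(norm (\<Sum>k\<in>F. smul (c k) (phi k)))\<^sup>2 = (\<Sum>k\<in>F. (norm (c k))\<^sup>2)"
  using assms
proof (induction F rule: finite_induct)
  case (insert k F)
  have "ip (phi k) (\<Sum>j\<in>F. smul (c j) (phi j)) = 0"
    using ip_commute[of "phi k" "\<Sum>j\<in>F. smul (c j) (phi j)"] insert by (simp add: ip_sum_phi)
  then have "ip (smul (c k) (phi k)) (\<Sum>j\<in>F. smul (c j) (phi j)) = 0"
    by (simp add: ip_smul_left)
  then show ?case
    using insert by (simp add: norm_add_orthogonal norm_smul)
qed simp

definition partial_expansion :: "nat \<Rightarrow> 'x \<Rightarrow> 'x"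
  where "partial_expansion n x = (\<Sum>k=1..n. smul (ip x (phi k)) (phi k))"

lemma norm_partial_expansion_le: "norm (partial_expansion n x) \<le> norm x"
proof -
  let ?y = "x - partial_expansion n x"
  have *: "ip ?y (phi k) = 0" if "k \<in> {1..n}" for k
    using that by (simp add: ip_diff_left partial_expansion_def ip_sum_phi)
  have **: "ip (phi k) ?y = 0" if "k \<in> {1..n}" for k
    by (subst ip_commute) (simp only: *[OF that] scalar_conj_zero)
  have "ip (partial_expansion n x) ?y = (\<Sum>k=1..n. ip x (phi k) * ip (phi k) ?y)"
    by (subst (1) partial_expansion_def) (simp only: ip_sum_left ip_smul_left)
  also have "\<dots> = 0"
    by (intro sum.neutral ballI) (simp only: ** mult_zero_right)
  finally have "(norm (partial_expansion n x + ?y))\<^sup>2 = (norm (partial_expansion n x))\<^sup>2 + (norm ?y)\<^sup>2"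
    by (rule norm_add_orthogonal)
  then have "(norm (partial_expansion n x))\<^sup>2 \<le> (norm x)\<^sup>2" by simp
  then show ?thesis by (rule power2_le_imp_le) simp
qed

lemma bounded_operator_partial_expansion: "bounded_operator smul (partial_expansion n)"
  by (rule bounded_operatorI_contraction)
    (simp_all add: norm_partial_expansion_le, simp_all add: partial_expansion_def ip_add_left
      ip_smul_left scale_left_distrib sum.distrib scale_sum_right)

lemma partial_expansion_tendsto: "(\<lambda>n. partial_expansion n x) \<longlonglongrightarrow> x"
proof (rule strong_limit_id)
  fix k :: nat assume k: "k \<ge> 1"
  have "partial_expansion n (phi k) = phi k" if "n \<ge> k" for n
  proof -
    have "partial_expansion n (phi k) = (\<Sum>j=1..n. if j = k then phi j else 0)"
      unfolding partial_expansion_def using k by (intro sum.cong) (auto simp: ip_phi)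
    then show ?thesis using k that by simp
  qed
  then show "(\<lambda>n. partial_expansion n (phi k)) \<longlonglongrightarrow> phi k"
    by (intro tendsto_eventually eventually_sequentiallyI[of k])
qed (rule bounded_operator_partial_expansion norm_partial_expansion_le)+

lemma eqI_phi:
  assumes "\<And>k. k \<ge> 1 \<Longrightarrow> ip x (phi k) = ip y (phi k)"
  shows "x = y"
proof -
  have "partial_expansion n x = partial_expansion n y" for n
    unfolding partial_expansion_def by (rule sum.cong) (simp_all add: assms)
  then show ?thesis
    using LIMSEQ_unique[OF partial_expansion_tendsto[of x]] partial_expansion_tendsto[of y] by simp
qed

lemma parseval: "(\<lambda>n. \<Sum>k=1..n. ip x (phi k) * scalar_conj (ip y (phi k))) \<longlonglongrightarrow> ip x y"
proof -
  have "(\<lambda>n. ip (partial_expansion n x) y) \<longlonglongrightarrow> ip x y"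
    by (rule bounded_linear.tendsto[OF bounded_linear_ip_left partial_expansion_tendsto])
  moreover have "ip (partial_expansion n x) y = (\<Sum>k=1..n. ip x (phi k) * scalar_conj (ip y (phi k)))" for n
    unfolding partial_expansion_def ip_sum_left ip_smul_left ip_commute[of _ y, symmetric] ..
  ultimately show ?thesis by simp
qed

text \<open>
  Only \<open>\<bar>\<theta> k\<bar> \<le> 1\<close> is of interest, where the series converges by comparison with the expansion
  of \<open>x\<close>.
\<close>
definition diagonal_op :: "(nat \<Rightarrow> real) \<Rightarrow> 'x \<Rightarrow> 'x"
  where "diagonal_op \<theta> x = lim (\<lambda>n. \<Sum>k=1..n. smul (\<theta> k *\<^sub>R ip x (phi k)) (phi k))"

context
  fixes \<theta> :: "nat \<Rightarrow> real"
  assumes \<theta>: "\<And>k. k \<ge> 1 \<Longrightarrow> \<bar>\<theta> k\<bar> \<le> 1"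
begin

lemma norm_sum_multiplier_le:
  assumes "finite F" "F \<subseteq> {1..}"
  shows "norm (\<Sum>k\<in>F. smul (\<theta> k *\<^sub>R ip x (phi k)) (phi k)) \<le> norm (\<Sum>k\<in>F. smul (ip x (phi k)) (phi k))"
proof (rule power2_le_imp_le)
  have "(\<Sum>k\<in>F. (norm (\<theta> k *\<^sub>R ip x (phi k)))\<^sup>2) \<le> (\<Sum>k\<in>F. (norm (ip x (phi k)))\<^sup>2)"
    using assms \<theta> by (intro sum_mono power_mono) (auto intro!: mult_left_le_one_le simp: subset_iff)
  then show "(norm (\<Sum>k\<in>F. smul (\<theta> k *\<^sub>R ip x (phi k)) (phi k)))\<^sup>2
      \<le> (norm (\<Sum>k\<in>F. smul (ip x (phi k)) (phi k)))\<^sup>2"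
    by (simp only: norm_sum_phi[OF assms])
qed simp

text \<open>
  Blocks of the multiplied series are dominated by blocks of the expansion of \<open>x\<close>, which is Cauchy.
\<close>
lemma diagonal_op_tendsto: "(\<lambda>n. \<Sum>k=1..n. smul (\<theta> k *\<^sub>R ip x (phi k)) (phi k)) \<longlonglongrightarrow> diagonal_op \<theta> x"
proof -
  let ?s = "\<lambda>n. \<Sum>k=1..n. smul (\<theta> k *\<^sub>R ip x (phi k)) (phi k)"
  have le: "dist (?s m) (?s n) \<le> dist (partial_expansion m x) (partial_expansion n x)" if "m \<le> n" for m n
  proof -
    have split: "{1..n} = {1..m} \<union> {m<..n}" using that by auto
    have *: "(\<Sum>k=1..n. f k) - (\<Sum>k=1..m. f k) = (\<Sum>k\<in>{m<..n}. f k)" for f :: "nat \<Rightarrow> 'x"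
      unfolding split by (subst sum.union_disjoint) auto
    show ?thesis
      unfolding partial_expansion_def dist_norm
        norm_minus_commute[of "sum _ {1..m}" "sum _ {1..n}"] *
      by (rule norm_sum_multiplier_le) auto
  qed
  have le': "dist (?s m) (?s n) \<le> dist (partial_expansion m x) (partial_expansion n x)" for m n
    using le[of m n] le[of n m] by (cases "m \<le> n") (simp_all add: dist_commute)
  have c: "Cauchy (\<lambda>n. partial_expansion n x)"
    by (rule LIMSEQ_imp_Cauchy[OF partial_expansion_tendsto])
  have "Cauchy ?s"
  proof (rule metric_CauchyI)
    fix e :: real assume "e > 0"
    obtain M where "\<forall>m\<ge>M. \<forall>n\<ge>M. dist (partial_expansion m x) (partial_expansion n x) < e"
      using metric_CauchyD[OF c \<open>e > 0\<close>] by blast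
    then show "\<exists>M. \<forall>m\<ge>M. \<forall>n\<ge>M. dist (?s m) (?s n) < e"
      by (intro exI[of _ M]) (blast intro: order.strict_trans1[OF le'])
  qed
  then show ?thesis
    unfolding diagonal_op_def by (simp add: Cauchy_convergent_iff convergent_LIMSEQ_iff)
qed

lemma ip_diagonal_op: "k \<ge> 1 \<Longrightarrow> ip (diagonal_op \<theta> x) (phi k) = \<theta> k *\<^sub>R ip x (phi k)"
proof -
  assume k: "k \<ge> 1"
  have "(\<lambda>n. ip (\<Sum>k=1..n. smul (\<theta> k *\<^sub>R ip x (phi k)) (phi k)) (phi k)) \<longlonglongrightarrow> ip (diagonal_op \<theta> x) (phi k)"
    by (rule bounded_linear.tendsto[OF bounded_linear_ip_left diagonal_op_tendsto])
  moreover have "(\<lambda>n. ip (\<Sum>k=1..n. smul (\<theta> k *\<^sub>R ip x (phi k)) (phi k)) (phi k)) \<longlonglongrightarrow> \<theta> k *\<^sub>R ip x (phi k)"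
    using k by (intro tendsto_eventually eventually_sequentiallyI[of k])
      (simp add: ip_sum_phi)
  ultimately show ?thesis by (rule LIMSEQ_unique)
qed

lemma norm_diagonal_op_le: "norm (diagonal_op \<theta> x) \<le> norm x"
proof (rule LIMSEQ_le_const2[OF tendsto_norm[OF diagonal_op_tendsto]])
  have "norm (\<Sum>k=1..n. smul (\<theta> k *\<^sub>R ip x (phi k)) (phi k)) \<le> norm x" for n
    using norm_sum_multiplier_le[of "{1..n}" x] norm_partial_expansion_le[of n x]
    by (simp add: partial_expansion_def)
  then show "\<exists>N. \<forall>n\<ge>N. norm (\<Sum>k=1..n. smul (\<theta> k *\<^sub>R ip x (phi k)) (phi k)) \<le> norm x" by blast
qed

lemma bounded_operator_diagonal_op: "bounded_operator smul (diagonal_op \<theta>)"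
  by (rule bounded_operatorI_contraction; (rule eqI_phi)?)
    (simp_all add: norm_diagonal_op_le ip_diagonal_op ip_add_left ip_smul_left scaleR_add_right)

lemma diagonal_op_phi: "k \<ge> 1 \<Longrightarrow> diagonal_op \<theta> (phi k) = \<theta> k *\<^sub>R phi k"
  by (rule eqI_phi) (auto simp: ip_diagonal_op ip_scaleR_left ip_phi)

end

lemma diagonal_op_tendsto_id:
  assumes le: "\<And>i k. k \<ge> 1 \<Longrightarrow> \<bar>\<theta> i k\<bar> \<le> 1"
    and lim: "\<And>k. k \<ge> 1 \<Longrightarrow> ((\<lambda>i. \<theta> i k) \<longlongrightarrow> 1) F"
  shows "((\<lambda>i. diagonal_op (\<theta> i) x) \<longlongrightarrow> x) F"
proof (rule strong_limit_id)
  fix k :: nat assume k: "k \<ge> 1"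
  have "((\<lambda>i. \<theta> i k *\<^sub>R phi k) \<longlongrightarrow> 1 *\<^sub>R phi k) F"
    by (intro tendsto_scaleR tendsto_const lim k)
  then show "((\<lambda>i. diagonal_op (\<theta> i) (phi k)) \<longlongrightarrow> phi k) F"
    using diagonal_op_phi[OF le k] by simp
qed (simp_all add: bounded_operator_diagonal_op norm_diagonal_op_le le)

end

section \<open>The semigroup generated by a diagonal self-adjoint operator\<close>

lemma expm1_quotient_tendsto: "((\<lambda>h::real. (exp (c * h) - 1) / h) \<longlongrightarrow> c) (at_right 0)"
proof -
  have "((\<lambda>h. exp (c * h)) has_real_derivative c) (at 0)"
    by (auto intro!: derivative_eq_intros)
  then have "((\<lambda>h. (exp (c * h) - 1) / h) \<longlongrightarrow> c) (at 0)"
    by (simp add: DERIV_def)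
  then show ?thesis
    by (rule filterlim_mono) (simp_all add: at_le)
qed

lemma scaleR_difference_quotient:
  "(1 / h) *\<^sub>R (e *\<^sub>R x - x) = ((e - 1) / h) *\<^sub>R (x :: 'a::real_vector)"
  by (simp add: diff_divide_distrib scaleR_left_diff_distrib scaleR_right_diff_distrib)

lemma norm_power_minus_1_le:
  fixes z :: "'k::real_normed_field"
  shows "norm (z ^ n - 1) \<le> (1 + norm (z - 1)) ^ n - 1"
proof (induction n)
  case (Suc n)
  have "z ^ Suc n - 1 = (z ^ n - 1) * z + (z - 1)" by (simp add: algebra_simps)
  then have "norm (z ^ Suc n - 1) \<le> norm (z ^ n - 1) * norm z + norm (z - 1)"
    by (metis norm_triangle_ineq norm_mult)
  also have "norm z \<le> 1 + norm (z - 1)"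
    using norm_triangle_ineq[of 1 "z - 1"] by simp
  then have "norm (z ^ n - 1) * norm z \<le> ((1 + norm (z - 1)) ^ n - 1) * (1 + norm (z - 1))"
    using Suc by (intro mult_mono) auto
  finally show ?case by (simp add: algebra_simps)
qed simp

text \<open>
  Write \<open>f t\<close> as the \<open>n\<close>-th power of \<open>f (t / n)\<close>, which is \<open>1 + o(1 / n)\<close>.
\<close>
lemma multiplicative_eq_1:
  fixes f :: "real \<Rightarrow> 'k::real_normed_field"
  assumes 0: "f 0 = 1" and mult: "\<And>s t. s \<ge> 0 \<Longrightarrow> t \<ge> 0 \<Longrightarrow> f (s + t) = f s * f t"
    and der: "((\<lambda>h. (1 / h) *\<^sub>R (f h - 1)) \<longlongrightarrow> 0) (at_right 0)" and "t \<ge> 0"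
  shows "f t = 1"
proof (cases "t = 0")
  case False
  then have "t > 0" using \<open>t \<ge> 0\<close> by simp
  have pow: "f (real n * s) = f s ^ n" if "s \<ge> 0" for n s
  proof (induction n)
    case (Suc n)
    have "f (real (Suc n) * s) = f (s + real n * s)" by (simp add: algebra_simps)
    also have "\<dots> = f s * f (real n * s)" using that by (intro mult) auto
    finally show ?case using Suc by simp
  qed (simp add: 0)
  define h where "h n = t / real (Suc n)" for n
  have h: "h n > 0" "real (Suc n) * h n = t" for n
    using \<open>t > 0\<close> by (simp_all add: h_def)
  have "h \<longlonglongrightarrow> 0"
    unfolding h_def by (intro LIMSEQ_Suc[OF lim_const_over_n])
  moreover have "h n \<noteq> 0" for n using h(1)[of n] by simp
  ultimately have "filterlim h (at_right 0) sequentially"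
    using h(1) by (simp add: filterlim_at)
  then have "(\<lambda>n. t * norm ((1 / h n) *\<^sub>R (f (h n) - 1))) \<longlonglongrightarrow> t * norm (0::'k)"
    by (intro tendsto_mult tendsto_const tendsto_norm filterlim_compose[OF der])
  then have "(\<lambda>n. exp (t * norm ((1 / h n) *\<^sub>R (f (h n) - 1))) - 1) \<longlonglongrightarrow> exp (t * norm (0::'k)) - 1"
    by (intro tendsto_diff tendsto_exp tendsto_const)
  moreover have "norm (f t - 1) \<le> exp (t * norm ((1 / h n) *\<^sub>R (f (h n) - 1))) - 1" for n
  proof -
    let ?e = "norm (f (h n) - 1)"
    have "norm (f t - 1) \<le> (1 + ?e) ^ Suc n - 1"
      using norm_power_minus_1_le[of "f (h n)" "Suc n"] pow[of "h n" "Suc n"] h[of n] by simp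
    also have "(1 + ?e) ^ Suc n \<le> exp ?e ^ Suc n"
      by (intro power_mono exp_ge_add_one_self) simp
    also have "exp ?e ^ Suc n = exp (real (Suc n) * ?e)"
      by (rule exp_of_nat_mult[symmetric])
    also have "real (Suc n) * ?e = t * norm ((1 / h n) *\<^sub>R (f (h n) - 1))"
      using h(1)[of n] by (simp add: h(2)[of n, symmetric])
    finally show ?thesis by simp
  qed
  ultimately have "norm (f t - 1) \<le> exp (t * norm (0::'k)) - 1"
    by (intro LIMSEQ_le_const) auto
  then show ?thesis by simp
qed (simp add: 0)

lemma (in hilbert_basis) eigenvalue_nonneg:
  assumes "accretive ip D A" and k: "k \<ge> 1" and eigen: "phi k \<in> D" "A (phi k) = c *\<^sub>R phi k"
  shows "c \<ge> 0"
proof -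
  have "\<exists>r\<ge>0. ip (A (phi k)) (phi k) = of_real r"
    using eigen(1) assms(1) unfolding accretive_def by blast
  then obtain r where r: "r \<ge> 0" "ip (A (phi k)) (phi k) = of_real r" by blast
  then have "of_real c = (of_real r :: 'k)"
    using k by (simp add: eigen(2) ip_scaleR_left ip_phi of_real_def)
  then show ?thesis using r(1) by (simp only: of_real_eq_iff)
qed

locale diagonal_operator = hilbert_basis smul ip phi
  for smul :: "'k::{real_normed_field,euclidean_space} \<Rightarrow> 'x::{banach,second_countable_topology} \<Rightarrow> 'x"
    and ip :: "'x \<Rightarrow> 'x \<Rightarrow> 'k" and phi :: "nat \<Rightarrow> 'x" +
  fixes D :: "'x set" and A :: "'x \<Rightarrow> 'x" and lam :: "nat \<Rightarrow> real"
  assumes self_adjoint: "self_adjoint ip D A" and accretive: "accretive ip D A"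
    and eigenvector: "\<And>k. k \<ge> 1 \<Longrightarrow> phi k \<in> D \<and> A (phi k) = lam k *\<^sub>R phi k"
    and simple: "\<And>j k. j \<ge> 1 \<Longrightarrow> k \<ge> 1 \<Longrightarrow> lam j = lam k \<Longrightarrow> j = k"
begin

lemma lam_nonneg: "k \<ge> 1 \<Longrightarrow> lam k \<ge> 0"
  by (rule eigenvalue_nonneg[OF accretive]) (use eigenvector in auto)

text \<open>
  Self-adjointness means that the graph is as large as symmetry permits; tested against the
  eigenvectors by Parseval's identity, membership is a condition on coordinates. This replaces the
  usual description of the domain by square summability of \<open>lam k\<close> times the coordinates.
\<close>
lemma graph_iff_coordinates:
  "(x, z) \<in> operator_graph D A \<longleftrightarrow> (\<forall>k\<ge>1. ip z (phi k) = lam k *\<^sub>R ip x (phi k))" (is "_ \<longleftrightarrow> ?R x z")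
proof -
  have R: "?R x z" if "(x, z) \<in> operator_graph D A" for x z
  proof safe
    fix k :: nat assume k: "k \<ge> 1"
    have "(x, z) \<in> adjoint_graph ip D A"
      using that self_adjoint by (simp add: self_adjoint_def)
    then have "ip (A (phi k)) x = ip (phi k) z"
      using eigenvector[OF k] by (auto simp: adjoint_graph_def)
    then have "lam k *\<^sub>R ip (phi k) x = ip (phi k) z"
      using eigenvector[OF k] by (simp add: ip_scaleR_left)
    then show "ip z (phi k) = lam k *\<^sub>R ip x (phi k)"
      by (metis ip_commute scalar_conj_scaleR)
  qed
  moreover have "(x, z) \<in> operator_graph D A" if xz: "?R x z"
  proof -
    have "ip (A w) x = ip w z" if "w \<in> D" for w
    proof -
      have "?R w (A w)" using R[of w "A w"] that by (auto simp: operator_graph_def)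
      then have "(\<Sum>k=1..n. ip (A w) (phi k) * scalar_conj (ip x (phi k))) =
          (\<Sum>k=1..n. ip w (phi k) * scalar_conj (ip z (phi k)))" for n
        using xz by (intro sum.cong refl) (simp add: scalar_conj_scaleR)
      then show ?thesis
        using LIMSEQ_unique[OF parseval[of "A w" x]] parseval[of w z] by simp
    qed
    then have "(x, z) \<in> adjoint_graph ip D A" by (simp add: adjoint_graph_def)
    then show ?thesis using self_adjoint by (simp add: self_adjoint_def)
  qed
  ultimately show ?thesis by blast
qed

lemma negative_graph_iff_coordinates:
  "(x, y) \<in> operator_graph D (\<lambda>x. - A x) \<longleftrightarrow> (\<forall>k\<ge>1. ip y (phi k) = - lam k *\<^sub>R ip x (phi k))"
proof -
  have "(x, y) \<in> operator_graph D (\<lambda>x. - A x) \<longleftrightarrow> (x, - y) \<in> operator_graph D A"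
    by (simp add: operator_graph_def) (metis minus_minus)
  also have "\<dots> \<longleftrightarrow> (\<forall>k\<ge>1. ip y (phi k) = - lam k *\<^sub>R ip x (phi k))"
    unfolding graph_iff_coordinates ip_minus_left by (metis minus_equation_iff scaleR_minus_left)
  finally show ?thesis .
qed

text \<open>
  The truncation at \<open>0\<close> only makes the multipliers bounded by \<open>1\<close> for every real \<open>t\<close>.
\<close>
definition heat :: "real \<Rightarrow> 'x \<Rightarrow> 'x"
  where "heat t = diagonal_op (\<lambda>k. exp (- lam k * max 0 t))"

lemma heat_multiplier: "k \<ge> 1 \<Longrightarrow> \<bar>exp (- lam k * max 0 t)\<bar> \<le> 1"
  using lam_nonneg[of k] by simp

lemma ip_heat: "k \<ge> 1 \<Longrightarrow> t \<ge> 0 \<Longrightarrow> ip (heat t x) (phi k) = exp (- lam k * t) *\<^sub>R ip x (phi k)"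
  unfolding heat_def by (subst ip_diagonal_op) (simp_all add: lam_nonneg)

lemma bounded_operator_heat: "bounded_operator smul (heat t)"
  unfolding heat_def by (rule bounded_operator_diagonal_op) (rule heat_multiplier)

lemma C0_semigroup_heat: "C0_semigroup smul heat"
  unfolding C0_semigroup_def
proof (intro conjI allI impI)
  show "heat 0 x = x" for x
    by (rule eqI_phi) (simp add: ip_heat)
  show "heat (s + t) x = heat s (heat t x)" if "s \<ge> 0" "t \<ge> 0" for s t x
    by (rule eqI_phi) (use that in \<open>simp add: ip_heat exp_add[symmetric] algebra_simps\<close>)
  show "((\<lambda>t. heat t x) \<longlongrightarrow> x) (at_right 0)" for x
    unfolding heat_def
  proof (rule diagonal_op_tendsto_id)
    fix k
    have "((\<lambda>t. exp (- lam k * max 0 t)) \<longlongrightarrow> exp (- lam k * max 0 0)) (at_right 0)"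
      by (intro tendsto_intros)
    then show "((\<lambda>t. exp (- lam k * max 0 t)) \<longlongrightarrow> 1) (at_right 0)" by simp
  qed (rule heat_multiplier)
qed (rule bounded_operator_heat)

text \<open>
  The inclusion of the operator in the generator rests on rewriting the difference quotient at \<open>x\<close> as a
  diagonal operator applied to the limit \<open>y\<close>. Its multipliers \<open>(1 - exp (- lam k * h)) / (lam k * h)\<close>
  lie in \<open>[0,1]\<close> and tend to \<open>1\<close>.
\<close>
lemma generator_graph_heat: "generator_graph heat = operator_graph D (\<lambda>x. - A x)"
proof -
  have 1: "ip y (phi k) = - lam k *\<^sub>R ip x (phi k)"
    if "(x, y) \<in> generator_graph heat" and k: "k \<ge> 1" for x y k
  proof -
    have "((\<lambda>h. ip ((1 / h) *\<^sub>R (heat h x - x)) (phi k)) \<longlongrightarrow> ip y (phi k)) (at_right 0)"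
      using that(1) by (intro bounded_linear.tendsto[OF bounded_linear_ip_left]) (simp add: generator_graph_def)
    moreover have "\<forall>\<^sub>F h in at_right 0. ip ((1 / h) *\<^sub>R (heat h x - x)) (phi k)
        = ((exp (- lam k * h) - 1) / h) *\<^sub>R ip x (phi k)"
      using k by (auto simp: ip_scaleR_left ip_diff_left ip_heat scaleR_difference_quotient
          intro!: eventually_at_rightI[of 0 1])
    ultimately have "((\<lambda>h. ((exp (- lam k * h) - 1) / h) *\<^sub>R ip x (phi k)) \<longlongrightarrow> ip y (phi k)) (at_right 0)"
      by (rule Lim_transform_eventually)
    moreover have "((\<lambda>h. ((exp (- lam k * h) - 1) / h) *\<^sub>R ip x (phi k)) \<longlongrightarrow> - lam k *\<^sub>R ip x (phi k)) (at_right 0)"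
      by (intro tendsto_scaleR tendsto_const expm1_quotient_tendsto)
    ultimately show ?thesis
      by (intro tendsto_unique[of "at_right 0"]) auto
  qed
  have 2: "(x, y) \<in> generator_graph heat" if y: "\<And>k. k \<ge> 1 \<Longrightarrow> ip y (phi k) = - lam k *\<^sub>R ip x (phi k)" for x y
  proof -
    define \<theta> where "\<theta> h k = (if lam k = 0 \<or> h \<le> 0 then 1 else (1 - exp (- lam k * h)) / (lam k * h))" for h k
    have \<theta>_le: "\<bar>\<theta> h k\<bar> \<le> 1" if "k \<ge> 1" for h k
      using lam_nonneg[OF that] exp_ge_add_one_self[of "- lam k * h"]
      by (auto simp: \<theta>_def abs_le_iff divide_simps mult_less_0_iff)
    have \<theta>_lim: "((\<lambda>h. \<theta> h k) \<longlongrightarrow> 1) (at_right 0)" if "k \<ge> 1" for k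
    proof (cases "lam k = 0")
      case False
      have "((\<lambda>h. - (1 / lam k) * ((exp (- lam k * h) - 1) / h)) \<longlongrightarrow> - (1 / lam k) * (- lam k)) (at_right 0)"
        by (intro tendsto_mult tendsto_const expm1_quotient_tendsto)
      then have "((\<lambda>h. - (1 / lam k) * ((exp (- lam k * h) - 1) / h)) \<longlongrightarrow> 1) (at_right 0)"
        using False by simp
      moreover have "\<forall>\<^sub>F h in at_right 0. - (1 / lam k) * ((exp (- lam k * h) - 1) / h) = \<theta> h k"
        using False by (auto simp: \<theta>_def field_simps intro!: eventually_at_rightI[of 0 1])
      ultimately show ?thesis by (rule Lim_transform_eventually)
    qed (simp add: \<theta>_def)
    have "((\<lambda>h. diagonal_op (\<theta> h) y) \<longlongrightarrow> y) (at_right 0)"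
      by (rule diagonal_op_tendsto_id) (rule \<theta>_le \<theta>_lim; assumption)+
    moreover have "diagonal_op (\<theta> h) y = (1 / h) *\<^sub>R (heat h x - x)" if "h > 0" for h
    proof (rule eqI_phi)
      fix k :: nat assume k: "k \<ge> 1"
      have "ip (diagonal_op (\<theta> h) y) (phi k) = \<theta> h k *\<^sub>R (- lam k *\<^sub>R ip x (phi k))"
        by (simp add: ip_diagonal_op[OF \<theta>_le k] y[OF k])
      also have "\<dots> = ((exp (- lam k * h) - 1) / h) *\<^sub>R ip x (phi k)"
      proof -
        have "\<theta> h k * - lam k = (exp (- lam k * h) - 1) / h"
          using \<open>h > 0\<close> by (auto simp: \<theta>_def field_simps)
        then show ?thesis by (simp only: scaleR_scaleR)
      qed
      finally show "ip (diagonal_op (\<theta> h) y) (phi k) = ip ((1 / h) *\<^sub>R (heat h x - x)) (phi k)"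
        using k \<open>h > 0\<close> by (simp add: ip_scaleR_left ip_diff_left ip_heat scaleR_difference_quotient)
    qed
    then have "\<forall>\<^sub>F h in at_right 0. diagonal_op (\<theta> h) y = (1 / h) *\<^sub>R (heat h x - x)"
      by (auto intro!: eventually_at_rightI[of 0 1])
    ultimately show ?thesis
      unfolding generator_graph_def by (auto dest: Lim_transform_eventually)
  qed
  have "(x, y) \<in> generator_graph heat \<longleftrightarrow> (x, y) \<in> operator_graph D (\<lambda>x. - A x)" for x y
    unfolding negative_graph_iff_coordinates using 1 2 by blast
  then show ?thesis by auto
qed

text \<open>
  A semigroup maps the domain of its generator to itself and commutes with it, so \<open>S t (phi k)\<close> is
  again an eigenvector for \<open>lam k\<close>. As the eigenvalue is simple, it is a scalar multiple \<open>g t\<close> of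
  \<open>phi k\<close>. Then \<open>g\<close> is multiplicative with derivative \<open>- lam k\<close> at \<open>0\<close>, hence exponential, and
  density of the span of the eigenvectors does the rest.
\<close>
lemma semigroup_eq_heat:
  assumes S: "C0_semigroup smul S" and gen: "generator_graph S = operator_graph D (\<lambda>x. - A x)"
    and "t \<ge> 0"
  shows "S t x = heat t x"
proof -
  have op: "bounded_operator smul (S t)" if "t \<ge> 0" for t
    using S that by (simp add: C0_semigroup_def)
  have S0: "S 0 x = x" for x using S by (simp add: C0_semigroup_def)
  have add: "S (s + t) x = S s (S t x)" if "s \<ge> 0" "t \<ge> 0" for s t x
    using S that by (simp add: C0_semigroup_def)
  have lin: "bounded_linear (S t)" "\<And>c x. S t (smul c x) = smul c (S t x)" if "t \<ge> 0" for t
    using op[OF that] by (auto simp: bounded_operator_def)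
  have phi: "S t (phi k) = exp (- lam k * t) *\<^sub>R phi k" if k: "k \<ge> 1" and "t \<ge> 0" for k t
  proof -
    have g0: "((\<lambda>h. (1 / h) *\<^sub>R (S h (phi k) - phi k)) \<longlongrightarrow> - (lam k *\<^sub>R phi k)) (at_right 0)"
    proof -
      have "(phi k, - (lam k *\<^sub>R phi k)) \<in> generator_graph S"
        using eigenvector[OF k] by (force simp: gen operator_graph_def)
      then show ?thesis by (simp add: generator_graph_def)
    qed
    define g where "g t = ip (S t (phi k)) (phi k)" for t
    have Sg: "S t (phi k) = smul (g t) (phi k)" if "t \<ge> 0" for t
    proof -
      have "((\<lambda>h. S t ((1 / h) *\<^sub>R (S h (phi k) - phi k))) \<longlongrightarrow> S t (- (lam k *\<^sub>R phi k))) (at_right 0)"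
        by (rule bounded_linear.tendsto[OF lin(1)[OF that] g0])
      moreover have "S t ((1 / h) *\<^sub>R (S h (phi k) - phi k)) = (1 / h) *\<^sub>R (S h (S t (phi k)) - S t (phi k))"
        if "h > 0" for h
        using add[of t h "phi k"] add[of h t "phi k"] that \<open>t \<ge> 0\<close> bounded_linear.linear[OF lin(1)[OF \<open>t \<ge> 0\<close>]]
        by (simp add: linear_cmul linear_diff add.commute)
      then have "\<forall>\<^sub>F h in at_right 0. S t ((1 / h) *\<^sub>R (S h (phi k) - phi k)) = (1 / h) *\<^sub>R (S h (S t (phi k)) - S t (phi k))"
        by (auto intro!: eventually_at_rightI[of 0 1])
      ultimately have "(S t (phi k), S t (- (lam k *\<^sub>R phi k))) \<in> generator_graph S"
        unfolding generator_graph_def by (auto dest: Lim_transform_eventually)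
      then have "ip (S t (- (lam k *\<^sub>R phi k))) (phi j) = - lam j *\<^sub>R ip (S t (phi k)) (phi j)" if "j \<ge> 1" for j
        using that by (simp add: gen negative_graph_iff_coordinates)
      moreover have "S t (- (lam k *\<^sub>R phi k)) = - lam k *\<^sub>R S t (phi k)"
        using bounded_linear.linear[OF lin(1)[OF \<open>t \<ge> 0\<close>]] by (simp add: linear_cmul linear_neg)
      ultimately have *: "lam k *\<^sub>R ip (S t (phi k)) (phi j) = lam j *\<^sub>R ip (S t (phi k)) (phi j)" if "j \<ge> 1" for j
        using that by (simp add: ip_scaleR_left ip_minus_left)
      show ?thesis
      proof (rule eqI_phi)
        fix j :: nat assume "j \<ge> 1"
        then show "ip (S t (phi k)) (phi j) = ip (smul (g t) (phi k)) (phi j)"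
          using *[of j] simple[of j k] k by (cases "j = k") (auto simp: ip_smul_left ip_phi g_def)
      qed
    qed
    define f where "f t = exp (lam k * t) *\<^sub>R g t" for t
    have "f t = 1"
    proof (rule multiplicative_eq_1[OF _ _ _ \<open>t \<ge> 0\<close>])
      show "f 0 = 1" using k by (simp add: f_def g_def S0 ip_phi)
      show "f (s + t) = f s * f t" if "s \<ge> 0" "t \<ge> 0" for s t
      proof -
        have "S (s + t) (phi k) = S s (S t (phi k))" by (rule add[OF that])
        also have "\<dots> = smul (g t * g s) (phi k)"
          unfolding Sg[OF that(2)] lin(2)[OF that(1)] Sg[OF that(1)] by simp
        finally have "g (s + t) = g t * g s"
          using k by (simp add: g_def[of "s + t"] ip_smul_left ip_phi)
        then show ?thesis by (simp add: f_def exp_add algebra_simps)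
      qed
      have "((\<lambda>h. ip ((1 / h) *\<^sub>R (S h (phi k) - phi k)) (phi k)) \<longlongrightarrow> ip (- (lam k *\<^sub>R phi k)) (phi k)) (at_right 0)"
        by (rule bounded_linear.tendsto[OF bounded_linear_ip_left g0])
      then have "((\<lambda>h. (1 / h) *\<^sub>R (g h - 1)) \<longlongrightarrow> - of_real (lam k)) (at_right 0)"
        using k by (simp add: ip_scaleR_left ip_diff_left ip_minus_left ip_phi g_def of_real_def)
      then have "((\<lambda>h. exp (lam k * h) *\<^sub>R ((1 / h) *\<^sub>R (g h - 1)) + ((exp (lam k * h) - 1) / h) *\<^sub>R (1::'k))
          \<longlongrightarrow> exp (lam k * 0) *\<^sub>R (- of_real (lam k)) + lam k *\<^sub>R 1) (at_right 0)"
        by (intro tendsto_add tendsto_scaleR tendsto_const tendsto_exp tendsto_mult tendsto_ident_at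
            expm1_quotient_tendsto)
      moreover have "exp (lam k * h) *\<^sub>R ((1 / h) *\<^sub>R (g h - 1)) + ((exp (lam k * h) - 1) / h) *\<^sub>R (1::'k) = (1 / h) *\<^sub>R (f h - 1)" for h
        by (simp add: f_def algebra_simps divide_inverse)
      ultimately show "((\<lambda>h. (1 / h) *\<^sub>R (f h - 1)) \<longlongrightarrow> 0) (at_right 0)"
        by (simp add: of_real_def)
    qed
    then have "exp (- lam k * t) *\<^sub>R f t = exp (- lam k * t) *\<^sub>R 1" by simp
    then have "g t = exp (- lam k * t) *\<^sub>R 1"
      by (simp add: f_def exp_add[symmetric])
    then show ?thesis using Sg[OF \<open>t \<ge> 0\<close>] smul_of_real[of "exp (- lam k * t)" "phi k"] by (simp add: of_real_def)
  qed
  have "(\<lambda>n. S t (partial_expansion n x)) \<longlonglongrightarrow> S t x"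
    by (rule bounded_linear.tendsto[OF lin(1)[OF \<open>t \<ge> 0\<close>] partial_expansion_tendsto])
  moreover have "S t (partial_expansion n x) = heat t (partial_expansion n x)" for n
  proof -
    have h: "heat t (smul c y) = smul c (heat t y)" for c y
      using bounded_operator_heat[of t] by (simp add: bounded_operator_def)
    have hp: "heat t (phi k) = exp (- lam k * t) *\<^sub>R phi k" if "k \<ge> 1" for k
      using that \<open>t \<ge> 0\<close> unfolding heat_def by (subst diagonal_op_phi) (simp_all add: lam_nonneg)
    have hl: "linear (heat t)"
      using bounded_operator_heat[of t] by (auto simp: bounded_operator_def dest: bounded_linear.linear)
    show ?thesis
      unfolding partial_expansion_def linear_sum[OF bounded_linear.linear[OF lin(1)[OF \<open>t \<ge> 0\<close>]]] linear_sum[OF hl]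
      using \<open>t \<ge> 0\<close> by (intro sum.cong) (simp_all add: lin(2) h hp phi)
  qed
  moreover have "(\<lambda>n. heat t (partial_expansion n x)) \<longlonglongrightarrow> heat t x"
    using bounded_operator_heat[of t]
    by (intro bounded_linear.tendsto[OF _ partial_expansion_tendsto]) (simp add: bounded_operator_def)
  ultimately show ?thesis using LIMSEQ_unique by auto
qed

lemma exp_semigroup_eq_heat: "t \<ge> 0 \<Longrightarrow> exp_semigroup smul D A t = heat t"
proof -
  assume "t \<ge> 0"
  have "C0_semigroup smul (exp_semigroup smul D A) \<and>
      generator_graph (exp_semigroup smul D A) = operator_graph D (\<lambda>x. - A x)"
    unfolding exp_semigroup_def
    by (rule someI[of _ heat]) (simp add: C0_semigroup_heat generator_graph_heat)
  then show ?thesis using semigroup_eq_heat[OF _ _ \<open>t \<ge> 0\<close>] by blast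
qed

end

section \<open>Mild solutions of boundedly perturbed contraction semigroups\<close>

lemma norm_integral_indicator_le:
  fixes f :: "real \<Rightarrow> 'x::{banach,second_countable_topology}"
  assumes f: "f \<in> borel_measurable borel" and M: "\<And>s. 0 \<le> s \<Longrightarrow> s < t \<Longrightarrow> norm (f s) \<le> M" and "t \<ge> 0"
  shows "integrable lborel (\<lambda>s. indicator {0..<t} s *\<^sub>R f s)"
    and "norm (\<integral>s. indicator {0..<t} s *\<^sub>R f s \<partial>lborel) \<le> t * M"
proof -
  show int: "integrable lborel (\<lambda>s. indicator {0..<t} s *\<^sub>R f s)"
    using f M by (intro integrableI_bounded_set_indicator[where B = M] emeasure_bounded_finite) auto
  have intM: "integrable lborel (\<lambda>s. indicator {0..<t} s *\<^sub>R M)"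
    by (intro integrableI_bounded_set_indicator[where B = "\<bar>M\<bar>"] emeasure_bounded_finite) auto
  have "norm (\<integral>s. indicator {0..<t} s *\<^sub>R f s \<partial>lborel) \<le> (\<integral>s. indicator {0..<t} s *\<^sub>R M \<partial>lborel)"
    using M by (intro Bochner_Integration.integral_norm_bound_integral int intM) (simp add: indicator_def)
  also have "\<dots> = t * M"
    using \<open>t \<ge> 0\<close> by simp
  finally show "norm (\<integral>s. indicator {0..<t} s *\<^sub>R f s \<partial>lborel) \<le> t * M" .
qed

text \<open>
  A substitute for Gronwall's inequality: when the feedback constant is at most one half, a bound
  in terms of the running supremum closes up at the maximum point.
\<close>
lemma bound_of_half_selfbound:
  fixes v :: "real \<Rightarrow> 'a::real_normed_vector"
  assumes cont: "continuous_on {0..T} v"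
    and self: "\<And>t d. t \<in> {0..T} \<Longrightarrow> (\<And>s. s \<in> {0..t} \<Longrightarrow> norm (v s) \<le> d) \<Longrightarrow> norm (v t) \<le> c + d / 2"
    and t: "t \<in> {0..T}"
  shows "norm (v t) \<le> 2 * c"
proof -
  have "\<exists>r\<in>{0..T}. \<forall>s\<in>{0..T}. norm (v s) \<le> norm (v r)"
    using t by (intro continuous_attains_sup continuous_on_norm cont) auto
  then obtain r where r: "r \<in> {0..T}" "\<And>s. s \<in> {0..T} \<Longrightarrow> norm (v s) \<le> norm (v r)" by blast
  have "norm (v r) \<le> c + norm (v r) / 2"
    using r by (intro self) auto
  with r(2)[OF t] show ?thesis by simp
qed

text \<open>
  The semigroup is continued by the identity to negative times. Integrands such as
  \<open>\<lambda>s. S (t - s) (f s)\<close> are then Borel functions on the whole line.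
\<close>
locale contraction_semigroup =
  fixes S :: "real \<Rightarrow> 'x::{banach,second_countable_topology} \<Rightarrow> 'x"
  assumes linear: "bounded_linear (S t)"
    and contraction: "norm (S t x) \<le> norm x"
    and nonpos: "t \<le> 0 \<Longrightarrow> S t x = x"
    and semigroup: "s \<ge> 0 \<Longrightarrow> t \<ge> 0 \<Longrightarrow> S (s + t) x = S s (S t x)"
    and strongly_continuous: "continuous_on UNIV (\<lambda>t. S t x)"
begin

lemma S_diff: "S t (x - y) = S t x - S t y"
  by (rule linear_diff[OF bounded_linear.linear[OF linear]])

lemma jointly_continuous: "continuous_on UNIV (\<lambda>z. S (fst z) (snd z))"
proof (rule continuous_on_sequentiallyI)
  fix u :: "nat \<Rightarrow> real \<times> 'x" and a :: "real \<times> 'x"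
  assume u: "u \<longlonglongrightarrow> a"
  have "(\<lambda>n. S (fst (u n)) (snd a)) \<longlonglongrightarrow> S (fst a) (snd a)"
    using continuous_on_tendsto_compose[OF strongly_continuous[of "snd a"] tendsto_fst[OF u]] by simp
  moreover have "(\<lambda>n. S (fst (u n)) (snd (u n) - snd a)) \<longlonglongrightarrow> 0"
  proof (rule Lim_null_comparison)
    show "\<forall>\<^sub>F n in sequentially. norm (S (fst (u n)) (snd (u n) - snd a)) \<le> norm (snd (u n) - snd a)"
      by (simp add: contraction)
    show "(\<lambda>n. norm (snd (u n) - snd a)) \<longlonglongrightarrow> 0"
      using tendsto_snd[OF u] by (simp add: tendsto_norm_zero_iff LIM_zero_iff)
  qed
  ultimately have "(\<lambda>n. S (fst (u n)) (snd a) + S (fst (u n)) (snd (u n) - snd a)) \<longlonglongrightarrow> S (fst a) (snd a) + 0"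
    by (rule tendsto_add)
  then show "(\<lambda>n. S (fst (u n)) (snd (u n))) \<longlonglongrightarrow> S (fst a) (snd a)"
    by (simp add: S_diff)
qed

lemma measurable_S:
  assumes f: "f \<in> borel_measurable borel"
  shows "(\<lambda>s. S (t - s) (f s)) \<in> borel_measurable borel"
proof -
  have "(\<lambda>s. (t - s, f s)) \<in> borel_measurable borel"
    using f by (intro borel_measurable_Pair) auto
  from borel_measurable_continuous_on[OF jointly_continuous this] show ?thesis by simp
qed

text \<open>
  With the half-open interval of integration, restarting at a later time splits the integral
  without overlap, and the values of \<open>f\<close> at the end point of a control interval are irrelevant.
\<close>
definition duhamel :: "(real \<Rightarrow> 'x) \<Rightarrow> real \<Rightarrow> 'x"
  where "duhamel f t = (\<integral>s. indicator {0..<t} s *\<^sub>R S (t - s) (f s) \<partial>lborel)"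

lemma
  assumes f: "f \<in> borel_measurable borel" and M: "\<And>s. 0 \<le> s \<Longrightarrow> s < t \<Longrightarrow> norm (f s) \<le> M" and "t \<ge> 0"
  shows integrable_duhamel: "integrable lborel (\<lambda>s. indicator {0..<t} s *\<^sub>R S (t - s) (f s))"
    and norm_duhamel_le: "norm (duhamel f t) \<le> t * M"
  using norm_integral_indicator_le[OF measurable_S[OF f], of t t M] order_trans[OF contraction M] \<open>t \<ge> 0\<close>
  by (simp_all add: duhamel_def)

lemma duhamel_diff:
  assumes f: "f \<in> borel_measurable borel" "\<And>s. 0 \<le> s \<Longrightarrow> s < t \<Longrightarrow> norm (f s) \<le> M"
    and g: "g \<in> borel_measurable borel" "\<And>s. 0 \<le> s \<Longrightarrow> s < t \<Longrightarrow> norm (g s) \<le> N" and "t \<ge> 0"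
  shows "duhamel (\<lambda>s. f s - g s) t = duhamel f t - duhamel g t"
  using integrable_duhamel[OF f \<open>t \<ge> 0\<close>] integrable_duhamel[OF g \<open>t \<ge> 0\<close>]
  by (simp add: duhamel_def S_diff scaleR_diff_right)

lemma duhamel_cong:
  assumes "\<And>s. 0 \<le> s \<Longrightarrow> s < t \<Longrightarrow> f s = g s"
  shows "duhamel f t = duhamel g t"
  unfolding duhamel_def by (rule Bochner_Integration.integral_cong) (auto simp: indicator_def assms)

lemma continuous_on_duhamel:
  assumes f: "f \<in> borel_measurable borel" and M: "\<And>s. norm (f s) \<le> M"
  shows "continuous_on UNIV (duhamel f)"
proof (rule continuous_on_sequentiallyI)
  fix u :: "nat \<Rightarrow> real" and a
  assume u: "u \<longlonglongrightarrow> a"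
  then have "Bseq u"
    by (intro convergent_imp_Bseq convergentI)
  then obtain K where K: "\<And>n. \<bar>u n\<bar> \<le> K"
    unfolding Bseq_def real_norm_def by blast
  show "(\<lambda>n. duhamel f (u n)) \<longlonglongrightarrow> duhamel f a"
    unfolding duhamel_def
  proof (rule integral_dominated_convergence)
    have m: "(\<lambda>s. indicator {0..<t} s *\<^sub>R S (t - s) (f s)) \<in> borel_measurable lborel" for t
      using measurable_S[OF f, of t] by simp
    show "(\<lambda>s. indicator {0..<a} s *\<^sub>R S (a - s) (f s)) \<in> borel_measurable lborel"
      "(\<lambda>s. indicator {0..<u n} s *\<^sub>R S (u n - s) (f s)) \<in> borel_measurable lborel" for n
      by (rule m)+
    show "integrable lborel (\<lambda>s. indicator {0..<K} s *\<^sub>R M)"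
      by (intro integrableI_bounded_set_indicator[where B = "\<bar>M\<bar>"] emeasure_bounded_finite) auto
    have "M \<ge> 0" using M[of 0] norm_ge_zero order_trans by blast
    then have "norm (indicator {0..<u n} s *\<^sub>R S (u n - s) (f s)) \<le> indicator {0..<K} s *\<^sub>R M" for n s
      using K[of n] order_trans[OF contraction M, of "u n - s" s] by (auto simp: indicator_def)
    then show "AE s in lborel. norm (indicator {0..<u n} s *\<^sub>R S (u n - s) (f s)) \<le> indicator {0..<K} s *\<^sub>R M" for n
      by simp
    show "AE s in lborel. (\<lambda>n. indicator {0..<u n} s *\<^sub>R S (u n - s) (f s))
        \<longlonglongrightarrow> indicator {0..<a} s *\<^sub>R S (a - s) (f s)"
      using AE_lborel_singleton[of a]
    proof eventually_elim
      case (elim s)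
      have "\<forall>\<^sub>F n in sequentially. indicator {0..<u n} s = (indicator {0..<a} s :: real)"
      proof (cases "s < a")
        case True
        from order_tendstoD(1)[OF u this] show ?thesis
          by eventually_elim (use True in \<open>simp add: indicator_def\<close>)
      next
        case False
        then have "a < s" using elim by simp
        from order_tendstoD(2)[OF u this] show ?thesis
          by eventually_elim (use False in \<open>simp add: indicator_def\<close>)
      qed
      then have "(\<lambda>n. indicator {0..<u n} s :: real) \<longlonglongrightarrow> indicator {0..<a} s"
        by (rule tendsto_eventually)
      moreover have "(\<lambda>n. S (u n - s) (f s)) \<longlonglongrightarrow> S (a - s) (f s)"
        using continuous_on_tendsto_compose[OF strongly_continuous[of "f s"] tendsto_diff[OF u tendsto_const]]
        by simp
      ultimately show ?case by (rule tendsto_scaleR)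
    qed
  qed
qed

text \<open>
  The forcing before time \<open>a\<close> is carried on by the semigroup, the later forcing is shifted to start at \<open>0\<close>.
\<close>
lemma duhamel_restart:
  assumes f: "f \<in> borel_measurable borel" and M: "\<And>s. 0 \<le> s \<Longrightarrow> s < a + t \<Longrightarrow> norm (f s) \<le> M"
    and "a \<ge> 0" "t \<ge> 0"
  shows "duhamel f (a + t) = S t (duhamel f a) + duhamel (\<lambda>s. f (a + s)) t"
proof -
  let ?g = "\<lambda>s. S (a + t - s) (f s)"
  have "integrable lborel (\<lambda>s. indicator {0..<a} s *\<^sub>R ?g s)"
    using \<open>t \<ge> 0\<close> \<open>a \<ge> 0\<close> by (intro norm_integral_indicator_le(1)[where M = M] measurable_S[OF f] order_trans[OF contraction M]) auto
  moreover have "integrable lborel (\<lambda>s. indicator {a..<a + t} s *\<^sub>R ?g s)"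
    using \<open>t \<ge> 0\<close> \<open>a \<ge> 0\<close> order_trans[OF contraction M]
    by (intro integrableI_bounded_set_indicator[where B = M] emeasure_bounded_finite) (auto intro: measurable_S[OF f])
  ultimately have "(\<integral>s. indicator {0..<a} s *\<^sub>R ?g s + indicator {a..<a + t} s *\<^sub>R ?g s \<partial>lborel)
      = (\<integral>s. indicator {0..<a} s *\<^sub>R ?g s \<partial>lborel) + (\<integral>s. indicator {a..<a + t} s *\<^sub>R ?g s \<partial>lborel)"
    by (rule Bochner_Integration.integral_add)
  moreover have "indicator {0..<a} s *\<^sub>R ?g s + indicator {a..<a + t} s *\<^sub>R ?g s = indicator {0..<a + t} s *\<^sub>R ?g s" for s
    using \<open>a \<ge> 0\<close> \<open>t \<ge> 0\<close> by (simp add: indicator_def)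
  ultimately have split: "duhamel f (a + t) = (\<integral>s. indicator {0..<a} s *\<^sub>R ?g s \<partial>lborel)
      + (\<integral>s. indicator {a..<a + t} s *\<^sub>R ?g s \<partial>lborel)"
    by (simp add: duhamel_def)
  have eq: "indicator {0..<a} s *\<^sub>R ?g s = S t (indicator {0..<a} s *\<^sub>R S (a - s) (f s))" for s
  proof (cases "s \<in> {0..<a}")
    case True
    then have "S (t + (a - s)) (f s) = S t (S (a - s) (f s))"
      using \<open>t \<ge> 0\<close> by (intro semigroup) auto
    with True show ?thesis by (simp add: algebra_simps)
  qed (simp add: linear_0[OF bounded_linear.linear[OF linear]])
  have "(\<integral>s. indicator {0..<a} s *\<^sub>R ?g s \<partial>lborel) = S t (duhamel f a)"
    unfolding duhamel_def eq
    by (intro integral_bounded_linear linear integrable_duhamel[where M = M]) (use f M \<open>a \<ge> 0\<close> \<open>t \<ge> 0\<close> in auto)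
  moreover have "(\<integral>s. indicator {a..<a + t} s *\<^sub>R ?g s \<partial>lborel) = duhamel (\<lambda>s. f (a + s)) t"
    unfolding duhamel_def
    by (subst lborel_integral_real_affine[where c = 1 and t = a])
      (auto intro!: Bochner_Integration.integral_cong simp: indicator_def algebra_simps)
  ultimately show ?thesis by (simp add: split)
qed

text \<open>
  The path lives on the whole line, so that \<open>\<lambda>s. G s (w s)\<close> is globally measurable; only its values
  on \<open>[0,T]\<close> are constrained.
\<close>
definition mild :: "(real \<Rightarrow> 'x \<Rightarrow> 'x) \<Rightarrow> real \<Rightarrow> 'x \<Rightarrow> (real \<Rightarrow> 'x) \<Rightarrow> bool"
  where "mild G T w0 w \<longleftrightarrow> continuous_on UNIV w \<and>
    (\<forall>t\<in>{0..T}. w t = S t w0 - duhamel (\<lambda>s. G s (w s)) t)"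

lemma mildD:
  assumes "mild G T w0 w"
  shows "continuous_on UNIV w" "t \<in> {0..T} \<Longrightarrow> w t = S t w0 - duhamel (\<lambda>s. G s (w s)) t"
  using assms by (simp_all add: mild_def)

lemma mild_cong:
  assumes "mild G T w0 w" and "\<And>s x. 0 \<le> s \<Longrightarrow> s < T \<Longrightarrow> G s x = G' s x"
  shows "mild G' T w0 w"
  unfolding mild_def
proof (intro conjI ballI)
  show "continuous_on UNIV w" by (rule mildD(1)[OF assms(1)])
  fix t assume t: "t \<in> {0..T}"
  have "duhamel (\<lambda>s. G s (w s)) t = duhamel (\<lambda>s. G' s (w s)) t"
    using t by (intro duhamel_cong assms(2)) auto
  then show "w t = S t w0 - duhamel (\<lambda>s. G' s (w s)) t"
    using mildD(2)[OF assms(1) t] by simp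
qed

end

context hilbert_basis
begin

text \<open>
  Strong continuity at any time reduces to continuity at \<open>0\<close>, because by the semigroup law
  \<open>dist (S s x) (S t x) \<le> dist (S \<bar>s - t\<bar> x) x\<close> for \<open>s, t \<ge> 0\<close>.
\<close>
lemma contraction_semigroup_diagonal:
  assumes nonneg: "\<And>k. k \<ge> 1 \<Longrightarrow> \<nu> k \<ge> 0"
  shows "contraction_semigroup (\<lambda>t. diagonal_op (\<lambda>k. exp (- \<nu> k * max 0 t)))"
proof -
  let ?S = "\<lambda>t. diagonal_op (\<lambda>k. exp (- \<nu> k * max 0 t))"
  have le: "\<bar>exp (- \<nu> k * max 0 t)\<bar> \<le> 1" if "k \<ge> 1" for k t
    using nonneg[OF that] by simp
  have ip: "ip (?S t x) (phi k) = exp (- \<nu> k * max 0 t) *\<^sub>R ip x (phi k)" if "k \<ge> 1" for t x k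
    by (rule ip_diagonal_op[OF le that])
  have lin: "bounded_linear (?S t)" for t
    using bounded_operator_diagonal_op[OF le] by (simp add: bounded_operator_def)
  have add: "?S (s + t) x = ?S s (?S t x)" if "s \<ge> 0" "t \<ge> 0" for s t x
  proof (rule eqI_phi)
    fix k :: nat assume k: "k \<ge> 1"
    show "ip (?S (s + t) x) (phi k) = ip (?S s (?S t x)) (phi k)"
      unfolding ip[OF k] using that by (simp add: exp_add[symmetric] algebra_simps)
  qed
  have dist: "dist (?S s x) (?S t x) \<le> dist (?S \<bar>max 0 s - max 0 t\<bar> x) x" for s t x
  proof -
    have *: "dist (?S s x) (?S t x) \<le> dist (?S \<bar>max 0 s - max 0 t\<bar> x) x" if "t \<le> s" for s t
    proof -
      have "?S s x = ?S (max 0 t + (max 0 s - max 0 t)) x" by simp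
      also have "\<dots> = ?S (max 0 t) (?S (max 0 s - max 0 t) x)"
        using that by (intro add) auto
      finally have "?S s x = ?S t (?S (max 0 s - max 0 t) x)" by simp
      then have "dist (?S s x) (?S t x) = norm (?S t (?S (max 0 s - max 0 t) x - x))"
        by (simp only: dist_norm linear_diff[OF bounded_linear.linear[OF lin]])
      also have "\<dots> \<le> norm (?S (max 0 s - max 0 t) x - x)"
        by (rule norm_diagonal_op_le[OF le])
      finally show ?thesis using that by (simp add: dist_norm)
    qed
    show ?thesis
      using *[of t s] *[of s t] by (cases "t \<le> s") (simp_all add: dist_commute abs_minus_commute)
  qed
  show ?thesis
  proof (rule contraction_semigroup.intro)
    show "continuous_on UNIV (\<lambda>t. ?S t x)" for x
      unfolding continuous_on_def
    proof
      fix t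
      have "((\<lambda>s. ?S \<bar>max 0 s - max 0 t\<bar> x) \<longlongrightarrow> x) (at t)"
      proof (rule diagonal_op_tendsto_id[OF le])
        fix k
        have "((\<lambda>s. exp (- \<nu> k * max 0 \<bar>max 0 s - max 0 t\<bar>)) \<longlongrightarrow> exp (- \<nu> k * max 0 \<bar>max 0 t - max 0 t\<bar>)) (at t)"
          by (intro tendsto_intros)
        then show "((\<lambda>s. exp (- \<nu> k * max 0 \<bar>max 0 s - max 0 t\<bar>)) \<longlongrightarrow> 1) (at t)" by simp
      qed
      then have lim: "((\<lambda>s. dist (?S \<bar>max 0 s - max 0 t\<bar> x) x) \<longlongrightarrow> 0) (at t)"
        by (rule tendsto_dist_iff[THEN iffD1])
      have "((\<lambda>s. dist (?S s x) (?S t x)) \<longlongrightarrow> 0) (at t)"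
        by (rule tendsto_sandwich[OF _ _ tendsto_const lim]) (rule always_eventually allI zero_le_dist dist)+
      then show "((\<lambda>s. ?S s x) \<longlongrightarrow> ?S t x) (at t within UNIV)"
        by (rule tendsto_dist_iff[THEN iffD2])
    qed
    show "?S t x = x" if "t \<le> 0" for t x
    proof (rule eqI_phi)
      fix k :: nat assume k: "k \<ge> 1"
      show "ip (?S t x) (phi k) = ip x (phi k)"
        unfolding ip[OF k] using that by simp
    qed
    show "bounded_linear (?S t)" for t by (rule lin)
    show "norm (?S t x) \<le> norm x" for t x by (rule norm_diagonal_op_le[OF le])
    show "?S (s + t) x = ?S s (?S t x)" if "0 \<le> s" "0 \<le> t" for s t x by (rule add[OF that])
  qed
qed

end

locale bounded_perturbation =
  fixes G :: "real \<Rightarrow> 'x::{banach,second_countable_topology} \<Rightarrow> 'x" and \<kappa> :: real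
  assumes G_diff: "G s (x - y) = G s x - G s y"
    and G_bound: "norm (G s x) \<le> \<kappa> * norm x"
    and G_measurable: "continuous_on UNIV w \<Longrightarrow> (\<lambda>s. G s (w s)) \<in> borel_measurable borel"
begin

lemma norm_G_le: "norm x \<le> d \<Longrightarrow> norm (G s x) \<le> \<bar>\<kappa>\<bar> * d"
  by (meson G_bound abs_ge_self abs_ge_zero mult_mono norm_ge_zero order_trans)

lemma bounded_along_path:
  assumes "continuous_on UNIV w"
  shows "\<exists>M. \<forall>s. 0 \<le> s \<longrightarrow> s \<le> T \<longrightarrow> norm (G s (w s)) \<le> M"
proof -
  have "compact (w ` {0..T})"
    by (intro compact_continuous_image continuous_on_subset[OF assms]) auto
  then obtain d where d: "\<And>s. s \<in> {0..T} \<Longrightarrow> norm (w s) \<le> d"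
    by (metis compact_imp_bounded bounded_iff imageI)
  have "norm (G s (w s)) \<le> \<bar>\<kappa>\<bar> * d" if "0 \<le> s" "s \<le> T" for s
    using that d by (intro norm_G_le) auto
  then show ?thesis by blast
qed

end

locale perturbed_semigroup = contraction_semigroup S + bounded_perturbation G \<kappa>
  for S :: "real \<Rightarrow> 'x::{banach,second_countable_topology} \<Rightarrow> 'x" and G :: "real \<Rightarrow> 'x \<Rightarrow> 'x" and \<kappa>
begin

lemma norm_duhamel_G_le:
  assumes w: "continuous_on UNIV w" and d: "\<And>s. 0 \<le> s \<Longrightarrow> s < t \<Longrightarrow> norm (w s) \<le> d" and "t \<ge> 0"
  shows "norm (duhamel (\<lambda>s. G s (w s)) t) \<le> t * (\<bar>\<kappa>\<bar> * d)"
  by (rule norm_duhamel_le[OF G_measurable[OF w] norm_G_le[OF d] \<open>t \<ge> 0\<close>])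

lemma duhamel_G_diff:
  assumes w: "continuous_on UNIV w" and v: "continuous_on UNIV v" and "t \<ge> 0"
  shows "duhamel (\<lambda>s. G s (w s)) t - duhamel (\<lambda>s. G s (v s)) t = duhamel (\<lambda>s. G s (w s - v s)) t"
proof -
  obtain M where M: "\<And>s. 0 \<le> s \<Longrightarrow> s \<le> t \<Longrightarrow> norm (G s (w s)) \<le> M" using bounded_along_path[OF w] by metis
  obtain N where N: "\<And>s. 0 \<le> s \<Longrightarrow> s \<le> t \<Longrightarrow> norm (G s (v s)) \<le> N" using bounded_along_path[OF v] by metis
  show ?thesis
    unfolding G_diff using \<open>t \<ge> 0\<close>
    by (intro duhamel_diff[symmetric] G_measurable w v) (auto intro: M N)
qed

lemma mild_unique:
  assumes w: "mild G T w0 w" and v: "mild G T w0 v" and small: "T * \<bar>\<kappa>\<bar> \<le> 1 / 2" and t: "t \<in> {0..T}"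
  shows "w t = v t"
proof -
  have cont: "continuous_on UNIV w" "continuous_on UNIV v"
    using w v by (simp_all add: mild_def)
  have "norm (w t - v t) \<le> 2 * 0"
  proof (rule bound_of_half_selfbound[OF _ _ t])
    show "continuous_on {0..T} (\<lambda>t. w t - v t)"
      by (intro continuous_on_diff continuous_on_subset[OF cont(1)] continuous_on_subset[OF cont(2)]) auto
    fix t d assume t: "t \<in> {0..T}" and d: "\<And>s. s \<in> {0..t} \<Longrightarrow> norm (w s - v s) \<le> d"
    have "d \<ge> 0" using order_trans[OF norm_ge_zero d[of 0]] t by simp
    have "w t - v t = duhamel (\<lambda>s. G s (v s)) t - duhamel (\<lambda>s. G s (w s)) t"
      using w v t by (simp add: mild_def)
    also have "\<dots> = duhamel (\<lambda>s. G s (v s - w s)) t"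
      using t by (intro duhamel_G_diff cont) auto
    also have "norm \<dots> \<le> t * (\<bar>\<kappa>\<bar> * d)"
      using t d by (intro norm_duhamel_G_le continuous_on_diff cont) (auto simp: norm_minus_commute)
    also have "\<dots> \<le> T * (\<bar>\<kappa>\<bar> * d)"
      using t \<open>d \<ge> 0\<close> by (intro mult_right_mono) auto
    also have "\<dots> \<le> 1 / 2 * d"
      unfolding mult.assoc[symmetric] using \<open>d \<ge> 0\<close> small by (intro mult_right_mono) auto
    finally show "norm (w t - v t) \<le> 0 + d / 2" by simp
  qed
  then show ?thesis by simp
qed

text \<open>
  Picard iteration in one go: on bounded continuous functions of the whole line, with time clamped
  to \<open>[0,T]\<close>, the Duhamel map is a contraction with factor one half.
\<close>
lemma mild_exists:
  assumes small: "T * \<bar>\<kappa>\<bar> \<le> 1 / 2" and "T \<ge> 0"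
  shows "\<exists>w. mild G T w0 w"
proof -
  \<comment> \<open>Time is clamped to the interval so that the fixed point is sought among functions on the whole line.\<close>
  define cl where "cl t = min T (max 0 t)" for t
  have cl: "cl t \<in> {0..T}" "t \<in> {0..T} \<Longrightarrow> cl t = t" for t
    using \<open>T \<ge> 0\<close> by (auto simp: cl_def)
  have cl_cont: "continuous_on UNIV cl"
    unfolding cl_def by (intro continuous_intros)
  define \<Phi> where "\<Phi> w t = S (cl t) w0 - duhamel (\<lambda>s. G s (apply_bcontfun w s)) (cl t)" for w t
  have \<Phi>: "\<Phi> w \<in> bcontfun" for w
  proof (rule bcontfun_normI)
    have bd: "norm (apply_bcontfun w s) \<le> norm w" for s by (rule norm_bounded)
    have "continuous_on UNIV (duhamel (\<lambda>s. G s (apply_bcontfun w s)))"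
      by (rule continuous_on_duhamel[OF G_measurable norm_G_le[OF bd]]) auto
    then have "continuous_on UNIV (\<lambda>t. duhamel (\<lambda>s. G s (apply_bcontfun w s)) (cl t))"
      by (rule continuous_on_compose2[OF _ cl_cont]) auto
    moreover have "continuous_on UNIV (\<lambda>t. S (cl t) w0)"
      by (rule continuous_on_compose2[OF strongly_continuous cl_cont]) auto
    ultimately show "continuous_on UNIV (\<Phi> w)"
      unfolding \<Phi>_def by (intro continuous_on_diff)
    fix t
    have "norm (duhamel (\<lambda>s. G s (apply_bcontfun w s)) (cl t)) \<le> cl t * (\<bar>\<kappa>\<bar> * norm w)"
      using cl(1)[of t] bd by (intro norm_duhamel_G_le) auto
    also have "\<dots> \<le> T * (\<bar>\<kappa>\<bar> * norm w)"
      using cl(1)[of t] by (intro mult_right_mono) auto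
    finally show "norm (\<Phi> w t) \<le> norm w0 + T * (\<bar>\<kappa>\<bar> * norm w)"
      unfolding \<Phi>_def by (intro order_trans[OF norm_triangle_ineq4] add_mono contraction)
  qed
  have "\<exists>!w. Bcontfun (\<Phi> w) = w"
  proof (rule banach_fix_type[of "1 / 2"])
    show "\<forall>w v. dist (Bcontfun (\<Phi> w)) (Bcontfun (\<Phi> v)) \<le> 1 / 2 * dist w v"
    proof (intro allI dist_bound)
      fix w v :: "real \<Rightarrow>\<^sub>C 'x" and t
      have bd: "norm (apply_bcontfun v s - apply_bcontfun w s) \<le> dist w v" for s
        using dist_bounded[of w s v] by (simp add: dist_norm norm_minus_commute)
      have "dist (apply_bcontfun (Bcontfun (\<Phi> w)) t) (apply_bcontfun (Bcontfun (\<Phi> v)) t)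
          = norm (duhamel (\<lambda>s. G s (apply_bcontfun v s)) (cl t) - duhamel (\<lambda>s. G s (apply_bcontfun w s)) (cl t))"
        by (simp add: Bcontfun_inverse \<Phi> dist_norm) (simp add: \<Phi>_def)
      also have "\<dots> = norm (duhamel (\<lambda>s. G s (apply_bcontfun v s - apply_bcontfun w s)) (cl t))"
        using cl(1)[of t] by (subst duhamel_G_diff) auto
      also have "\<dots> \<le> cl t * (\<bar>\<kappa>\<bar> * dist w v)"
        using cl(1)[of t] by (intro norm_duhamel_G_le continuous_on_diff bd) auto
      also have "\<dots> \<le> T * (\<bar>\<kappa>\<bar> * dist w v)"
        using cl(1)[of t] by (intro mult_right_mono) auto
      also have "\<dots> \<le> 1 / 2 * dist w v"
        unfolding mult.assoc[symmetric] using small by (intro mult_right_mono) auto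
      finally show "dist (apply_bcontfun (Bcontfun (\<Phi> w)) t) (apply_bcontfun (Bcontfun (\<Phi> v)) t) \<le> 1 / 2 * dist w v" .
    qed
  qed auto
  then obtain w where w: "Bcontfun (\<Phi> w) = w" by blast
  then have fixp: "apply_bcontfun w t = \<Phi> w t" for t
    using Bcontfun_inverse[OF \<Phi>[of w]] by metis
  have "mild G T w0 (apply_bcontfun w)"
    unfolding mild_def
  proof (intro conjI ballI)
    fix t assume "t \<in> {0..T}"
    then show "apply_bcontfun w t = S t w0 - duhamel (\<lambda>s. G s (apply_bcontfun w s)) t"
      using fixp[of t] by (simp only: \<Phi>_def cl(2))
  qed auto
  then show ?thesis by blast
qed

lemma mild_restart:
  assumes w: "mild G T w0 w" and "a \<ge> 0" "a + T' \<le> T"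
  shows "mild (\<lambda>s. G (a + s)) T' (w a) (\<lambda>s. w (a + s))"
  unfolding mild_def
proof (intro conjI ballI)
  have cont: "continuous_on UNIV w" using w by (simp add: mild_def)
  show "continuous_on UNIV (\<lambda>s. w (a + s))"
    by (rule continuous_on_compose2[OF cont]) (auto intro: continuous_intros)
  fix t assume t: "t \<in> {0..T'}"
  obtain M where M: "\<And>s. 0 \<le> s \<Longrightarrow> s \<le> a + t \<Longrightarrow> norm (G s (w s)) \<le> M" using bounded_along_path[OF cont] by metis
  have "w (a + t) = S (a + t) w0 - duhamel (\<lambda>s. G s (w s)) (a + t)"
    using w t \<open>a \<ge> 0\<close> \<open>a + T' \<le> T\<close> by (simp add: mild_def)
  also have "duhamel (\<lambda>s. G s (w s)) (a + t) = S t (duhamel (\<lambda>s. G s (w s)) a) + duhamel (\<lambda>s. G (a + s) (w (a + s))) t"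
    using t \<open>a \<ge> 0\<close> M by (intro duhamel_restart[where M = M] G_measurable cont) auto
  also have "S (a + t) w0 = S t (S a w0)"
    using semigroup[of t a w0] t \<open>a \<ge> 0\<close> by (simp add: add.commute)
  also have "w a = S a w0 - duhamel (\<lambda>s. G s (w s)) a"
    using w t \<open>a \<ge> 0\<close> \<open>a + T' \<le> T\<close> by (simp add: mild_def)
  then have "S t (S a w0) = S t (w a) + S t (duhamel (\<lambda>s. G s (w s)) a)"
    by (simp add: S_diff)
  finally show "w (a + t) = S t (w a) - duhamel (\<lambda>s. G (a + s) (w (a + s))) t"
    by simp
qed

end

section \<open>Finite moment problems\<close>

lemma abs_coeff_prod_linear_le:
  fixes a b :: "nat \<Rightarrow> real"
  shows "\<bar>coeff (\<Prod>j\<in>F. [:a j, b j:]) i\<bar> \<le> (\<Prod>j\<in>F. \<bar>a j\<bar> + \<bar>b j\<bar>)"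
proof (induction F arbitrary: i rule: infinite_finite_induct)
  case (insert k F)
  let ?Q = "\<Prod>j\<in>F. [:a j, b j:]"
  let ?M = "\<Prod>j\<in>F. \<bar>a j\<bar> + \<bar>b j\<bar>"
  have "coeff ([:a k, b k:] * ?Q) i = a k * coeff ?Q i + b k * (case i of 0 \<Rightarrow> 0 | Suc l \<Rightarrow> coeff ?Q l)"
    by (simp add: mult_pCons_left coeff_pCons split: nat.split)
  also have "\<bar>\<dots>\<bar> \<le> \<bar>a k\<bar> * ?M + \<bar>b k\<bar> * ?M"
  proof (rule order_trans[OF abs_triangle_ineq], unfold abs_mult, intro add_mono mult_left_mono abs_ge_zero)
    show "\<bar>coeff ?Q i\<bar> \<le> ?M" by (rule insert.IH)
    show "\<bar>case i of 0 \<Rightarrow> 0 | Suc l \<Rightarrow> coeff ?Q l\<bar> \<le> ?M"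
      using insert.IH by (simp split: nat.split add: prod_nonneg)
  qed
  finally show ?case using insert.hyps by (simp add: algebra_simps)
qed (simp_all add: one_pCons coeff_pCons split: nat.split)

text \<open>
  The coefficients \<open>c i\<close> are combinations of the coefficients of the Lagrange basis polynomials. In the
  form \<open>\<Prod> (1 - X / z j) / (1 - z k / z j)\<close> each linear factor has coefficients of modulus at most
  \<open>1 / d\<close>, since \<open>z j \<ge> 1\<close>, so the whole product has coefficients bounded by \<open>(2 / d) ^ m\<close>.
\<close>
lemma interpolation_with_bounded_coefficients:
  fixes z :: "nat \<Rightarrow> real" and a :: "nat \<Rightarrow> 'v::real_normed_vector"
  assumes "finite J" "card J \<le> m" and z: "\<And>j. j \<in> J \<Longrightarrow> z j \<ge> 1"
    and d: "0 < d" "d \<le> 1"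
    and sep: "\<And>j k. j \<in> J \<Longrightarrow> k \<in> J \<Longrightarrow> j \<noteq> k \<Longrightarrow> d \<le> \<bar>1 - z k / z j\<bar>"
  shows "\<exists>c. (\<forall>k\<in>J. (\<Sum>i<m. z k ^ i *\<^sub>R c i) = a k) \<and> (\<forall>i. norm (c i) \<le> (2 / d) ^ m * (\<Sum>k\<in>J. norm (a k)))"
proof -
  \<comment> \<open>The Lagrange basis polynomials, expanded in powers of \<open>X / z j\<close>.\<close>
  define Q where "Q k = (\<Prod>j\<in>J - {k}. [:1 / (1 - z k / z j), - (1 / z j) / (1 - z k / z j):])" for k
  define c where "c i = (\<Sum>k\<in>J. coeff (Q k) i *\<^sub>R a k)" for i
  have eval: "poly (Q k) (z l) = (if l = k then 1 else 0)" if "k \<in> J" "l \<in> J" for k l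
  proof -
    have *: "poly [:1 / (1 - z k / z j), - (1 / z j) / (1 - z k / z j):] (z l) = (1 - z l / z j) / (1 - z k / z j)" for j
      by (simp add: diff_divide_distrib)
    have ne: "1 - z k / z j \<noteq> 0" if "j \<in> J - {k}" for j
      using sep[of j k] that \<open>k \<in> J\<close> d by auto
    show ?thesis
    proof (cases "l = k")
      case True
      then show ?thesis unfolding Q_def poly_prod * using ne by (simp add: prod.neutral)
    next
      case False
      have "z l \<noteq> 0" using z[OF \<open>l \<in> J\<close>] by simp
      then have "\<exists>j\<in>J - {k}. (1 - z l / z j) / (1 - z k / z j) = 0"
        using False \<open>l \<in> J\<close> by (intro bexI[of _ l]) auto
      then have "poly (Q k) (z l) = 0"
        unfolding Q_def poly_prod * using \<open>finite J\<close> by (intro prod_zero) auto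
      with False show ?thesis by simp
    qed
  qed
  have deg: "degree (Q k) < m" if "k \<in> J" for k
  proof -
    have "degree (Q k) \<le> (\<Sum>j\<in>J - {k}. degree [:1 / (1 - z k / z j), - (1 / z j) / (1 - z k / z j):])"
      unfolding Q_def by (rule order_trans[OF degree_prod_sum_le]) (simp_all add: \<open>finite J\<close>)
    also have "\<dots> \<le> (\<Sum>j\<in>J - {k}. 1)"
      by (intro sum_mono) (simp add: degree_pCons_eq_if)
    also have "\<dots> < card J"
      using card_Diff1_less[OF \<open>finite J\<close> that] by (simp only: sum_constant) simp
    finally show ?thesis using \<open>card J \<le> m\<close> by simp
  qed
  have bound: "\<bar>coeff (Q k) i\<bar> \<le> (2 / d) ^ m" if "k \<in> J" for k i
  proof -
    have "\<bar>coeff (Q k) i\<bar> \<le> (\<Prod>j\<in>J - {k}. \<bar>1 / (1 - z k / z j)\<bar> + \<bar>- (1 / z j) / (1 - z k / z j)\<bar>)"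
      unfolding Q_def by (rule abs_coeff_prod_linear_le)
    also have "\<dots> \<le> (\<Prod>j\<in>J - {k}. 2 / d)"
    proof (intro prod_mono conjI)
      fix j assume j: "j \<in> J - {k}"
      have inv: "\<bar>1 / (1 - z k / z j)\<bar> \<le> 1 / d"
        using sep[of j k] j that d by (simp add: abs_divide frac_le)
      have "\<bar>- (1 / z j) / (1 - z k / z j)\<bar> = \<bar>1 / z j\<bar> * \<bar>1 / (1 - z k / z j)\<bar>"
        by (simp add: abs_mult abs_divide)
      also have "\<dots> \<le> 1 * (1 / d)"
        using z[of j] j inv by (intro mult_mono) auto
      finally show "\<bar>1 / (1 - z k / z j)\<bar> + \<bar>- (1 / z j) / (1 - z k / z j)\<bar> \<le> 2 / d"
        using inv by simp
    qed simp
    also have "\<dots> = (2 / d) ^ card (J - {k})" by simp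
    also have "\<dots> \<le> (2 / d) ^ m"
      using d \<open>card J \<le> m\<close> \<open>finite J\<close> card_Diff1_le[of J k] by (intro power_increasing) (auto simp: field_simps)
    finally show ?thesis .
  qed
  have "(\<Sum>i<m. z l ^ i *\<^sub>R c i) = a l" if l: "l \<in> J" for l
  proof -
    have "(\<Sum>i<m. z l ^ i *\<^sub>R c i) = (\<Sum>k\<in>J. \<Sum>i<m. z l ^ i *\<^sub>R coeff (Q k) i *\<^sub>R a k)"
      unfolding c_def scaleR_sum_right by (rule sum.swap)
    also have "\<dots> = (\<Sum>k\<in>J. (\<Sum>i<m. coeff (Q k) i * z l ^ i) *\<^sub>R a k)"
      by (simp add: scaleR_sum_left mult.commute)
    also have "\<dots> = (\<Sum>k\<in>J. poly (Q k) (z l) *\<^sub>R a k)"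
    proof (intro sum.cong refl)
      fix k assume "k \<in> J"
      have "poly (Q k) (z l) = (\<Sum>i<m. coeff (Q k) i * z l ^ i)"
        unfolding poly_altdef using deg[OF \<open>k \<in> J\<close>]
        by (intro sum.mono_neutral_left) (auto simp: coeff_eq_0)
      then show "(\<Sum>i<m. coeff (Q k) i * z l ^ i) *\<^sub>R a k = poly (Q k) (z l) *\<^sub>R a k" by simp
    qed
    also have "\<dots> = (\<Sum>k\<in>J. if k = l then a k else 0)"
      using l by (intro sum.cong refl) (simp add: eval)
    finally show ?thesis using l \<open>finite J\<close> by simp
  qed
  moreover have "norm (c i) \<le> (2 / d) ^ m * (\<Sum>k\<in>J. norm (a k))" for i
    unfolding c_def sum_distrib_left
    by (rule order_trans[OF norm_sum sum_mono]) (simp add: bound mult_right_mono)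
  ultimately show ?thesis by blast
qed

lemma abs_1_minus_exp_ge:
  fixes x :: real
  assumes "\<epsilon> \<ge> 0" "\<epsilon> \<le> \<bar>x\<bar>"
  shows "\<epsilon> / (1 + \<epsilon>) \<le> \<bar>1 - exp x\<bar>"
proof -
  have key: "\<epsilon> / (1 + \<epsilon>) \<le> 1 - exp (- y)" if "\<epsilon> \<le> y" for y
  proof -
    have "exp (- y) \<le> exp (- \<epsilon>)" using that by simp
    also have "\<dots> \<le> 1 / (1 + \<epsilon>)"
      using exp_ge_add_one_self[of \<epsilon>] assms(1) by (simp add: exp_minus field_simps)
    finally show ?thesis using assms(1) by (simp add: field_simps)
  qed
  show ?thesis
  proof (cases "x \<ge> 0")
    case True
    have "1 - exp (- x) \<le> exp x - 1"
      using exp_ge_add_one_self[of x] exp_ge_add_one_self[of "-x"] by linarith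
    then show ?thesis using key[of x] True assms by simp
  next
    case False
    then show ?thesis using key[of "- x"] assms by simp
  qed
qed

text \<open>
  The \<open>i\<close>-th piece contributes the integral over the first piece, shifted by \<open>i * h\<close>, that is,
  multiplied by \<open>exp (\<mu> * h) ^ i\<close>: exponential moments of step functions are values of polynomials.
\<close>
lemma integral_step_exp:
  fixes c :: "nat \<Rightarrow> 'v::{banach,second_countable_topology}"
  assumes "h > 0"
  shows "(\<integral>s. exp (\<mu> * s) *\<^sub>R (\<Sum>i<m. indicator {real i * h..<real (Suc i) * h} s *\<^sub>R c i) \<partial>lborel)
    = (\<integral>s. indicator {0..<h} s * exp (\<mu> * s) \<partial>lborel) *\<^sub>R (\<Sum>i<m. exp (\<mu> * h) ^ i *\<^sub>R c i)"
proof -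
  let ?I = "\<lambda>i. {real i * h..<real (Suc i) * h}"
  have meas: "(\<lambda>s. exp (\<mu> * s)) \<in> borel_measurable borel"
    by (intro borel_measurable_continuous_onI continuous_intros)
  have int: "integrable lborel (\<lambda>s. indicator (?I i) s *\<^sub>R exp (\<mu> * s))" for i
  proof (rule integrableI_bounded_set_indicator[where B = "exp (\<bar>\<mu>\<bar> * (real (Suc i) * h))"])
    have "norm (exp (\<mu> * s)) \<le> exp (\<bar>\<mu>\<bar> * (real (Suc i) * h))" if s: "s \<in> ?I i" for s
    proof -
      have "0 \<le> real i * h" using \<open>h > 0\<close> by simp
      then have "0 \<le> s" using s by auto
      then have "\<mu> * s \<le> \<bar>\<mu>\<bar> * (real (Suc i) * h)"
        using s by (intro mult_mono) auto
      then show ?thesis by simp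
    qed
    then show "AE s in lborel. s \<in> ?I i \<longrightarrow> norm (exp (\<mu> * s)) \<le> exp (\<bar>\<mu>\<bar> * (real (Suc i) * h))" by simp
    show "emeasure lborel (?I i) < \<infinity>" by (rule emeasure_bounded_finite) simp
  qed (use meas in auto)
  have shift: "(\<integral>s. indicator (?I i) s *\<^sub>R exp (\<mu> * s) \<partial>lborel)
      = exp (\<mu> * h) ^ i * (\<integral>s. indicator {0..<h} s * exp (\<mu> * s) \<partial>lborel)" for i
  proof -
    have "(\<integral>s. indicator (?I i) s *\<^sub>R exp (\<mu> * s) \<partial>lborel)
        = (\<integral>s. indicator (?I i) (real i * h + s) *\<^sub>R exp (\<mu> * (real i * h + s)) \<partial>lborel)"
      by (subst lborel_integral_real_affine[where c = 1 and t = "real i * h"]) simp_all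
    also have "\<dots> = (\<integral>s. exp (\<mu> * h) ^ i * (indicator {0..<h} s * exp (\<mu> * s)) \<partial>lborel)"
      by (rule Bochner_Integration.integral_cong)
        (auto simp: indicator_def exp_of_nat_mult[symmetric] exp_add[symmetric] algebra_simps)
    finally show ?thesis by simp
  qed
  have "(\<integral>s. exp (\<mu> * s) *\<^sub>R (\<Sum>i<m. indicator (?I i) s *\<^sub>R c i) \<partial>lborel)
      = (\<integral>s. (\<Sum>i<m. (indicator (?I i) s *\<^sub>R exp (\<mu> * s)) *\<^sub>R c i) \<partial>lborel)"
    by (simp only: scaleR_sum_right scaleR_scaleR real_scaleR_def mult.commute)
  also have "\<dots> = (\<Sum>i<m. \<integral>s. (indicator (?I i) s *\<^sub>R exp (\<mu> * s)) *\<^sub>R c i \<partial>lborel)"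
    by (intro Bochner_Integration.integral_sum integrable_scaleR_left int)
  also have "\<dots> = (\<Sum>i<m. (exp (\<mu> * h) ^ i * (\<integral>s. indicator {0..<h} s * exp (\<mu> * s) \<partial>lborel)) *\<^sub>R c i)"
    by (subst integral_scaleR_left) (simp_all only: int shift)
  finally show ?thesis by (simp add: scaleR_sum_right mult.commute)
qed

text \<open>
  The bound degenerates only like a power of \<open>1 / (\<delta> * h)\<close> with exponent \<open>m\<close>. It is
  uniform in the size of the exponents \<open>\<mu> k\<close>, because the growing exponentials have large moments.
\<close>
lemma moment_problem:
  fixes \<mu> :: "nat \<Rightarrow> real" and a :: "nat \<Rightarrow> 'v::{banach,second_countable_topology}"
  assumes "finite J" "card J \<le> m" and \<mu>: "\<And>j. j \<in> J \<Longrightarrow> \<mu> j \<ge> 0"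
    and "h > 0" "\<delta> > 0"
    and sep: "\<And>j k. j \<in> J \<Longrightarrow> k \<in> J \<Longrightarrow> j \<noteq> k \<Longrightarrow> \<delta> \<le> \<bar>\<mu> k - \<mu> j\<bar>"
    and a: "\<And>j. j \<in> J \<Longrightarrow> norm (a j) \<le> M" and "M \<ge> 0"
  shows "\<exists>p. p \<in> borel_measurable borel \<and> (\<forall>s. s \<notin> {0..<real m * h} \<longrightarrow> p s = 0)
    \<and> (\<forall>s. norm (p s) \<le> (2 + 2 / (\<delta> * h)) ^ m * (real m)\<^sup>2 * M / h)
    \<and> (\<forall>k\<in>J. (\<integral>s. exp (\<mu> k * s) *\<^sub>R p s \<partial>lborel) = a k)"
proof -
  \<comment> \<open>The moment of one piece; it is at least \<open>h\<close> because the exponentials do not decay.\<close>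
  define g where "g k = (\<integral>s. indicator {0..<h} s * exp (\<mu> k * s) \<partial>lborel)" for k
  have g: "h \<le> g k" if "k \<in> J" for k
  proof -
    have "norm (exp (\<mu> k * s)) \<le> exp (\<mu> k * h)" if "0 \<le> s" "s < h" for s
      using that \<mu>[OF \<open>k \<in> J\<close>] by (simp add: mult_left_mono)
    then have 1: "integrable lborel (\<lambda>s. indicator {0..<h} s *\<^sub>R exp (\<mu> k * s))"
      using \<open>h > 0\<close> by (intro norm_integral_indicator_le(1)) (auto intro!: borel_measurable_continuous_onI continuous_intros)
    have 2: "integrable lborel (\<lambda>s. indicator {0..<h} s *\<^sub>R (1::real))"
      using \<open>h > 0\<close> by (intro norm_integral_indicator_le(1)[where M = 1]) auto
    have "(\<integral>s. indicator {0..<h} s *\<^sub>R (1::real) \<partial>lborel) \<le> (\<integral>s. indicator {0..<h} s *\<^sub>R exp (\<mu> k * s) \<partial>lborel)"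
      by (intro integral_mono 1 2) (use \<mu>[OF that] in \<open>auto simp: indicator_def\<close>)
    then show ?thesis using \<open>h > 0\<close> by (simp add: g_def)
  qed
  \<comment> \<open>The relative separation of the nodes \<open>exp (\<mu> k * h)\<close>.\<close>
  define d where "d = \<delta> * h / (1 + \<delta> * h)"
  have dh: "\<delta> * h > 0" using \<open>h > 0\<close> \<open>\<delta> > 0\<close> by simp
  have d: "0 < d" "d \<le> 1" using dh by (simp_all add: d_def)
  have sepz: "d \<le> \<bar>1 - exp (\<mu> k * h) / exp (\<mu> j * h)\<bar>" if "j \<in> J" "k \<in> J" "j \<noteq> k" for j k
  proof -
    have "\<delta> * h \<le> \<bar>(\<mu> k - \<mu> j) * h\<bar>"
      using sep[OF that] \<open>h > 0\<close> by (simp add: abs_mult)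
    then have "d \<le> \<bar>1 - exp ((\<mu> k - \<mu> j) * h)\<bar>"
      unfolding d_def using dh by (intro abs_1_minus_exp_ge) auto
    then show ?thesis by (simp add: left_diff_distrib exp_diff)
  qed
  have "exp (\<mu> j * h) \<ge> 1" if "j \<in> J" for j using \<mu>[OF that] \<open>h > 0\<close> by simp
  then have "\<exists>c. (\<forall>k\<in>J. (\<Sum>i<m. exp (\<mu> k * h) ^ i *\<^sub>R c i) = (1 / g k) *\<^sub>R a k)
      \<and> (\<forall>i. norm (c i) \<le> (2 / d) ^ m * (\<Sum>k\<in>J. norm ((1 / g k) *\<^sub>R a k)))"
    by (intro interpolation_with_bounded_coefficients assms(1,2) d sepz)
  then obtain c where c: "\<And>k. k \<in> J \<Longrightarrow> (\<Sum>i<m. exp (\<mu> k * h) ^ i *\<^sub>R c i) = (1 / g k) *\<^sub>R a k"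
      "\<And>i. norm (c i) \<le> (2 / d) ^ m * (\<Sum>k\<in>J. norm ((1 / g k) *\<^sub>R a k))"
    by blast
  define p where "p s = (\<Sum>i<m. indicator {real i * h..<real (Suc i) * h} s *\<^sub>R c i)" for s
  have "p \<in> borel_measurable borel"
    unfolding p_def by measurable
  moreover have "p s = 0" if "s \<notin> {0..<real m * h}" for s
    unfolding p_def
  proof (intro sum.neutral ballI)
    fix i assume "i \<in> {..<m}"
    then have "real (Suc i) * h \<le> real m * h"
      using \<open>h > 0\<close> by (intro mult_right_mono) auto
    moreover have "0 \<le> real i * h" using \<open>h > 0\<close> by simp
    ultimately show "indicator {real i * h..<real (Suc i) * h} s *\<^sub>R c i = 0"
      using that by (auto simp: indicator_def)
  qed
  moreover have "norm (p s) \<le> (2 + 2 / (\<delta> * h)) ^ m * (real m)\<^sup>2 * M / h" for s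
  proof -
    have "(\<Sum>k\<in>J. norm ((1 / g k) *\<^sub>R a k)) \<le> (\<Sum>k\<in>J. M / h)"
    proof (rule sum_mono)
      fix k assume "k \<in> J"
      then have "norm (a k) / g k \<le> M / h"
        using \<open>h > 0\<close> \<open>M \<ge> 0\<close> by (intro frac_le a g)
      with g[OF \<open>k \<in> J\<close>] \<open>h > 0\<close> show "norm ((1 / g k) *\<^sub>R a k) \<le> M / h"
        by simp
    qed
    also have "\<dots> \<le> real m * (M / h)"
      using \<open>card J \<le> m\<close> \<open>M \<ge> 0\<close> \<open>h > 0\<close> by (simp add: mult_right_mono divide_right_mono)
    finally have "(2 / d) ^ m * (\<Sum>k\<in>J. norm ((1 / g k) *\<^sub>R a k)) \<le> (2 / d) ^ m * (real m * (M / h))"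
      using d by (intro mult_left_mono) auto
    moreover have "2 / d = 2 + 2 / (\<delta> * h)"
      using \<open>h > 0\<close> \<open>\<delta> > 0\<close> by (simp add: d_def add_divide_distrib distrib_left)
    ultimately have ci: "norm (c i) \<le> (2 + 2 / (\<delta> * h)) ^ m * (real m * (M / h))" for i
      using c(2)[of i] by simp
    have "norm (p s) \<le> (\<Sum>i<m. norm (c i))"
      unfolding p_def by (rule order_trans[OF norm_sum sum_mono]) (simp add: indicator_def)
    also have "\<dots> \<le> (\<Sum>i<m. (2 + 2 / (\<delta> * h)) ^ m * (real m * (M / h)))"
      by (intro sum_mono ci)
    finally show ?thesis by (simp add: power2_eq_square mult_ac)
  qed
  moreover have "(\<integral>s. exp (\<mu> k * s) *\<^sub>R p s \<partial>lborel) = a k" if "k \<in> J" for k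
    unfolding p_def integral_step_exp[OF \<open>h > 0\<close>] c(1)[OF that] g_def[symmetric]
    using g[OF that] \<open>h > 0\<close> by simp
  ultimately show ?thesis by blast
qed

section \<open>One step of the control scheme\<close>

text \<open>
  For \<open>m\<close> of order \<open>x\<^sup>2\<close> and \<open>1 / \<tau> \<le> x ^ 4\<close> the base of the power is polynomial in \<open>x\<close>, so the cost
  is \<open>exp (O(x\<^sup>2 ln x))\<close>; the crude estimate \<open>ln x \<le> x\<close> is sufficient, because the cost has to be beaten
  only by \<open>exp (- \<tau> * x ^ 4)\<close>.
\<close>
lemma control_cost_bound:
  fixes Cb r \<alpha> \<delta> :: real
  assumes "\<alpha> > 0" "Cb > 0" "r \<ge> 0" "\<delta> > 0"
  shows "\<exists>C>0. \<forall>\<tau> x. \<forall>m::nat. 0 < \<tau> \<longrightarrow> 1 \<le> x \<longrightarrow> 1 \<le> \<tau> * x ^ 4 \<longrightarrow> 1 \<le> m \<longrightarrow> real m \<le> x\<^sup>2 / \<alpha> + 1 \<longrightarrow>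
    Cb * real m powr r * real m ^ 3 / \<tau> * (2 + 2 * real m / (\<delta> * \<tau>)) ^ m \<le> exp (C * x ^ 3)"
proof -
  define c2 where "c2 = 1 / \<alpha> + 1"
  define c3 where "c3 = 2 + 2 * c2 / \<delta>"
  have c2: "c2 \<ge> 1" using \<open>\<alpha> > 0\<close> by (simp add: c2_def)
  have c3: "c3 \<ge> 2" using c2 \<open>\<delta> > 0\<close> by (simp add: c3_def)
  define C where "C = Cb + (r + 3) * (c2 + 2) + 4 + c2 * (c3 + 6)"
  have "C > 0"
    unfolding C_def using assms c2 c3 by (intro add_pos_pos add_pos_nonneg mult_nonneg_nonneg mult_pos_pos) auto
  moreover have "Cb * real m powr r * real m ^ 3 / \<tau> * (2 + 2 * real m / (\<delta> * \<tau>)) ^ m \<le> exp (C * x ^ 3)"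
    if \<tau>: "0 < \<tau>" and x: "1 \<le> x" and \<tau>x: "1 \<le> \<tau> * x ^ 4" and m: "1 \<le> m" "real m \<le> x\<^sup>2 / \<alpha> + 1" for \<tau> x and m :: nat
  proof -
    have lnx: "0 \<le> ln x" "ln x \<le> x"
      using x ln_le_minus_one[of x] by auto
    have x3: "x \<le> x ^ 3" "1 \<le> x ^ 3" using x by (auto intro: self_le_power)
    \<comment> \<open>All quantities are dominated by powers of \<open>x\<close>, and \<open>x\<close> itself by \<open>x ^ 3\<close>.\<close>
    have "x\<^sup>2 / \<alpha> + 1 \<le> x\<^sup>2 / \<alpha> + x\<^sup>2" using x by simp
    then have m2: "real m \<le> c2 * x\<^sup>2" using m(2) by (simp add: c2_def algebra_simps)
    have inv: "1 / \<tau> \<le> x ^ 4" using \<tau> \<tau>x by (simp add: field_simps)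
    have lnm: "ln (real m) \<le> (c2 + 2) * x" "0 \<le> ln (real m)"
    proof -
      have "ln (real m) \<le> ln (c2 * x\<^sup>2)" using m m2 by simp
      also have "\<dots> = ln c2 + 2 * ln x" using c2 x by (simp add: ln_mult ln_realpow)
      also have "\<dots> \<le> c2 * x + 2 * x"
      proof -
        have "ln c2 \<le> c2" using ln_le_minus_one[of c2] c2 by simp
        also have "c2 \<le> c2 * x" using x c2 by simp
        finally show ?thesis using lnx by simp
      qed
      finally show "ln (real m) \<le> (c2 + 2) * x" by (simp add: algebra_simps)
      show "0 \<le> ln (real m)" using m by simp
    qed
    have "Cb \<le> exp (Cb * x ^ 3)"
    proof -
      have "Cb \<le> exp Cb" using exp_ge_add_one_self[of Cb] by linarith
      also have "\<dots> \<le> exp (Cb * x ^ 3)" using x3 \<open>Cb > 0\<close> by simp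
      finally show ?thesis .
    qed
    moreover have "real m powr r * real m ^ 3 \<le> exp ((r + 3) * (c2 + 2) * x ^ 3)"
    proof -
      have "real m powr r * real m ^ 3 = real m powr (r + 3)"
        using m by (simp add: powr_add powr_realpow)
      also have "\<dots> = exp ((r + 3) * ln (real m))" using m by (simp add: powr_def)
      also have "\<dots> \<le> exp ((r + 3) * ((c2 + 2) * x ^ 3))"
        using \<open>r \<ge> 0\<close> lnm x3 c2 by (simp add: mult_left_mono order_trans[OF lnm(1)])
      finally show ?thesis by (simp add: mult.assoc)
    qed
    moreover have "1 / \<tau> \<le> exp (4 * x ^ 3)"
    proof -
      have "x ^ 4 = exp (4 * ln x)" using x exp_of_nat_mult[of 4 "ln x"] by simp
      also have "\<dots> \<le> exp (4 * x ^ 3)" using lnx x3 by simp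
      finally show ?thesis using inv by simp
    qed
    moreover have "(2 + 2 * real m / (\<delta> * \<tau>)) ^ m \<le> exp (c2 * (c3 + 6) * x ^ 3)"
    proof -
      have "real m / \<tau> \<le> (c2 * x\<^sup>2) * x ^ 4"
        using mult_mono[OF m2 inv] c2 \<tau> by simp
      also have "\<dots> = c2 * x ^ 6" by (simp add: power_add[symmetric])
      finally have "2 * real m / (\<delta> * \<tau>) \<le> 2 * c2 / \<delta> * x ^ 6"
        using \<open>\<delta> > 0\<close> \<tau> by (simp add: field_simps)
      moreover have "2 \<le> 2 * x ^ 6" using x by simp
      ultimately have base: "2 + 2 * real m / (\<delta> * \<tau>) \<le> c3 * x ^ 6"
        by (simp add: c3_def algebra_simps)
      have "(2 + 2 * real m / (\<delta> * \<tau>)) ^ m \<le> (c3 * x ^ 6) ^ m"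
        using base \<open>\<delta> > 0\<close> \<tau> by (intro power_mono) auto
      also have "\<dots> = exp (real m * ln (c3 * x ^ 6))"
        using c3 x by (simp add: exp_of_nat_mult)
      also have "\<dots> \<le> exp ((c2 * x\<^sup>2) * ((c3 + 6) * x))"
      proof -
        have "ln (c3 * x ^ 6) = ln c3 + 6 * ln x" using c3 x by (simp add: ln_mult ln_realpow)
        also have "\<dots> \<le> c3 * x + 6 * x"
        proof -
          have "ln c3 \<le> c3" using ln_le_minus_one[of c3] c3 by simp
          also have "c3 \<le> c3 * x" using x c3 by simp
          finally show ?thesis using lnx by simp
        qed
        finally have *: "ln (c3 * x ^ 6) \<le> (c3 + 6) * x" by (simp add: algebra_simps)
        have "1 \<le> x ^ 6" using x by simp
        then have "1 \<le> c3 * x ^ 6" using c3 mult_mono[of 1 c3 1 "x ^ 6"] by simp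
        then have "0 \<le> ln (c3 * x ^ 6)" by (rule ln_ge_zero)
        with * m2 c2 show ?thesis by (simp add: mult_mono)
      qed
      also have "(c2 * x\<^sup>2) * ((c3 + 6) * x) = c2 * (c3 + 6) * x ^ 3"
        by (simp add: power2_eq_square power3_eq_cube)
      finally show ?thesis .
    qed
    ultimately have "(Cb * (real m powr r * real m ^ 3)) * (1 / \<tau>) * (2 + 2 * real m / (\<delta> * \<tau>)) ^ m
      \<le> (exp (Cb * x ^ 3) * exp ((r + 3) * (c2 + 2) * x ^ 3)) * exp (4 * x ^ 3) * exp (c2 * (c3 + 6) * x ^ 3)"
      using assms \<tau> by (intro mult_mono) auto
    also have "\<dots> = exp (C * x ^ 3)"
      by (simp add: C_def exp_add[symmetric] algebra_simps)
    finally show ?thesis by (simp add: mult.assoc)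
  qed
  ultimately show ?thesis by blast
qed

text \<open>
  The situation after division by the ground state amplitude: \<open>phi 1\<close> is an equilibrium. The
  assumption \<open>coupling\<close> says that the modes below the cutoff \<open>\<alpha>\<^sup>2 * m\<^sup>2\<close> are reached by
  \<open>B (phi 1)\<close> with a strength that is at worst polynomially small in \<open>m\<close>.
\<close>
locale bilinear_control = contraction_semigroup S + hilbert_basis smul ip phi
  for S :: "real \<Rightarrow> 'x::{banach,second_countable_topology} \<Rightarrow> 'x"
    and smul :: "'k::{real_normed_field,euclidean_space} \<Rightarrow> 'x \<Rightarrow> 'x"
    and ip :: "'x \<Rightarrow> 'x \<Rightarrow> 'k" and phi :: "nat \<Rightarrow> 'x" +
  fixes \<mu> :: "nat \<Rightarrow> real" and B :: "'x \<Rightarrow> 'x" and \<alpha> \<beta> Cb r :: real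
  assumes S_smul: "S t (smul c x) = smul c (S t x)"
    and ip_S: "k \<ge> 1 \<Longrightarrow> t \<ge> 0 \<Longrightarrow> ip (S t x) (phi k) = exp (- \<mu> k * t) *\<^sub>R ip x (phi k)"
    and \<mu>_1: "\<mu> 1 = 0" and \<mu>_nonneg: "k \<ge> 1 \<Longrightarrow> \<mu> k \<ge> 0"
    and \<alpha>_pos: "\<alpha> > 0"
    and \<mu>_gap: "j \<ge> 1 \<Longrightarrow> k \<ge> 1 \<Longrightarrow> j \<noteq> k \<Longrightarrow> \<alpha>\<^sup>2 \<le> \<bar>\<mu> k - \<mu> j\<bar>"
    and \<mu>_growth: "k \<ge> 1 \<Longrightarrow> \<alpha>\<^sup>2 * (real k - 1)\<^sup>2 \<le> \<mu> k"
    and B_diff: "B (x - y) = B x - B y" and B_bound: "norm (B x) \<le> \<beta> * norm x" and \<beta>_nonneg: "\<beta> \<ge> 0"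
    and Cb_pos: "Cb > 0" and r_nonneg: "r \<ge> 0"
    and coupling: "k \<ge> 1 \<Longrightarrow> m \<ge> 1 \<Longrightarrow> \<mu> k < \<alpha>\<^sup>2 * (real m)\<^sup>2 \<Longrightarrow>
      1 \<le> Cb * real m powr r * norm (ip (B (phi 1)) (phi k))"
begin

definition control_term :: "(real \<Rightarrow> 'k) \<Rightarrow> real \<Rightarrow> 'x \<Rightarrow> 'x"
  where "control_term p s x = smul (p s) (B x)"

lemma continuous_on_B: "continuous_on UNIV B"
proof (rule lipschitz_on_continuous_on)
  show "\<beta>-lipschitz_on UNIV B"
    by (rule lipschitz_onI) (simp_all add: dist_norm B_bound \<beta>_nonneg flip: B_diff)
qed

lemma perturbed_semigroup_control:
  assumes p: "p \<in> borel_measurable borel" and P: "\<And>s. norm (p s) \<le> P"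
  shows "perturbed_semigroup S (control_term p) (P * \<beta>)"
proof unfold_locales
  show "control_term p s (x - y) = control_term p s x - control_term p s y" for s x y
    by (simp add: control_term_def B_diff scale_right_diff_distrib)
  show "norm (control_term p s x) \<le> P * \<beta> * norm x" for s x
  proof -
    have "norm (p s) * norm (B x) \<le> P * (\<beta> * norm x)"
      using P[of s] B_bound[of x] order_trans[OF norm_ge_zero P[of s]] by (intro mult_mono) auto
    then show ?thesis by (simp add: control_term_def norm_smul mult.assoc)
  qed
  show "(\<lambda>s. control_term p s (w s)) \<in> borel_measurable borel" if w: "continuous_on UNIV w" for w
  proof -
    have "continuous_on UNIV (\<lambda>s. B (w s))"
      by (rule continuous_on_compose2[OF continuous_on_B w]) auto
    then have "(\<lambda>s. (p s, B (w s))) \<in> borel_measurable borel"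
      by (intro borel_measurable_Pair p borel_measurable_continuous_onI)
    moreover have "continuous_on UNIV (\<lambda>z. smul (fst z) (snd z))"
      by (intro bounded_bilinear.continuous_on[OF bounded_bilinear_smul] continuous_intros)
    ultimately have "(\<lambda>s. smul (fst (p s, B (w s))) (snd (p s, B (w s)))) \<in> borel_measurable borel"
      using borel_measurable_continuous_on by blast
    then show ?thesis by (simp add: control_term_def)
  qed
qed

lemma S_phi_1: "t \<ge> 0 \<Longrightarrow> S t (phi 1) = phi 1"
  by (rule eqI_phi) (auto simp: ip_S ip_phi \<mu>_1[simplified])

lemma norm_S_high_modes_le:
  assumes low: "\<And>k. k \<ge> 1 \<Longrightarrow> \<mu> k < \<Theta> \<Longrightarrow> ip w (phi k) = 0" and "t \<ge> 0"
  shows "norm (S t w) \<le> exp (- \<Theta> * t) * norm w"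
proof -
  \<comment> \<open>The absent low modes may be given the multiplier \<open>0\<close>, so that all multipliers are at most \<open>1\<close>.\<close>
  define \<theta> where "\<theta> k = (if \<mu> k < \<Theta> then 0 else exp (- (\<mu> k - \<Theta>) * t))" for k
  have \<theta>: "\<bar>\<theta> k\<bar> \<le> 1" for k
    using \<open>t \<ge> 0\<close> by (auto simp: \<theta>_def intro!: mult_nonpos_nonneg)
  have "S t w = exp (- \<Theta> * t) *\<^sub>R diagonal_op \<theta> w"
  proof (rule eqI_phi)
    fix k :: nat assume k: "k \<ge> 1"
    show "ip (S t w) (phi k) = ip (exp (- \<Theta> * t) *\<^sub>R diagonal_op \<theta> w) (phi k)"
      using low[OF k] by (auto simp: ip_S[OF k \<open>t \<ge> 0\<close>] ip_scaleR_left ip_diagonal_op[OF \<theta> k] \<theta>_def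
          exp_add[symmetric] algebra_simps)
  qed
  then show ?thesis
    using norm_diagonal_op_le[where x = w, OF \<theta>] by simp
qed

text \<open>
  The linearised equation at \<open>phi 1\<close> is driven by \<open>p(s) B (phi 1)\<close>; its modes see the control only
  through the exponential moments of \<open>p\<close>.
\<close>
lemma ip_duhamel_constant:
  assumes p: "p \<in> borel_measurable borel" and P: "\<And>s. norm (p s) \<le> P"
    and supp: "\<And>s. s \<notin> {0..<\<tau>} \<Longrightarrow> p s = 0" and "\<tau> \<ge> 0" and k: "k \<ge> 1"
  shows "ip (duhamel (\<lambda>s. control_term p s y) \<tau>) (phi k)
    = exp (- \<mu> k * \<tau>) *\<^sub>R ((\<integral>s. exp (\<mu> k * s) *\<^sub>R p s \<partial>lborel) * ip (B y) (phi k))"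
proof -
  interpret perturbed_semigroup S "control_term p" "P * \<beta>"
    by (rule perturbed_semigroup_control[OF p P])
  have "integrable lborel (\<lambda>s. indicator {0..<\<tau>} s *\<^sub>R S (\<tau> - s) (control_term p s y))"
    by (rule integrable_duhamel[OF G_measurable G_bound \<open>\<tau> \<ge> 0\<close>]) auto
  then have "ip (duhamel (\<lambda>s. control_term p s y) \<tau>) (phi k)
      = (\<integral>s. ip (indicator {0..<\<tau>} s *\<^sub>R S (\<tau> - s) (control_term p s y)) (phi k) \<partial>lborel)"
    unfolding duhamel_def by (rule integral_bounded_linear[OF bounded_linear_ip_left, symmetric])
  also have "\<dots> = (\<integral>s. exp (- \<mu> k * \<tau>) *\<^sub>R ((exp (\<mu> k * s) *\<^sub>R p s) * ip (B y) (phi k)) \<partial>lborel)"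
  proof (rule Bochner_Integration.integral_cong[OF refl])
    fix s
    show "ip (indicator {0..<\<tau>} s *\<^sub>R S (\<tau> - s) (control_term p s y)) (phi k)
        = exp (- \<mu> k * \<tau>) *\<^sub>R ((exp (\<mu> k * s) *\<^sub>R p s) * ip (B y) (phi k))"
    proof (cases "s \<in> {0..<\<tau>}")
      case True
      then show ?thesis
        using k by (simp add: ip_S control_term_def ip_smul_left exp_add[symmetric] algebra_simps)
    qed (simp add: supp)
  qed
  also have "\<dots> = exp (- \<mu> k * \<tau>) *\<^sub>R ((\<integral>s. exp (\<mu> k * s) *\<^sub>R p s \<partial>lborel) * ip (B y) (phi k))"
    unfolding integral_scaleR_right integral_mult_left_zero ..
  finally show ?thesis .
qed

text \<open>
  The control acts on \<open>[0,\<tau>)\<close> and brings all modes below the cutoff to rest at time \<open>\<tau>\<close>. It also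
  excites the higher modes, which is why a free evolution of length \<open>\<tau>\<close> follows.
\<close>
lemma low_mode_control:
  assumes "\<tau> > 0" and m: "m \<ge> 1"
  defines "K \<equiv> Cb * real m powr r * real m ^ 3 / \<tau> * (2 + 2 * real m / (\<alpha>\<^sup>2 * \<tau>)) ^ m"
  shows "\<exists>p. p \<in> borel_measurable borel \<and> (\<forall>s. s \<notin> {0..<\<tau>} \<longrightarrow> p s = 0) \<and> (\<forall>s. norm (p s) \<le> K * norm v0)
    \<and> norm (S (2 * \<tau>) v0 - duhamel (\<lambda>s. control_term p s (phi 1)) (2 * \<tau>))
      \<le> exp (- (\<alpha>\<^sup>2 * (real m)\<^sup>2) * \<tau>) * ((1 + \<tau> * K * \<beta>) * norm v0)"
proof -
  define J where "J = {k. k \<ge> 1 \<and> \<mu> k < \<alpha>\<^sup>2 * (real m)\<^sup>2}"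
  have "J \<subseteq> {1..m}"
  proof
    fix k assume k: "k \<in> J"
    then have "\<alpha>\<^sup>2 * (real k - 1)\<^sup>2 < \<alpha>\<^sup>2 * (real m)\<^sup>2"
      using \<mu>_growth[of k] by (auto simp: J_def)
    then have "(real k - 1)\<^sup>2 < (real m)\<^sup>2" using \<alpha>_pos by simp
    then have "real k - 1 < real m" by (rule power_less_imp_less_base) simp
    then show "k \<in> {1..m}" using k by (auto simp: J_def)
  qed
  then have J: "finite J" "card J \<le> m"
    using card_mono[of "{1..m}" J] by (auto intro: finite_subset)
  \<comment> \<open>There are at least as many pieces as modes to be controlled.\<close>
  define h where "h = \<tau> / real m"
  have h: "h > 0" "real m * h = \<tau>" using \<open>\<tau> > 0\<close> m by (simp_all add: h_def)
  define bk where "bk k = ip (B (phi 1)) (phi k)" for k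
  have bk: "1 \<le> Cb * real m powr r * norm (bk k)" if "k \<in> J" for k
    using coupling[of k m] that m by (simp add: J_def bk_def)
  define M where "M = Cb * real m powr r * norm v0"
  have "M \<ge> 0" using Cb_pos by (simp add: M_def)
  have targets: "norm (ip v0 (phi k) / bk k) \<le> M" if "k \<in> J" for k
  proof -
    have "norm (ip v0 (phi k)) \<le> norm v0"
      using that norm_ip_unit_le[of "phi k" v0] by (simp add: J_def ip_phi)
    also have "\<dots> * 1 \<le> norm v0 * (Cb * real m powr r * norm (bk k))"
      using bk[OF that] by (intro mult_left_mono) auto
    finally have "norm (ip v0 (phi k)) \<le> M * norm (bk k)" by (simp add: M_def mult_ac)
    moreover have "bk k \<noteq> 0" using bk[OF that] by auto
    ultimately show ?thesis by (simp add: norm_divide field_simps)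
  qed
  have ex: "\<exists>p. p \<in> borel_measurable borel \<and> (\<forall>s. s \<notin> {0..<real m * h} \<longrightarrow> p s = 0)
      \<and> (\<forall>s. norm (p s) \<le> (2 + 2 / (\<alpha>\<^sup>2 * h)) ^ m * (real m)\<^sup>2 * M / h)
      \<and> (\<forall>k\<in>J. (\<integral>s. exp (\<mu> k * s) *\<^sub>R p s \<partial>lborel) = ip v0 (phi k) / bk k)"
  proof (rule moment_problem[OF J _ h(1) _ _ targets \<open>M \<ge> 0\<close>])
    show "\<alpha>\<^sup>2 > 0" using \<alpha>_pos by simp
    show "\<mu> j \<ge> 0" if "j \<in> J" for j using that \<mu>_nonneg by (simp add: J_def)
    show "\<alpha>\<^sup>2 \<le> \<bar>\<mu> k - \<mu> j\<bar>" if "j \<in> J" "k \<in> J" "j \<noteq> k" for j k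
      using that by (intro \<mu>_gap) (simp_all add: J_def)
  qed
  have bound: "(2 + 2 / (\<alpha>\<^sup>2 * h)) ^ m * (real m)\<^sup>2 * M / h = K * norm v0"
    using \<open>\<tau> > 0\<close> m by (simp add: K_def M_def h_def power2_eq_square power3_eq_cube mult_ac)
  obtain p where p: "p \<in> borel_measurable borel" and supp: "\<And>s. s \<notin> {0..<\<tau>} \<Longrightarrow> p s = 0"
      and P: "\<And>s. norm (p s) \<le> K * norm v0"
      and mom: "\<And>k. k \<in> J \<Longrightarrow> (\<integral>s. exp (\<mu> k * s) *\<^sub>R p s \<partial>lborel) = ip v0 (phi k) / bk k"
    using ex[unfolded h(2) bound] by (elim exE conjE) simp
  interpret perturbed_semigroup S "control_term p" "K * norm v0 * \<beta>"
    by (rule perturbed_semigroup_control[OF p P])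
  have K: "K \<ge> 0" using Cb_pos \<open>\<tau> > 0\<close> \<alpha>_pos by (simp add: K_def)
  define W where "W = S \<tau> v0 - duhamel (\<lambda>s. control_term p s (phi 1)) \<tau>"
  have bd: "norm (control_term p s (phi 1)) \<le> K * norm v0 * \<beta> * norm (phi 1)" for s by (rule G_bound)
  have meas: "(\<lambda>s. control_term p s (phi 1)) \<in> borel_measurable borel"
    by (rule G_measurable[of "\<lambda>_. phi 1"]) (rule continuous_on_const)
  have "duhamel (\<lambda>s. control_term p s (phi 1)) (\<tau> + \<tau>)
      = S \<tau> (duhamel (\<lambda>s. control_term p s (phi 1)) \<tau>) + duhamel (\<lambda>s. control_term p (\<tau> + s) (phi 1)) \<tau>"
    by (rule duhamel_restart[OF meas bd]) (use \<open>\<tau> > 0\<close> in auto)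
  also have "duhamel (\<lambda>s. control_term p (\<tau> + s) (phi 1)) \<tau> = duhamel (\<lambda>s. 0) \<tau>"
  proof (rule duhamel_cong)
    fix s :: real assume "0 \<le> s"
    then have "p (\<tau> + s) = 0" by (intro supp) simp
    then show "control_term p (\<tau> + s) (phi 1) = 0" by (simp add: control_term_def)
  qed
  also have "\<dots> = 0"
    unfolding duhamel_def linear_0[OF bounded_linear.linear[OF linear]] by simp
  finally have "S (2 * \<tau>) v0 - duhamel (\<lambda>s. control_term p s (phi 1)) (2 * \<tau>) = S \<tau> W"
    using semigroup[of \<tau> \<tau> v0] \<open>\<tau> > 0\<close> unfolding W_def S_diff mult_2 by simp
  moreover have "norm (S \<tau> W) \<le> exp (- (\<alpha>\<^sup>2 * (real m)\<^sup>2) * \<tau>) * norm W"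
  proof (rule norm_S_high_modes_le)
    fix k :: nat assume k: "k \<ge> 1" "\<mu> k < \<alpha>\<^sup>2 * (real m)\<^sup>2"
    then have "k \<in> J" by (simp add: J_def)
    have "bk k \<noteq> 0" using bk[OF \<open>k \<in> J\<close>] by auto
    have "ip (duhamel (\<lambda>s. control_term p s (phi 1)) \<tau>) (phi k) = exp (- \<mu> k * \<tau>) *\<^sub>R (ip v0 (phi k) / bk k * bk k)"
      using \<open>\<tau> > 0\<close> k by (subst ip_duhamel_constant[OF p P supp]) (simp_all add: mom[OF \<open>k \<in> J\<close>] bk_def)
    then show "ip W (phi k) = 0"
      using \<open>bk k \<noteq> 0\<close> \<open>\<tau> > 0\<close> k by (simp add: W_def ip_diff_left ip_S)
  qed (use \<open>\<tau> > 0\<close> in simp)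
  moreover have "norm W \<le> (1 + \<tau> * K * \<beta>) * norm v0"
  proof -
    have "norm W \<le> norm v0 + \<tau> * (K * norm v0 * \<beta> * norm (phi 1))"
      unfolding W_def
      using \<open>\<tau> > 0\<close> by (intro order_trans[OF norm_triangle_ineq4] add_mono contraction norm_duhamel_le[OF meas bd]) auto
    then show ?thesis by (simp add: algebra_simps)
  qed
  ultimately have "norm (S (2 * \<tau>) v0 - duhamel (\<lambda>s. control_term p s (phi 1)) (2 * \<tau>))
      \<le> exp (- (\<alpha>\<^sup>2 * (real m)\<^sup>2) * \<tau>) * ((1 + \<tau> * K * \<beta>) * norm v0)"
    by (simp only:) (erule order_trans, erule mult_left_mono, rule exp_ge_zero)
  with p supp P show ?thesis by (intro exI[of _ p] conjI allI impI)
qed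

lemma mild_near_ground_state:
  assumes p: "p \<in> borel_measurable borel" and P: "\<And>s. norm (p s) \<le> P"
    and w: "mild (control_term p) T (phi 1 + v0) w" and small: "T * (P * \<beta>) \<le> 1 / 2" and t: "t \<in> {0..T}"
  shows "norm (w t - phi 1) \<le> 2 * (norm v0 + T * (P * \<beta>))"
    and "w t - phi 1 = S t v0 - duhamel (\<lambda>s. control_term p s (phi 1)) t - duhamel (\<lambda>s. control_term p s (w s - phi 1)) t"
proof -
  interpret perturbed_semigroup S "control_term p" "P * \<beta>"
    by (rule perturbed_semigroup_control[OF p P])
  have "P \<ge> 0" by (rule order_trans[OF norm_ge_zero P])
  then have Pb: "P * \<beta> \<ge> 0" using \<beta>_nonneg by simp
  have cont: "continuous_on UNIV w" using w by (simp add: mild_def)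
  have eq: "w t - phi 1 = S t v0 - duhamel (\<lambda>s. control_term p s (w s)) t" if "t \<in> {0..T}" for t
    using w that linear_add[OF bounded_linear.linear[OF linear], of t "phi 1" v0]
    by (simp add: mild_def S_phi_1[simplified])
  show "w t - phi 1 = S t v0 - duhamel (\<lambda>s. control_term p s (phi 1)) t - duhamel (\<lambda>s. control_term p s (w s - phi 1)) t"
    using duhamel_G_diff[OF cont, of "\<lambda>_. phi 1" t] t unfolding eq[OF t] by (simp add: algebra_simps)
  show "norm (w t - phi 1) \<le> 2 * (norm v0 + T * (P * \<beta>))"
  proof (rule bound_of_half_selfbound[OF _ _ t])
    show "continuous_on {0..T} (\<lambda>t. w t - phi 1)"
      by (intro continuous_on_diff continuous_on_subset[OF cont] continuous_on_const) auto
    fix t d assume t: "t \<in> {0..T}" and d: "\<And>s. s \<in> {0..t} \<Longrightarrow> norm (w s - phi 1) \<le> d"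
    have "d \<ge> 0" using order_trans[OF norm_ge_zero d[of 0]] t by simp
    have "norm (w s) \<le> 1 + d" if "0 \<le> s" "s < t" for s
      using norm_triangle_ineq[of "phi 1" "w s - phi 1"] d[of s] that by simp
    then have "norm (duhamel (\<lambda>s. control_term p s (w s)) t) \<le> t * (\<bar>P * \<beta>\<bar> * (1 + d))"
      using t by (intro norm_duhamel_G_le cont) auto
    also have "\<dots> \<le> T * (\<bar>P * \<beta>\<bar> * (1 + d))"
      using t \<open>d \<ge> 0\<close> by (intro mult_right_mono) auto
    also have "\<dots> = T * (P * \<beta>) + T * (P * \<beta>) * d"
      unfolding abs_of_nonneg[OF Pb] by (simp add: algebra_simps)
    also have "T * (P * \<beta>) * d \<le> 1 / 2 * d"
      using small \<open>d \<ge> 0\<close> by (intro mult_right_mono)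
    finally have "norm (duhamel (\<lambda>s. control_term p s (w s)) t) \<le> T * (P * \<beta>) + 1 / 2 * d" by simp
    with norm_triangle_ineq4[of "S t v0" "duhamel (\<lambda>s. control_term p s (w s)) t"] contraction[of t v0]
    show "norm (w t - phi 1) \<le> norm v0 + T * (P * \<beta>) + d / 2"
      unfolding eq[OF t] by linarith
  qed
qed

text \<open>
  With the cutoff \<open>m\<close> next above \<open>x\<^sup>2 / \<alpha>\<close> the linear part of the deviation shrinks by
  \<open>exp (- \<tau> * x ^ 4)\<close>. The control and the deviation during the step are both of order
  \<open>exp (C * x ^ 3) * norm v0\<close>, so the neglected product \<open>p(s) B (w s - phi 1)\<close> is quadratic.
\<close>
lemma one_control_step:
  assumes "T > 0"
  shows "\<exists>C>0. \<forall>\<tau> x v0. 0 < \<tau> \<longrightarrow> \<tau> \<le> T \<longrightarrow> 1 \<le> x \<longrightarrow> 1 \<le> \<tau> * x ^ 4 \<longrightarrow> exp (C * x ^ 3) * norm v0 \<le> 1 \<longrightarrow>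
    (\<exists>p. p \<in> borel_measurable borel \<and> (\<forall>s. norm (p s) \<le> exp (C * x ^ 3) * norm v0) \<and>
      (\<forall>w. mild (control_term p) (2 * \<tau>) (phi 1 + v0) w \<longrightarrow>
        norm (w (2 * \<tau>) - phi 1) \<le> exp (C * x ^ 3) * (exp (- \<tau> * x ^ 4) * norm v0 + (norm v0)\<^sup>2)))"
proof -
  have a2: "\<alpha>\<^sup>2 > 0" using \<alpha>_pos by simp
  obtain C0 where "C0 > 0" and C0: "\<And>\<tau> x m. 0 < \<tau> \<Longrightarrow> 1 \<le> x \<Longrightarrow> 1 \<le> \<tau> * x ^ 4 \<Longrightarrow> 1 \<le> m \<Longrightarrow> real m \<le> x\<^sup>2 / \<alpha> + 1 \<Longrightarrow>
      Cb * real m powr r * real m ^ 3 / \<tau> * (2 + 2 * real m / (\<alpha>\<^sup>2 * \<tau>)) ^ m \<le> exp (C0 * x ^ 3)"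
    using control_cost_bound[OF \<alpha>_pos Cb_pos r_nonneg a2] by blast
  \<comment> \<open>\<open>C\<close> is chosen such that \<open>exp (C * x ^ 3)\<close> dominates \<open>2 * (E + K)\<^sup>2\<close> below.\<close>
  define c where "c = 2 + 2 * T * \<beta>"
  have "c \<ge> 2" using \<open>T > 0\<close> \<beta>_nonneg by (simp add: c_def)
  define C where "C = 2 + 2 * c + 2 * C0"
  have "C > 0" using \<open>C0 > 0\<close> \<open>c \<ge> 2\<close> by (simp add: C_def)
  moreover have "\<exists>p. p \<in> borel_measurable borel \<and> (\<forall>s. norm (p s) \<le> exp (C * x ^ 3) * norm v0) \<and>
      (\<forall>w. mild (control_term p) (2 * \<tau>) (phi 1 + v0) w \<longrightarrow>
        norm (w (2 * \<tau>) - phi 1) \<le> exp (C * x ^ 3) * (exp (- \<tau> * x ^ 4) * norm v0 + (norm v0)\<^sup>2))"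
    if \<tau>: "0 < \<tau>" "\<tau> \<le> T" and x: "1 \<le> x" "1 \<le> \<tau> * x ^ 4" and v0: "exp (C * x ^ 3) * norm v0 \<le> 1" for \<tau> x v0
  proof -
    define m where "m = nat \<lceil>x\<^sup>2 / \<alpha>\<rceil>"
    have pos: "x\<^sup>2 / \<alpha> > 0" using x \<alpha>_pos by simp
    then have m: "x\<^sup>2 / \<alpha> \<le> real m" "real m \<le> x\<^sup>2 / \<alpha> + 1" "1 \<le> m"
      by (simp_all add: m_def) linarith+
    define K where "K = Cb * real m powr r * real m ^ 3 / \<tau> * (2 + 2 * real m / (\<alpha>\<^sup>2 * \<tau>)) ^ m"
    have K: "0 \<le> K" "K \<le> exp (C0 * x ^ 3)"
      unfolding K_def using C0[OF \<tau>(1) x m(3,2)] Cb_pos \<tau> by simp_all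
    have x3: "1 \<le> x ^ 3" using x by simp
    \<comment> \<open>\<open>E * norm v0\<close> bounds the initial deviation together with the total forcing of the linearised equation.\<close>
    define E where "E = 1 + 2 * \<tau> * K * \<beta>"
    have "E \<ge> 1" using \<tau> K \<beta>_nonneg by (simp add: E_def)
    have big: "2 * (E + K)\<^sup>2 \<le> exp (C * x ^ 3)"
    proof -
      have "2 * \<tau> * K * \<beta> \<le> 2 * T * K * \<beta>"
        using \<tau> K \<beta>_nonneg by (intro mult_right_mono) auto
      then have "E + K \<le> 1 + (c - 1) * K" by (simp add: E_def c_def algebra_simps)
      also have "\<dots> \<le> exp (C0 * x ^ 3) + (c - 1) * exp (C0 * x ^ 3)"
        using K \<open>c \<ge> 2\<close> \<open>C0 > 0\<close> x by (intro add_mono mult_left_mono) auto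
      also have "\<dots> = c * exp (C0 * x ^ 3)" by (simp add: algebra_simps)
      also have "\<dots> \<le> exp (c * x ^ 3) * exp (C0 * x ^ 3)"
      proof (intro mult_right_mono)
        have "c \<le> exp c" using exp_ge_add_one_self[of c] by linarith
        also have "\<dots> \<le> exp (c * x ^ 3)" using x3 \<open>c \<ge> 2\<close> by simp
        finally show "c \<le> exp (c * x ^ 3)" .
      qed simp
      finally have "(E + K)\<^sup>2 \<le> (exp (c * x ^ 3) * exp (C0 * x ^ 3))\<^sup>2"
        using \<open>E \<ge> 1\<close> K by (intro power_mono) auto
      moreover have "2 \<le> exp (2 * x ^ 3)"
        using exp_ge_add_one_self[of "2 * x ^ 3"] x3 by linarith
      ultimately have "2 * (E + K)\<^sup>2 \<le> exp (2 * x ^ 3) * (exp (c * x ^ 3) * exp (C0 * x ^ 3))\<^sup>2"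
        by (intro mult_mono) auto
      also have "\<dots> = exp (C * x ^ 3)"
        by (simp add: C_def exp_add[symmetric] power2_eq_square algebra_simps)
      finally show ?thesis .
    qed
    have sq: "(E + K)\<^sup>2 \<ge> E\<^sup>2" "(E + K)\<^sup>2 \<ge> E + K" "E\<^sup>2 \<ge> E"
      using \<open>E \<ge> 1\<close> K by (auto intro!: power_mono self_le_power)
    obtain p where p: "p \<in> borel_measurable borel" and P: "\<And>s. norm (p s) \<le> K * norm v0"
      and lin: "norm (S (2 * \<tau>) v0 - duhamel (\<lambda>s. control_term p s (phi 1)) (2 * \<tau>))
        \<le> exp (- (\<alpha>\<^sup>2 * (real m)\<^sup>2) * \<tau>) * ((1 + \<tau> * K * \<beta>) * norm v0)"
      using low_mode_control[OF \<tau>(1) m(3), of v0] unfolding K_def by blast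
    interpret perturbed_semigroup S "control_term p" "K * norm v0 * \<beta>"
      by (rule perturbed_semigroup_control[OF p P])
    have "K \<le> exp (C * x ^ 3)" using sq big \<open>E \<ge> 1\<close> zero_le_power2[of "E + K"] by linarith
    then have "norm (p s) \<le> exp (C * x ^ 3) * norm v0" for s
      by (intro order_trans[OF P] mult_right_mono) auto
    moreover have "norm (w (2 * \<tau>) - phi 1) \<le> exp (C * x ^ 3) * (exp (- \<tau> * x ^ 4) * norm v0 + (norm v0)\<^sup>2)"
      if w: "mild (control_term p) (2 * \<tau>) (phi 1 + v0) w" for w
    proof -
      define e where "e = 2 * \<tau> * (K * norm v0 * \<beta>)"
      have e: "e = (E - 1) * norm v0" by (simp add: e_def E_def)
      have "2 * E * norm v0 \<le> exp (C * x ^ 3) * norm v0"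
        using big sq by (intro mult_right_mono) auto
      then have "2 * (E * norm v0) \<le> 1" using v0 by simp
      moreover have e': "norm v0 + e = E * norm v0" by (simp add: e algebra_simps)
      ultimately have "e \<le> 1 / 2" using norm_ge_zero[of v0] by linarith
      then have small: "2 * \<tau> * (K * norm v0 * \<beta>) \<le> 1 / 2" unfolding e_def .
      have range: "2 * \<tau> \<in> {0..2 * \<tau>}" using \<tau> by simp
      have d: "norm (w s - phi 1) \<le> 2 * E * norm v0" if "0 \<le> s" "s < 2 * \<tau>" for s
        using mild_near_ground_state(1)[OF p P w small, of s] that
        unfolding e_def[symmetric] e' by simp
      have nl: "norm (duhamel (\<lambda>s. control_term p s (w s - phi 1)) (2 * \<tau>)) \<le> 2 * \<tau> * (\<bar>K * norm v0 * \<beta>\<bar> * (2 * E * norm v0))"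
        using \<tau> by (intro norm_duhamel_G_le continuous_on_diff continuous_on_const mildD(1)[OF w] d) auto
      have "norm (w (2 * \<tau>) - phi 1) \<le> exp (- (\<alpha>\<^sup>2 * (real m)\<^sup>2) * \<tau>) * ((1 + \<tau> * K * \<beta>) * norm v0)
          + 2 * \<tau> * (\<bar>K * norm v0 * \<beta>\<bar> * (2 * E * norm v0))"
        unfolding mild_near_ground_state(2)[OF p P w small range]
        by (rule order_trans[OF norm_triangle_ineq4 add_mono[OF lin nl]])
      also have "\<dots> \<le> exp (- \<tau> * x ^ 4) * (E * norm v0) + 2 * E\<^sup>2 * (norm v0)\<^sup>2"
      proof (rule add_mono)
        have "x\<^sup>2 \<le> \<alpha> * real m" using m(1) \<alpha>_pos by (simp add: field_simps)
        then have "(x\<^sup>2)\<^sup>2 \<le> (\<alpha> * real m)\<^sup>2" by (intro power_mono) auto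
        then have "x ^ 4 \<le> \<alpha>\<^sup>2 * (real m)\<^sup>2" by (simp add: power_mult_distrib)
        then have "exp (- (\<alpha>\<^sup>2 * (real m)\<^sup>2) * \<tau>) \<le> exp (- \<tau> * x ^ 4)"
          using \<tau> by (simp add: mult.commute)
        moreover have nn: "0 \<le> 1 + \<tau> * K * \<beta>" using \<tau> K \<beta>_nonneg by simp
        moreover have "(1 + \<tau> * K * \<beta>) * norm v0 \<le> E * norm v0"
          using \<tau> K \<beta>_nonneg by (intro mult_right_mono) (auto simp: E_def)
        ultimately show "exp (- (\<alpha>\<^sup>2 * (real m)\<^sup>2) * \<tau>) * ((1 + \<tau> * K * \<beta>) * norm v0) \<le> exp (- \<tau> * x ^ 4) * (E * norm v0)"
          by (intro mult_mono[OF _ _ exp_ge_zero mult_nonneg_nonneg[OF nn norm_ge_zero]])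
        have "2 * \<tau> * (\<bar>K * norm v0 * \<beta>\<bar> * (2 * E * norm v0)) = e * (2 * E * norm v0)"
        proof -
          have "0 \<le> K * norm v0 * \<beta>" using K \<beta>_nonneg by simp
          then show ?thesis by (simp only: e_def abs_of_nonneg mult.assoc)
        qed
        also have "\<dots> \<le> (E * norm v0) * (2 * E * norm v0)"
        proof (rule mult_right_mono)
          show "e \<le> E * norm v0" using e' norm_ge_zero[of v0] by linarith
          show "0 \<le> 2 * E * norm v0" using \<open>E \<ge> 1\<close> by simp
        qed
        finally show "2 * \<tau> * (\<bar>K * norm v0 * \<beta>\<bar> * (2 * E * norm v0)) \<le> 2 * E\<^sup>2 * (norm v0)\<^sup>2"
          by (simp add: power2_eq_square mult_ac)
      qed
      also have "\<dots> \<le> exp (- \<tau> * x ^ 4) * (exp (C * x ^ 3) * norm v0) + exp (C * x ^ 3) * (norm v0)\<^sup>2"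
      proof -
        have "2 * E\<^sup>2 \<le> exp (C * x ^ 3)" "E \<le> exp (C * x ^ 3)"
          using big sq \<open>E \<ge> 1\<close> by linarith+
        then show ?thesis by (intro add_mono mult_left_mono mult_right_mono) auto
      qed
      finally show ?thesis by (simp add: algebra_simps)
    qed
    ultimately show ?thesis using p by (intro exI[of _ p] conjI allI impI)
  qed
  ultimately show ?thesis by (intro exI[of _ C] conjI allI impI)
qed

end

section \<open>Steering to the ground state by infinitely many steps\<close>

text \<open>
  The cost \<open>g\<close> takes one tenth of the exponent \<open>a\<close>, and the factor \<open>2\<close> from adding the linear and the
  quadratic error takes another tenth. Of the exponent \<open>2 a\<close> there remains \<open>18 / 10 * a\<close>, which
  exceeds \<open>(6 / 5) ^ 3 * a = 1.728 * a\<close>.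
\<close>
lemma superexponential_step:
  fixes a \<epsilon> g n n' :: real
  assumes a: "a \<ge> 10" and g: "0 \<le> g" "g \<le> exp (a / 10)" and \<epsilon>: "0 < \<epsilon>" "\<epsilon> \<le> 1"
    and n: "0 \<le> n" "n \<le> \<epsilon> * exp (- a)" and n': "n' \<le> g * (exp (- a) * n + n\<^sup>2)"
  shows "g * n \<le> \<epsilon>" and "n' \<le> \<epsilon> * exp (- ((6 / 5) ^ 3 * a))"
proof -
  have "g * n \<le> exp (a / 10) * (\<epsilon> * exp (- a))"
    using g n by (intro mult_mono) auto
  also have "\<dots> = \<epsilon> * exp (- (9 / 10 * a))"
    by (simp add: exp_add[symmetric])
  also have "\<dots> \<le> \<epsilon> * 1"
    using a \<epsilon> by (intro mult_left_mono) auto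
  finally show "g * n \<le> \<epsilon>" by simp
  have "n\<^sup>2 \<le> (\<epsilon> * exp (- a))\<^sup>2" using n by (intro power_mono) auto
  also have "\<dots> = \<epsilon> * (\<epsilon> * exp (- (2 * a)))"
    by (simp add: power2_eq_square exp_add[symmetric])
  also have "\<dots> \<le> 1 * (\<epsilon> * exp (- (2 * a)))"
    using \<epsilon> by (intro mult_right_mono) auto
  finally have n2: "n\<^sup>2 \<le> \<epsilon> * exp (- (2 * a))" by simp
  have "exp (- a) * n \<le> exp (- a) * (\<epsilon> * exp (- a))"
    using n by (intro mult_left_mono) auto
  also have "\<dots> = \<epsilon> * exp (- (2 * a))"
    by (simp add: exp_add[symmetric])
  finally have "exp (- a) * n + n\<^sup>2 \<le> 2 * (\<epsilon> * exp (- (2 * a)))"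
    using n2 by simp
  then have "n' \<le> exp (a / 10) * (2 * (\<epsilon> * exp (- (2 * a))))"
    using n' g n by (elim order_trans) (intro mult_mono, auto)
  also have "\<dots> = \<epsilon> * (2 * exp (- (19 / 10 * a)))"
    by (simp add: exp_add[symmetric])
  also have "\<dots> \<le> \<epsilon> * (exp (a / 10) * exp (- (19 / 10 * a)))"
  proof -
    have "2 \<le> exp (a / 10)" using exp_ge_add_one_self[of "a / 10"] a by linarith
    then show ?thesis using \<epsilon> by (intro mult_left_mono mult_right_mono) auto
  qed
  also have "\<dots> = \<epsilon> * exp (- (18 / 10 * a))"
    by (simp add: exp_add[symmetric])
  also have "\<dots> \<le> \<epsilon> * exp (- ((6 / 5) ^ 3 * a))"
    using a \<epsilon> by (simp add: power3_eq_cube)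
  finally show "n' \<le> \<epsilon> * exp (- ((6 / 5) ^ 3 * a))" .
qed

context bilinear_control
begin

lemma local_controllability:
  assumes "T > 0" and \<epsilon>: "\<epsilon> > 0" "\<epsilon> \<le> 1" and small: "T * (\<epsilon> * \<beta>) \<le> 1 / 2"
  shows "\<exists>R>0. \<forall>w0. norm (w0 - phi 1) < R \<longrightarrow>
    (\<exists>p. p \<in> borel_measurable borel \<and> (\<forall>s. norm (p s) \<le> \<epsilon>) \<and> (\<exists>w. mild (control_term p) T w0 w \<and> w T = phi 1))"
proof -
  obtain C where "C > 0" and step: "\<And>\<tau> x v0. 0 < \<tau> \<Longrightarrow> \<tau> \<le> T \<Longrightarrow> 1 \<le> x \<Longrightarrow> 1 \<le> \<tau> * x ^ 4 \<Longrightarrow>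
      exp (C * x ^ 3) * norm v0 \<le> 1 \<Longrightarrow>
    (\<exists>p. p \<in> borel_measurable borel \<and> (\<forall>s. norm (p s) \<le> exp (C * x ^ 3) * norm v0) \<and>
      (\<forall>w. mild (control_term p) (2 * \<tau>) (phi 1 + v0) w \<longrightarrow>
        norm (w (2 * \<tau>) - phi 1) \<le> exp (C * x ^ 3) * (exp (- \<tau> * x ^ 4) * norm v0 + (norm v0)\<^sup>2)))"
    using one_control_step[OF \<open>T > 0\<close>] by blast
  \<comment> \<open>The steps have length \<open>2 * \<tau>0 * (5 / 6) ^ j\<close>, which sums to \<open>12 * \<tau>0 = T\<close>.\<close>
  define \<tau>0 where "\<tau>0 = T / 12"
  have "\<tau>0 > 0" using \<open>T > 0\<close> by (simp add: \<tau>0_def)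
  \<comment> \<open>The initial value of \<open>x\<close>, so large that the cost exponent is at most a tenth of the gain exponent \<open>L\<close>.\<close>
  define Y where "Y = max 1 (max (10 * C / \<tau>0) (10 / \<tau>0))"
  define L where "L = \<tau>0 * Y ^ 4"
  have Y: "Y \<ge> 1" "10 * C \<le> \<tau>0 * Y" "10 \<le> \<tau>0 * Y"
  proof -
    show "Y \<ge> 1" by (simp add: Y_def)
    have "10 * C / \<tau>0 \<le> Y" "10 / \<tau>0 \<le> Y" by (simp_all add: Y_def)
    then show "10 * C \<le> \<tau>0 * Y" "10 \<le> \<tau>0 * Y"
      using \<open>\<tau>0 > 0\<close> by (simp_all add: field_simps)
  qed
  have L: "C * Y ^ 3 \<le> L / 10" "L \<ge> 10"
  proof -
    have "10 * C * Y ^ 3 \<le> \<tau>0 * Y * Y ^ 3"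
      using Y by (intro mult_right_mono) auto
    also have "\<dots> = L" unfolding L_def mult.assoc by (simp add: numeral_eq_Suc)
    finally show "C * Y ^ 3 \<le> L / 10" by simp
    have "\<tau>0 * Y \<le> \<tau>0 * Y ^ 4"
      using Y(1) \<open>\<tau>0 > 0\<close> by (intro mult_left_mono self_le_power) auto
    then show "L \<ge> 10" using Y(3) by (simp add: L_def)
  qed
  define \<tau> where "\<tau> j = \<tau>0 * (5 / 6) ^ j" for j :: nat
  define x where "x j = Y * (6 / 5) ^ j" for j :: nat
  define a where "a j = L * ((6 / 5) ^ 3) ^ j" for j :: nat
  define t where "t j = T * (1 - (5 / 6) ^ j)" for j :: nat
  have \<tau>: "0 < \<tau> j" "2 * \<tau> j \<le> T" "\<tau> j \<le> T" for j
  proof -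
    have "(5 / 6 :: real) ^ j \<le> 1" by (intro power_le_one) auto
    then have "\<tau> j \<le> \<tau>0" using \<open>\<tau>0 > 0\<close> by (simp add: \<tau>_def)
    then show "2 * \<tau> j \<le> T" "\<tau> j \<le> T" using \<open>T > 0\<close> by (simp_all add: \<tau>0_def)
    show "0 < \<tau> j" using \<open>\<tau>0 > 0\<close> by (simp add: \<tau>_def)
  qed
  have x: "1 \<le> x j" for j
    using mult_mono[OF Y(1), of 1 "(6 / 5) ^ j"] Y(1) by (simp add: x_def)
  have a: "a j \<ge> 10" "a (Suc j) = (6 / 5) ^ 3 * a j" for j
  proof -
    have "(1::real) \<le> ((6 / 5) ^ 3) ^ j" by (intro one_le_power) simp
    then show "a j \<ge> 10" using mult_mono[OF L(2), of 1 "((6 / 5) ^ 3) ^ j"] L(2) by (simp add: a_def)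
  qed (simp add: a_def)
  have \<tau>x: "\<tau> j * x j ^ 4 = a j" for j
  proof -
    have "((5 / 6) ^ j * ((6 / 5) ^ j) ^ 4 :: real) = ((5 / 6) * (6 / 5) ^ 4) ^ j"
      by (simp only: power_mult_distrib power_mult[symmetric] mult.commute)
    also have "(5 / 6) * (6 / 5) ^ 4 = ((6 / 5) ^ 3 :: real)" by (simp add: power_divide)
    finally show ?thesis
      by (simp add: \<tau>_def x_def a_def L_def power_mult_distrib mult_ac)
  qed
  have cost: "exp (C * x j ^ 3) \<le> exp (a j / 10)" for j
  proof -
    have "C * x j ^ 3 = (C * Y ^ 3) * ((6 / 5) ^ 3) ^ j"
      by (simp add: x_def power_mult_distrib power_mult[symmetric] mult.commute)
    also have "\<dots> \<le> (L / 10) * ((6 / 5) ^ 3) ^ j"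
      using L by (intro mult_right_mono) auto
    finally show ?thesis by (simp add: a_def)
  qed
  \<comment> \<open>Step \<open>j\<close> from deviation \<open>v\<close> with control \<open>p\<close> must end at \<open>v'\<close>, provided that \<open>v\<close> is within the bound for step \<open>j\<close>.\<close>
  define good where "good j v p v' \<longleftrightarrow> (norm v \<le> \<epsilon> * exp (- a j) \<longrightarrow>
      p \<in> borel_measurable borel \<and> (\<forall>s. norm (p s) \<le> \<epsilon>) \<and> norm v' \<le> \<epsilon> * exp (- a (Suc j)) \<and>
      (\<forall>w. mild (control_term p) (2 * \<tau> j) (phi 1 + v) w \<longrightarrow> w (2 * \<tau> j) = phi 1 + v'))" for j v p v'
  have "\<exists>p v'. good j v p v'" for j v
  proof (cases "norm v \<le> \<epsilon> * exp (- a j)")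
    case v: True
    note sup = superexponential_step[OF a(1)[of j] exp_ge_zero cost \<epsilon> norm_ge_zero v]
    have g: "exp (C * x j ^ 3) * norm v \<le> \<epsilon>" by (rule sup(1)[OF order_refl])
    then have "exp (C * x j ^ 3) * norm v \<le> 1" using \<epsilon>(2) by simp
    moreover have "1 \<le> \<tau> j * x j ^ 4" using a(1)[of j] by (simp add: \<tau>x)
    ultimately obtain p where p: "p \<in> borel_measurable borel" "\<And>s. norm (p s) \<le> exp (C * x j ^ 3) * norm v"
      and end': "\<And>w. mild (control_term p) (2 * \<tau> j) (phi 1 + v) w \<Longrightarrow>
        norm (w (2 * \<tau> j) - phi 1) \<le> exp (C * x j ^ 3) * (exp (- \<tau> j * x j ^ 4) * norm v + (norm v)\<^sup>2)"
      using step[of "\<tau> j" "x j" v] \<tau>[of j] x[of j] by blast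
    have P: "norm (p s) \<le> \<epsilon>" for s by (rule order_trans[OF p(2) g])
    interpret perturbed_semigroup S "control_term p" "\<epsilon> * \<beta>"
      by (rule perturbed_semigroup_control[OF p(1) P])
    have "2 * \<tau> j * (\<epsilon> * \<beta>) \<le> T * (\<epsilon> * \<beta>)"
      using \<tau>[of j] \<epsilon> \<beta>_nonneg by (intro mult_right_mono) auto
    then have small': "2 * \<tau> j * \<bar>\<epsilon> * \<beta>\<bar> \<le> 1 / 2"
      using \<epsilon> \<beta>_nonneg order_trans[OF _ small] by (simp only: abs_of_nonneg mult_nonneg_nonneg less_imp_le)
    have "0 \<le> 2 * \<tau> j" using \<tau>[of j] by simp
    from mild_exists[OF small' this] obtain w where w: "mild (control_term p) (2 * \<tau> j) (phi 1 + v) w" by blast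
    have "norm (w (2 * \<tau> j) - phi 1) \<le> \<epsilon> * exp (- ((6 / 5) ^ 3 * a j))"
      by (rule sup(2)) (use end'[OF w] in \<open>simp add: \<tau>x\<close>)
    then have "norm (w (2 * \<tau> j) - phi 1) \<le> \<epsilon> * exp (- a (Suc j))" by (simp add: a(2))
    moreover have "w' (2 * \<tau> j) = phi 1 + (w (2 * \<tau> j) - phi 1)"
      if "mild (control_term p) (2 * \<tau> j) (phi 1 + v) w'" for w'
      using mild_unique[OF that w small', of "2 * \<tau> j"] \<tau>[of j] by simp
    ultimately show ?thesis using p(1) P
      unfolding good_def by (intro exI[of _ p] exI[of _ "w (2 * \<tau> j) - phi 1"] conjI impI allI)
  qed (simp add: good_def)
  then obtain pc vc where "\<And>j v. good j v (pc j v) (vc j v)" by metis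
  then have pc:
    "\<And>j v. norm v \<le> \<epsilon> * exp (- a j) \<Longrightarrow> pc j v \<in> borel_measurable borel"
    "\<And>j v s. norm v \<le> \<epsilon> * exp (- a j) \<Longrightarrow> norm (pc j v s) \<le> \<epsilon>"
    "\<And>j v. norm v \<le> \<epsilon> * exp (- a j) \<Longrightarrow> norm (vc j v) \<le> \<epsilon> * exp (- a (Suc j))"
    "\<And>j v w. norm v \<le> \<epsilon> * exp (- a j) \<Longrightarrow> mild (control_term (pc j v)) (2 * \<tau> j) (phi 1 + v) w
      \<Longrightarrow> w (2 * \<tau> j) = phi 1 + vc j v"
    unfolding good_def by blast+
  show ?thesis
  proof (intro exI[of _ "\<epsilon> * exp (- a 0)"] conjI allI impI)
    show "\<epsilon> * exp (- a 0) > 0" using \<epsilon> by simp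
    fix w0 assume w0: "norm (w0 - phi 1) < \<epsilon> * exp (- a 0)"
    \<comment> \<open>The deviations at the switching times: each control depends on the state reached before.\<close>
    define v where "v = rec_nat (w0 - phi 1) vc"
    have v_0: "v 0 = w0 - phi 1" and v_Suc: "v (Suc j) = vc j (v j)" for j
      by (simp_all add: v_def)
    have v: "norm (v j) \<le> \<epsilon> * exp (- a j)" for j
      by (induction j) (use w0 in \<open>auto simp: v_0 v_Suc intro: pc(3)\<close>)
    have t: "t 0 = 0" "t (Suc j) = t j + 2 * \<tau> j" "t j < T" "0 \<le> t j" for j
      using \<open>T > 0\<close> by (simp_all add: t_def \<tau>_def \<tau>0_def algebra_simps power_le_one)
    have "mono t"
      using t(2) \<tau>(1) by (intro incseq_SucI) (simp add: less_imp_le)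
    \<comment> \<open>\<open>N s\<close> is the index of the step to which time \<open>s\<close> belongs.\<close>
    define N where "N s = (LEAST j. s < t (Suc j))" for s
    have N: "N s = j" if "t j \<le> s" "s < t (Suc j)" for s j
      unfolding N_def
    proof (rule Least_equality)
      fix i assume "s < t (Suc i)"
      with that(1) have "t j < t (Suc i)" by simp
      then have "\<not> Suc i \<le> j" using monoD[OF \<open>mono t\<close>, of "Suc i" j] by auto
      then show "j \<le> i" by simp
    qed (rule that(2))
    define p where "p s = pc (N s) (v (N s)) (s - t (N s))" for s
    have p: "p \<in> borel_measurable borel"
    proof -
      have N_meas: "N \<in> measurable borel (count_space UNIV)"
        unfolding N_def by measurable
      have "(\<lambda>s. pc i (v i) (s - t i)) \<in> borel_measurable borel" for i
        by (rule measurable_compose[OF _ pc(1)[OF v]]) measurable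
      then show ?thesis
        unfolding p_def by (rule measurable_compose_countable[OF _ N_meas])
    qed
    have P: "norm (p s) \<le> \<epsilon>" for s unfolding p_def by (rule pc(2)[OF v])
    interpret perturbed_semigroup S "control_term p" "\<epsilon> * \<beta>"
      by (rule perturbed_semigroup_control[OF p P])
    have "T * \<bar>\<epsilon> * \<beta>\<bar> \<le> 1 / 2" using small \<epsilon> \<beta>_nonneg by simp
    from mild_exists[OF this] obtain w where w: "mild (control_term p) T w0 w" using \<open>T > 0\<close> by auto
    \<comment> \<open>Restarting the global solution at \<open>t j\<close> gives a solution of step \<open>j\<close>, hence the global solution passes through the prescribed states.\<close>
    have wt: "w (t j) = phi 1 + v j" for j
    proof (induction j)
      case 0
      have "duhamel (\<lambda>s. control_term p s (w s)) 0 = 0"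
        by (simp add: duhamel_def)
      then show ?case using mildD(2)[OF w, of 0] \<open>T > 0\<close> by (simp add: t(1) v_0 nonpos)
    next
      case (Suc j)
      have "mild (\<lambda>s. control_term p (t j + s)) (2 * \<tau> j) (w (t j)) (\<lambda>s. w (t j + s))"
        using t(3)[of "Suc j"] t(2)[of j] t(4)[of j] by (intro mild_restart[OF w]) auto
      then have "mild (control_term (pc j (v j))) (2 * \<tau> j) (w (t j)) (\<lambda>s. w (t j + s))"
      proof (rule mild_cong)
        fix s y assume "0 \<le> s" "s < 2 * \<tau> j"
        then have "N (t j + s) = j" by (intro N) (simp_all add: t(2))
        then show "control_term p (t j + s) y = control_term (pc j (v j)) s y"
          by (simp add: control_term_def p_def)
      qed
      from pc(4)[OF v this[unfolded Suc]] show ?case by (simp add: t(2) v_Suc)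
    qed
    have "v \<longlonglongrightarrow> 0"
    proof (rule Lim_null_comparison)
      have "exp (- a j) \<le> (5 / 6) ^ j" for j
      proof -
        have "(6 / 5) ^ j \<le> ((6 / 5) ^ 3 :: real) ^ j"
          by (intro power_mono) (simp_all add: power3_eq_cube)
        also have "\<dots> \<le> a j"
          using mult_right_mono[of 1 L "((6 / 5) ^ 3) ^ j"] L(2) by (simp add: a_def)
        also have "\<dots> \<le> exp (a j)" using exp_ge_add_one_self[of "a j"] by linarith
        finally have "1 / exp (a j) \<le> 1 / (6 / 5) ^ j" by (intro divide_left_mono) auto
        also have "\<dots> = (5 / 6) ^ j" by (simp add: power_divide)
        finally show ?thesis by (simp add: exp_minus field_simps)
      qed
      then have "norm (v j) \<le> \<epsilon> * (5 / 6) ^ j" for j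
        using v[of j] \<epsilon> by (meson less_imp_le mult_left_mono order_trans)
      then show "\<forall>\<^sub>F j in sequentially. norm (v j) \<le> \<epsilon> * (5 / 6) ^ j" by simp
      show "(\<lambda>j. \<epsilon> * (5 / 6) ^ j) \<longlonglongrightarrow> 0"
        by (intro tendsto_mult_right_zero LIMSEQ_power_zero) simp
    qed
    then have "(\<lambda>j. w (t j)) \<longlonglongrightarrow> phi 1 + 0"
      unfolding wt by (intro tendsto_intros)
    moreover have "t \<longlonglongrightarrow> T * (1 - 0)"
      unfolding t_def by (intro tendsto_intros LIMSEQ_power_zero) simp
    then have "(\<lambda>j. w (t j)) \<longlonglongrightarrow> w T"
      using continuous_on_tendsto_compose[OF mildD(1)[OF w], of t T sequentially] by simp
    ultimately have "w T = phi 1" using LIMSEQ_unique by force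
    with p P w show "\<exists>p. p \<in> borel_measurable borel \<and> (\<forall>s. norm (p s) \<le> \<epsilon>) \<and> (\<exists>w. mild (control_term p) T w0 w \<and> w T = phi 1)"
      by (intro exI[of _ p] conjI allI exI[of _ w])
  qed
qed

end

section \<open>Return to the original equation\<close>

text \<open>
  The end point is a null set, and completing the measure does not change integrals of Borel functions.
\<close>
lemma integral_lebesgue_on_eq_half_open:
  fixes g :: "real \<Rightarrow> 'x::{banach,second_countable_topology}"
  assumes g: "g \<in> borel_measurable borel" and int: "integrable lborel (\<lambda>s. indicator {0..<t} s *\<^sub>R g s)"
  shows "integrable (lebesgue_on {0..t}) g"
    and "(\<integral>s. g s \<partial>lebesgue_on {0..t}) = (\<integral>s. indicator {0..<t} s *\<^sub>R g s \<partial>lborel)"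
proof -
  have m: "(\<lambda>s. indicator {0..t} s *\<^sub>R g s) \<in> borel_measurable lborel"
    "(\<lambda>s. indicator {0..<t} s *\<^sub>R g s) \<in> borel_measurable lborel"
    using g by simp_all
  have ae: "AE s in lborel. indicator {0..t} s *\<^sub>R g s = indicator {0..<t} s *\<^sub>R g s"
    using AE_lborel_singleton[of t] by eventually_elim (auto simp: indicator_def)
  have 1: "integrable lborel (\<lambda>s. indicator {0..t} s *\<^sub>R g s)"
    using int integrable_cong_AE[OF m ae] by simp
  show "integrable (lebesgue_on {0..t}) g"
    using 1 m by (simp add: integrable_restrict_space integrable_completion)
  have "(\<integral>s. g s \<partial>lebesgue_on {0..t}) = (\<integral>s. indicator {0..t} s *\<^sub>R g s \<partial>lborel)"
    using m by (simp add: integral_restrict_space integral_completion)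
  also have "\<dots> = (\<integral>s. indicator {0..<t} s *\<^sub>R g s \<partial>lborel)"
    by (rule integral_cong_AE[OF m ae])
  finally show "(\<integral>s. g s \<partial>lebesgue_on {0..t}) = (\<integral>s. indicator {0..<t} s *\<^sub>R g s \<partial>lborel)" .
qed

lemma L2_of_bounded:
  fixes p :: "real \<Rightarrow> 'k::{real_normed_field,euclidean_space}"
  assumes p: "p \<in> borel_measurable borel" and P: "\<And>s. norm (p s) \<le> \<epsilon>" and "T \<ge> 0"
  shows "L2_function T p" and "L2_function_norm T p \<le> \<epsilon> * sqrt T"
proof -
  have "\<epsilon> \<ge> 0" by (rule order_trans[OF norm_ge_zero P])
  have m: "(\<lambda>s. (norm (p s))\<^sup>2) \<in> borel_measurable borel" using p by measurable
  have P2: "norm ((norm (p s))\<^sup>2) \<le> \<epsilon>\<^sup>2" for s using P by (simp add: power_mono)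
  note I = norm_integral_indicator_le[OF m P2 \<open>T \<ge> 0\<close>]
  note J = integral_lebesgue_on_eq_half_open[OF m I(1)]
  have "p \<in> borel_measurable lborel" using p by simp
  then have "p \<in> borel_measurable (lebesgue_on {0..T})"
    by (intro measurable_restrict_space1 measurable_completion)
  then show "L2_function T p"
    using J(1) by (simp add: L2_function_def)
  have "(\<integral>s. (norm (p s))\<^sup>2 \<partial>lebesgue_on {0..T}) \<le> T * \<epsilon>\<^sup>2"
    using I(2) unfolding J(2) by simp
  then have "L2_function_norm T p \<le> sqrt (T * \<epsilon>\<^sup>2)"
    unfolding L2_function_norm_def by (rule real_sqrt_le_mono)
  then show "L2_function_norm T p \<le> \<epsilon> * sqrt T"
    using \<open>\<epsilon> \<ge> 0\<close> by (simp add: real_sqrt_mult mult.commute)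
qed

text \<open>
  Here \<open>S\<close> is the semigroup generated by \<open>lam 1 - A\<close>; it differs from the semigroup of \<open>- A\<close> by the
  scalar factor \<open>exp (lam 1 * t)\<close>.
\<close>
locale ground_state_control = diagonal_operator smul ip phi D A lam
    + bilinear_control S smul ip phi "\<lambda>k. lam k - lam 1" B \<alpha> \<beta> Cb r
  for S :: "real \<Rightarrow> 'x::{banach,second_countable_topology} \<Rightarrow> 'x"
    and smul :: "'k::{real_normed_field,euclidean_space} \<Rightarrow> 'x \<Rightarrow> 'x"
    and ip :: "'x \<Rightarrow> 'x \<Rightarrow> 'k" and phi :: "nat \<Rightarrow> 'x"
    and D :: "'x set" and A :: "'x \<Rightarrow> 'x" and lam :: "nat \<Rightarrow> real"
    and B :: "'x \<Rightarrow> 'x" and \<alpha> \<beta> Cb r :: real +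
  assumes B_scaleR: "B (c *\<^sub>R x) = c *\<^sub>R B x"
begin

lemma exp_semigroup_eq_shift:
  assumes "t \<ge> 0"
  shows "exp_semigroup smul D A t x = exp (- lam 1 * t) *\<^sub>R S t x"
proof (rule eqI_phi)
  fix k :: nat assume k: "k \<ge> 1"
  have "- lam k * t = - lam 1 * t + - (lam k - lam 1) * t" by (simp add: algebra_simps)
  then show "ip (exp_semigroup smul D A t x) (phi k) = ip (exp (- lam 1 * t) *\<^sub>R S t x) (phi k)"
    unfolding exp_semigroup_eq_heat[OF assms] ip_heat[OF k assms] ip_scaleR_left ip_S[OF k assms]
    by (simp only: exp_add scaleR_scaleR)
qed

text \<open>
  The ground state amplitude can be pulled out of the Duhamel integral, since
  \<open>exp (- lam 1 * (t - s)) * exp (- lam 1 * s)\<close> does not depend on \<open>s\<close>.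
\<close>
lemma duhamel_control_lebesgue:
  assumes p: "p \<in> borel_measurable borel" and P: "\<And>s. norm (p s) \<le> P"
    and w: "continuous_on UNIV w" and "t \<ge> 0"
    and u: "\<And>s. s \<in> {0..t} \<Longrightarrow> u s = exp (- lam 1 * s) *\<^sub>R w s"
  shows "integrable (lebesgue_on {0..t}) (\<lambda>s. exp_semigroup smul D A (t - s) (smul (p s) (B (u s))))"
    and "(\<integral>s. exp_semigroup smul D A (t - s) (smul (p s) (B (u s))) \<partial>lebesgue_on {0..t})
      = exp (- lam 1 * t) *\<^sub>R duhamel (\<lambda>s. control_term p s (w s)) t"
proof -
  interpret perturbed_semigroup S "control_term p" "P * \<beta>"
    by (rule perturbed_semigroup_control[OF p P])
  define g where "g s = exp (- lam 1 * t) *\<^sub>R S (t - s) (control_term p s (w s))" for s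
  have g: "exp_semigroup smul D A (t - s) (smul (p s) (B (u s))) = g s" if "s \<in> space (lebesgue_on {0..t})" for s
  proof -
    have s: "s \<in> {0..t}" using that by (simp add: space_restrict_space)
    have "smul (p s) (B (u s)) = exp (- lam 1 * s) *\<^sub>R control_term p s (w s)"
      by (simp add: u[OF s] B_scaleR smul_scaleR_right control_term_def)
    then have "exp_semigroup smul D A (t - s) (smul (p s) (B (u s)))
        = exp (- lam 1 * (t - s)) *\<^sub>R exp (- lam 1 * s) *\<^sub>R S (t - s) (control_term p s (w s))"
      using s by (simp add: exp_semigroup_eq_shift linear_cmul[OF bounded_linear.linear[OF linear]])
    also have "\<dots> = g s"
      by (simp add: g_def exp_add[symmetric] algebra_simps)
    finally show ?thesis .
  qed
  have meas: "(\<lambda>s. control_term p s (w s)) \<in> borel_measurable borel" by (rule G_measurable[OF w])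
  obtain M where M: "\<And>s. 0 \<le> s \<Longrightarrow> s \<le> t \<Longrightarrow> norm (control_term p s (w s)) \<le> M"
    using bounded_along_path[OF w] by metis
  have "integrable lborel (\<lambda>s. exp (- lam 1 * t) *\<^sub>R (indicator {0..<t} s *\<^sub>R S (t - s) (control_term p s (w s))))"
    by (intro integrable_scaleR_right integrable_duhamel[OF meas M \<open>t \<ge> 0\<close>]) auto
  then have int: "integrable lborel (\<lambda>s. indicator {0..<t} s *\<^sub>R g s)"
    by (simp add: g_def mult.commute)
  have mg: "g \<in> borel_measurable borel"
    unfolding g_def using measurable_S[OF meas] by (intro borel_measurable_scaleR) auto
  note L = integral_lebesgue_on_eq_half_open[OF mg int]
  show "integrable (lebesgue_on {0..t}) (\<lambda>s. exp_semigroup smul D A (t - s) (smul (p s) (B (u s))))"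
  proof -
    have "integrable (lebesgue_on {0..t}) (\<lambda>s. exp_semigroup smul D A (t - s) (smul (p s) (B (u s))))
        \<longleftrightarrow> integrable (lebesgue_on {0..t}) g"
      by (rule Bochner_Integration.integrable_cong[OF refl g])
    then show ?thesis using L(1) by simp
  qed
  have "(\<integral>s. exp_semigroup smul D A (t - s) (smul (p s) (B (u s))) \<partial>lebesgue_on {0..t}) = (\<integral>s. g s \<partial>lebesgue_on {0..t})"
    by (rule Bochner_Integration.integral_cong[OF refl g])
  also have "\<dots> = (\<integral>s. exp (- lam 1 * t) *\<^sub>R (indicator {0..<t} s *\<^sub>R S (t - s) (control_term p s (w s))) \<partial>lborel)"
    unfolding L(2) by (simp add: g_def mult.commute)
  also have "\<dots> = exp (- lam 1 * t) *\<^sub>R duhamel (\<lambda>s. control_term p s (w s)) t"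
    unfolding duhamel_def by (rule integral_scaleR_right)
  finally show "(\<integral>s. exp_semigroup smul D A (t - s) (smul (p s) (B (u s))) \<partial>lebesgue_on {0..t})
      = exp (- lam 1 * t) *\<^sub>R duhamel (\<lambda>s. control_term p s (w s)) t" .
qed

lemma mild_solution_iff_mild:
  assumes p: "p \<in> borel_measurable borel" and P: "\<And>s. norm (p s) \<le> P"
    and w: "continuous_on UNIV w" and u: "\<And>s. s \<in> {0..T} \<Longrightarrow> u s = exp (- lam 1 * s) *\<^sub>R w s"
  shows "mild_solution smul D A B T p u0 u \<longleftrightarrow> mild (control_term p) T u0 w"
proof -
  have cu: "continuous_on {0..T} u"
  proof (rule continuous_on_eq)
    show "continuous_on {0..T} (\<lambda>s. exp (- lam 1 * s) *\<^sub>R w s)"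
      by (intro continuous_intros continuous_on_subset[OF w]) auto
  qed (simp add: u)
  have eq: "(integrable (lebesgue_on {0..t}) (\<lambda>s. exp_semigroup smul D A (t - s) (smul (p s) (B (u s)))) \<and>
      u t = exp_semigroup smul D A t u0
        - (\<integral>s. exp_semigroup smul D A (t - s) (smul (p s) (B (u s))) \<partial>lebesgue_on {0..t}))
      \<longleftrightarrow> w t = S t u0 - duhamel (\<lambda>s. control_term p s (w s)) t" if t: "t \<in> {0..T}" for t
  proof -
    have "t \<ge> 0" using t by simp
    have us: "u s = exp (- lam 1 * s) *\<^sub>R w s" if "s \<in> {0..t}" for s
      using that t by (intro u) auto
    note D = duhamel_control_lebesgue[where u = u, OF p P w \<open>t \<ge> 0\<close> us]
    have I: "(\<integral>s. exp_semigroup smul D A (t - s) (smul (p s) (B (u s))) \<partial>lebesgue_on {0..t})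
      = exp (- lam 1 * t) *\<^sub>R duhamel (\<lambda>s. control_term p s (w s)) t"
      by (rule D(2))
    have "u t = exp_semigroup smul D A t u0
        - (\<integral>s. exp_semigroup smul D A (t - s) (smul (p s) (B (u s))) \<partial>lebesgue_on {0..t})
      \<longleftrightarrow> exp (- lam 1 * t) *\<^sub>R w t = exp (- lam 1 * t) *\<^sub>R (S t u0 - duhamel (\<lambda>s. control_term p s (w s)) t)"
      unfolding I u[OF t] exp_semigroup_eq_shift[OF \<open>t \<ge> 0\<close>] scaleR_diff_right ..
    then show ?thesis using D(1) by (simp only: scaleR_cancel_left) simp
  qed
  show ?thesis
    unfolding mild_solution_def mild_def using cu w by (simp only: eq simp_thms cong: ball_cong)
qed

lemma controllability_to_ground_state:
  assumes "T > 0" and \<epsilon>: "\<epsilon> > 0" "\<epsilon> \<le> 1" and small: "T * (\<epsilon> * \<beta>) \<le> 1 / 2"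
  shows "\<exists>R>0. \<forall>u0. norm (u0 - phi 1) < R \<longrightarrow>
    (\<exists>p. p \<in> borel_measurable borel \<and> (\<forall>s. norm (p s) \<le> \<epsilon>) \<and>
      (\<exists>u. mild_solution smul D A B T p u0 u \<and>
        (\<forall>v. mild_solution smul D A B T p u0 v \<longrightarrow> (\<forall>t\<in>{0..T}. v t = u t)) \<and>
        u T = exp (- lam 1 * T) *\<^sub>R phi 1))"
proof -
  obtain R where "R > 0" and R: "\<And>w0. norm (w0 - phi 1) < R \<Longrightarrow>
    \<exists>p. p \<in> borel_measurable borel \<and> (\<forall>s. norm (p s) \<le> \<epsilon>) \<and> (\<exists>w. mild (control_term p) T w0 w \<and> w T = phi 1)"
    using local_controllability[OF assms] by blast
  have "\<exists>p. p \<in> borel_measurable borel \<and> (\<forall>s. norm (p s) \<le> \<epsilon>) \<and>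
      (\<exists>u. mild_solution smul D A B T p u0 u \<and>
        (\<forall>v. mild_solution smul D A B T p u0 v \<longrightarrow> (\<forall>t\<in>{0..T}. v t = u t)) \<and>
        u T = exp (- lam 1 * T) *\<^sub>R phi 1)" if u0: "norm (u0 - phi 1) < R" for u0
  proof -
    obtain p w where p: "p \<in> borel_measurable borel" and P: "\<And>s. norm (p s) \<le> \<epsilon>"
      and w: "mild (control_term p) T u0 w" and wT: "w T = phi 1"
      using R[OF u0] by blast
    interpret perturbed_semigroup S "control_term p" "\<epsilon> * \<beta>"
      by (rule perturbed_semigroup_control[OF p P])
    have small': "T * \<bar>\<epsilon> * \<beta>\<bar> \<le> 1 / 2" using small \<epsilon> \<beta>_nonneg by simp
    define u where "u t = exp (- lam 1 * t) *\<^sub>R w t" for t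
    have "mild_solution smul D A B T p u0 u"
      using mild_solution_iff_mild[OF p P mildD(1)[OF w], of T u u0] w by (simp add: u_def)
    moreover have "v t = u t" if v: "mild_solution smul D A B T p u0 v" and t: "t \<in> {0..T}" for v t
    proof -
      \<comment> \<open>A competing solution is known to be continuous only on \<open>[0,T]\<close>; it is extended by its end values.\<close>
      define cl where "cl s = min T (max 0 s)" for s
      define w' where "w' s = exp (lam 1 * cl s) *\<^sub>R v (cl s)" for s
      have cl: "continuous_on UNIV cl" unfolding cl_def by (intro continuous_intros)
      have "continuous_on UNIV (\<lambda>s. v (cl s))"
        by (rule continuous_on_compose2[OF _ cl]) (use v \<open>T > 0\<close> in \<open>auto simp: mild_solution_def cl_def\<close>)
      then have cw': "continuous_on UNIV w'"
        unfolding w'_def by (intro continuous_intros cl)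
      have vw': "v s = exp (- lam 1 * s) *\<^sub>R w' s" if "s \<in> {0..T}" for s
      proof -
        have "cl s = s" using that by (simp add: cl_def)
        then show ?thesis by (simp add: w'_def exp_add[symmetric])
      qed
      have "mild (control_term p) T u0 w'"
        by (rule iffD1[OF mild_solution_iff_mild[OF p P cw' vw'] v])
      from mild_unique[OF this w small' t] show ?thesis
        by (simp only: vw'[OF t] u_def)
    qed
    moreover have "u T = exp (- lam 1 * T) *\<^sub>R phi 1" by (simp add: u_def wT)
    ultimately show ?thesis using p P
      by (intro exI[of _ p] exI[of _ u] conjI allI impI ballI)
  qed
  with \<open>R > 0\<close> show ?thesis by (intro exI[of _ R] conjI allI impI)
qed

end

text \<open>
  The gaps of the square roots add up, and \<open>a - b = (sqrt a - sqrt b) * (sqrt a + sqrt b)\<close> is at least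
  \<open>(sqrt a - sqrt b)\<^sup>2\<close>.
\<close>
lemma sqrt_gap_imp_gap:
  fixes lam :: "nat \<Rightarrow> real"
  assumes nonneg: "\<And>k. k \<ge> 1 \<Longrightarrow> lam k \<ge> 0" and "\<alpha> > 0"
    and gap: "\<And>k. k \<ge> 1 \<Longrightarrow> sqrt (lam (k + 1)) - sqrt (lam k) \<ge> \<alpha>"
  shows "1 \<le> j \<Longrightarrow> j \<le> k \<Longrightarrow> \<alpha> * (real k - real j) \<le> sqrt (lam k) - sqrt (lam j)"
    and "1 \<le> j \<Longrightarrow> j \<le> k \<Longrightarrow> \<alpha>\<^sup>2 * (real k - real j)\<^sup>2 \<le> lam k - lam j"
proof -
  show *: "\<alpha> * (real k - real j) \<le> sqrt (lam k) - sqrt (lam j)" if "1 \<le> j" "j \<le> k" for j k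
    using \<open>j \<le> k\<close>
  proof (induction k rule: dec_induct)
    case (step k)
    then show ?case using gap[of k] \<open>1 \<le> j\<close> by (simp add: algebra_simps)
  qed simp
  show "\<alpha>\<^sup>2 * (real k - real j)\<^sup>2 \<le> lam k - lam j" if "1 \<le> j" "j \<le> k"
  proof -
    let ?x = "sqrt (lam k)" and ?y = "sqrt (lam j)"
    have y: "?y \<ge> 0" using nonneg that by simp
    have d: "0 \<le> \<alpha> * (real k - real j)" using \<open>\<alpha> > 0\<close> that by simp
    have "(\<alpha> * (real k - real j))\<^sup>2 \<le> (?x - ?y)\<^sup>2"
      using *[OF that] d by (intro power_mono)
    also have "\<dots> \<le> (?x - ?y) * (?x + ?y)"
      unfolding power2_eq_square using y order_trans[OF d *[OF that]] by (intro mult_left_mono) auto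
    also have "\<dots> = lam k - lam j"
    proof -
      have "lam j \<ge> 0" "lam k \<ge> 0" using nonneg that by (meson order_trans)+
      then show ?thesis by (simp add: algebra_simps)
    qed
    finally show ?thesis by (simp add: power_mult_distrib)
  qed
qed

theorem theorem1p1:
  fixes smul :: "'k::{real_normed_field,euclidean_space} \<Rightarrow>
      'x::{banach,second_countable_topology} \<Rightarrow> 'x"
    and ip :: "'x \<Rightarrow> 'x \<Rightarrow> 'k"
    and D :: "'x set" and A B :: "'x \<Rightarrow> 'x"
    and lam :: "nat \<Rightarrow> real" and phi :: "nat \<Rightarrow> 'x"
    and \<alpha> b q :: real
  assumes "hilbert_space smul ip"
    and "densely_defined_operator smul D A"
    and "self_adjoint ip D A"
    and "accretive ip D A"
    and "has_compact_resolvent smul D A"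
    and "ordered_eigenbasis smul ip D A lam phi"
    and "\<alpha> > 0"
    and "\<forall>k\<ge>1. sqrt (lam (k + 1)) - sqrt (lam k) \<ge> \<alpha>"
    and "bounded_operator smul B"
    and "b > 0" and "q > 0"
    and "ip (B (phi 1)) (phi 1) \<noteq> 0"
    and "\<forall>k>1. lam k powr q * norm (ip (B (phi 1)) (phi k)) \<ge> b"
  shows "\<exists>C\<^sub>K>0. \<forall>T>0. \<exists>R\<^sub>T>0. \<forall>u0. norm (u0 - phi 1) < R\<^sub>T \<longrightarrow>
    (\<exists>p :: real \<Rightarrow> 'k.
      L2_function T p \<and>
      (\<exists>u. mild_solution smul D A B T p u0 u \<and>
           (\<forall>v. mild_solution smul D A B T p u0 v \<longrightarrow> (\<forall>t\<in>{0..T}. v t = u t)) \<and>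
           u T = exp (- lam 1 * T) *\<^sub>R phi 1) \<and>
      (let T\<^sub>\<alpha> = pi\<^sup>2 / 6 * min 1 (1 / \<alpha>\<^sup>2);
           T\<^sub>f = min T T\<^sub>\<alpha>
       in L2_function_norm T p \<le>
            exp (- pi\<^sup>2 * C\<^sub>K / T\<^sub>f) / (exp (2 * pi\<^sup>2 * C\<^sub>K / (3 * T\<^sub>f)) - 1)))"
proof -
  note basis = assms(6)[unfolded ordered_eigenbasis_def]
  interpret hilbert_space smul ip by (rule assms(1))
  interpret hilbert_basis smul ip phi
    by unfold_locales (use basis in blast)
  have eigen: "phi k \<in> D \<and> A (phi k) = lam k *\<^sub>R phi k" if "k \<ge> 1" for k
    using basis that by blast
  have lam_nonneg: "lam k \<ge> 0" if "k \<ge> 1" for k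
    using eigen[OF that] by (intro eigenvalue_nonneg[OF assms(4) that]) auto
  have gap: "\<alpha>\<^sup>2 * (real k - real j)\<^sup>2 \<le> lam k - lam j" if "1 \<le> j" "j \<le> k" for j k
    by (rule sqrt_gap_imp_gap(2)[where lam = lam, OF lam_nonneg assms(7) assms(8)[rule_format] that])
  have gap': "\<alpha>\<^sup>2 \<le> \<bar>lam k - lam j\<bar>" if "1 \<le> j" "1 \<le> k" "j \<noteq> k" for j k
  proof -
    have *: "\<alpha>\<^sup>2 \<le> lam k - lam j" if "1 \<le> j" "j < k" for j k
    proof -
      have "1 \<le> real k - real j" using that by simp
      then have "1 \<le> (real k - real j)\<^sup>2" by (rule one_le_power)
      then have "\<alpha>\<^sup>2 * 1 \<le> \<alpha>\<^sup>2 * (real k - real j)\<^sup>2" by (intro mult_left_mono) auto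
      then show ?thesis using gap[of j k] that by simp
    qed
    show ?thesis using *[of j k] *[of k j] that by (cases "j < k") auto
  qed
  have a2: "\<alpha>\<^sup>2 > 0" using assms(7) by simp
  interpret diagonal_operator smul ip phi D A lam
  proof unfold_locales
    show "j = k" if "1 \<le> j" "1 \<le> k" "lam j = lam k" for j k
    proof (rule ccontr)
      assume "j \<noteq> k"
      from gap'[OF that(1,2) this] a2 that(3) show False by simp
    qed
  qed (rule assms(3,4) eigen; assumption?)+
  have B: "bounded_linear B" using assms(9) by (simp add: bounded_operator_def)
  obtain \<beta> where \<beta>: "\<beta> \<ge> 0" "\<And>x. norm (B x) \<le> norm x * \<beta>"
    using bounded_linear.nonneg_bounded[OF B] by blast
  define \<mu> where "\<mu> k = lam k - lam 1" for k
  define S where "S t = diagonal_op (\<lambda>k. exp (- \<mu> k * max 0 t))" for t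
  have \<mu>_growth: "\<alpha>\<^sup>2 * (real k - 1)\<^sup>2 \<le> \<mu> k" if "k \<ge> 1" for k
    using gap[of 1 k] that by (simp add: \<mu>_def)
  have \<mu>_nonneg: "\<mu> k \<ge> 0" if "k \<ge> 1" for k
    by (rule order_trans[OF _ \<mu>_growth[OF that]]) simp
  have mult_le: "\<bar>exp (- \<mu> k * max 0 t)\<bar> \<le> 1" if "k \<ge> 1" for k t
    using \<mu>_nonneg[OF that] by simp
  \<comment> \<open>Below the cutoff, \<open>lam k < \<alpha>\<^sup>2 * m\<^sup>2 + lam 1 \<le> c * m\<^sup>2\<close>, which turns the lower bound in \<open>lam k\<close> into one in \<open>m\<close>.\<close>
  define c where "c = \<alpha>\<^sup>2 + lam 1"
  define Cb where "Cb = 1 / norm (ip (B (phi 1)) (phi 1)) + c powr q / b"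
  have c: "c > 0" unfolding c_def by (intro add_pos_nonneg a2 lam_nonneg) simp
  have coupling: "1 \<le> Cb * real m powr (2 * q) * norm (ip (B (phi 1)) (phi k))"
    if k: "k \<ge> 1" and m: "m \<ge> 1" and "\<mu> k < \<alpha>\<^sup>2 * (real m)\<^sup>2" for k m
  proof (cases "k = 1")
    case True
    have "1 \<le> real m powr (2 * q)" using m assms(11) by (simp add: ge_one_powr_ge_zero)
    moreover have "1 \<le> Cb * norm (ip (B (phi 1)) (phi 1))"
      using assms(12) assms(10) c by (simp add: Cb_def algebra_simps)
    ultimately have "1 * 1 \<le> (Cb * norm (ip (B (phi 1)) (phi 1))) * real m powr (2 * q)"
      by (intro mult_mono) auto
    then show ?thesis using True by (simp add: mult_ac)
  next
    case False
    have "lam k \<le> \<alpha>\<^sup>2 * (real m)\<^sup>2 + lam 1" using that(3) by (simp add: \<mu>_def)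
    also have "\<dots> \<le> c * (real m)\<^sup>2"
    proof -
      have "1 \<le> (real m)\<^sup>2" using m by simp
      then have "lam 1 * 1 \<le> lam 1 * (real m)\<^sup>2" using lam_nonneg[of 1] by (intro mult_left_mono) auto
      then show ?thesis by (simp add: c_def algebra_simps)
    qed
    finally have "lam k powr q \<le> (c * (real m)\<^sup>2) powr q"
      using lam_nonneg[OF k] assms(11) by (intro powr_mono2) auto
    also have "\<dots> = c powr q * real m powr (2 * q)"
      using c m by (simp add: powr_mult powr_powr flip: powr_numeral)
    finally have "lam k powr q * norm (ip (B (phi 1)) (phi k))
        \<le> c powr q * real m powr (2 * q) * norm (ip (B (phi 1)) (phi k))"
      by (rule mult_right_mono) simp
    moreover have "b \<le> lam k powr q * norm (ip (B (phi 1)) (phi k))" using assms(13) False k by simp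
    ultimately have "1 \<le> c powr q / b * (real m powr (2 * q) * norm (ip (B (phi 1)) (phi k)))"
      using assms(10) by (simp add: field_simps)
    also have "\<dots> \<le> Cb * (real m powr (2 * q) * norm (ip (B (phi 1)) (phi k)))"
      by (intro mult_right_mono) (simp_all add: Cb_def)
    finally show ?thesis by (simp add: mult_ac)
  qed
  interpret contraction_semigroup S
    unfolding S_def by (rule contraction_semigroup_diagonal[OF \<mu>_nonneg])
  interpret ground_state_control S smul ip phi D A lam B \<alpha> \<beta> Cb "2 * q"
  proof unfold_locales
    show "S t (smul c x) = smul c (S t x)" for t c x
      using bounded_operator_diagonal_op[OF mult_le] by (simp add: S_def bounded_operator_def)
    show "ip (S t x) (phi k) = exp (- (lam k - lam 1) * t) *\<^sub>R ip x (phi k)" if "k \<ge> 1" "t \<ge> 0" for k t x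
      using ip_diagonal_op[where x = x, OF mult_le[of _ t] that(1)] that(2) by (simp add: S_def \<mu>_def)
    show "B (x - y) = B x - B y" for x y
      by (rule linear_diff[OF bounded_linear.linear[OF B]])
    show "B (s *\<^sub>R x) = s *\<^sub>R B x" for s x
      by (rule linear_cmul[OF bounded_linear.linear[OF B]])
    show "norm (B x) \<le> \<beta> * norm x" for x using \<beta>(2)[of x] by (simp add: mult.commute)
    show "Cb > 0"
      unfolding Cb_def using assms(10,12) by (intro add_pos_nonneg) auto
    show "\<alpha>\<^sup>2 \<le> \<bar>lam k - lam 1 - (lam j - lam 1)\<bar>" if "j \<ge> 1" "k \<ge> 1" "j \<noteq> k" for j k
      using gap'[OF that] by simp
  qed (use assms(7,11) \<beta>(1) \<mu>_nonneg \<mu>_growth coupling in \<open>simp_all add: \<mu>_def\<close>)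
  show ?thesis
  proof (rule exI[of _ "1::real"], intro conjI allI impI)
    fix T :: real assume "T > 0"
    define Tf where "Tf = min T (pi\<^sup>2 / 6 * min 1 (1 / \<alpha>\<^sup>2))"
    define V where "V = exp (- pi\<^sup>2 * 1 / Tf) / (exp (2 * pi\<^sup>2 * 1 / (3 * Tf)) - 1)"
    have "Tf > 0" using \<open>T > 0\<close> a2 by (simp add: Tf_def)
    then have "V > 0" by (simp add: V_def)
    \<comment> \<open>The last two bounds make the \<open>L\<^sup>2\<close> norm at most \<open>V\<close> and the Duhamel map a contraction.\<close>
    define \<epsilon> where "\<epsilon> = min 1 (min (V / sqrt T) (1 / (2 * T * (\<beta> + 1))))"
    have \<epsilon>: "\<epsilon> > 0" "\<epsilon> \<le> 1" using \<open>V > 0\<close> \<open>T > 0\<close> \<beta>(1) by (simp_all add: \<epsilon>_def)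
    have "\<epsilon> \<le> V / sqrt T" by (simp add: \<epsilon>_def)
    then have \<epsilon>V: "\<epsilon> * sqrt T \<le> V" using \<open>T > 0\<close> by (simp add: field_simps)
    have "\<epsilon> \<le> 1 / (2 * T * (\<beta> + 1))" by (simp add: \<epsilon>_def)
    moreover have "2 * T * (\<beta> + 1) > 0" using \<open>T > 0\<close> \<beta>(1) by simp
    ultimately have "\<epsilon> * (2 * T * (\<beta> + 1)) \<le> 1" by (simp only: pos_le_divide_eq)
    moreover have "\<epsilon> * T \<ge> 0" using \<epsilon> \<open>T > 0\<close> by simp
    ultimately have small: "T * (\<epsilon> * \<beta>) \<le> 1 / 2" by (simp add: algebra_simps)
    obtain R where "R > 0" and R: "\<And>u0. norm (u0 - phi 1) < R \<Longrightarrow>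
      \<exists>p. p \<in> borel_measurable borel \<and> (\<forall>s. norm (p s) \<le> \<epsilon>) \<and>
        (\<exists>u. mild_solution smul D A B T p u0 u \<and>
          (\<forall>v. mild_solution smul D A B T p u0 v \<longrightarrow> (\<forall>t\<in>{0..T}. v t = u t)) \<and>
          u T = exp (- lam 1 * T) *\<^sub>R phi 1)"
      using controllability_to_ground_state[OF \<open>T > 0\<close> \<epsilon> small] by blast
    show "\<exists>R>0. \<forall>u0. norm (u0 - phi 1) < R \<longrightarrow>
      (\<exists>p :: real \<Rightarrow> 'k. L2_function T p \<and>
        (\<exists>u. mild_solution smul D A B T p u0 u \<and>
             (\<forall>v. mild_solution smul D A B T p u0 v \<longrightarrow> (\<forall>t\<in>{0..T}. v t = u t)) \<and>
             u T = exp (- lam 1 * T) *\<^sub>R phi 1) \<and>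
        (let T\<^sub>\<alpha> = pi\<^sup>2 / 6 * min 1 (1 / \<alpha>\<^sup>2); T\<^sub>f = min T T\<^sub>\<alpha>
         in L2_function_norm T p \<le> exp (- pi\<^sup>2 * 1 / T\<^sub>f) / (exp (2 * pi\<^sup>2 * 1 / (3 * T\<^sub>f)) - 1)))"
    proof (intro exI[of _ R] conjI allI impI \<open>R > 0\<close>)
      fix u0 assume "norm (u0 - phi 1) < R"
      then obtain p where p: "p \<in> borel_measurable borel" and P: "\<And>s. norm (p s) \<le> \<epsilon>"
        and u: "\<exists>u. mild_solution smul D A B T p u0 u \<and>
          (\<forall>v. mild_solution smul D A B T p u0 v \<longrightarrow> (\<forall>t\<in>{0..T}. v t = u t)) \<and>
          u T = exp (- lam 1 * T) *\<^sub>R phi 1"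
        using R by blast
      have "0 \<le> T" using \<open>T > 0\<close> by simp
      note L2 = L2_of_bounded[OF p P this]
      have "L2_function_norm T p \<le> V" by (rule order_trans[OF L2(2) \<epsilon>V])
      then have "let T\<^sub>\<alpha> = pi\<^sup>2 / 6 * min 1 (1 / \<alpha>\<^sup>2); T\<^sub>f = min T T\<^sub>\<alpha>
         in L2_function_norm T p \<le> exp (- pi\<^sup>2 * 1 / T\<^sub>f) / (exp (2 * pi\<^sup>2 * 1 / (3 * T\<^sub>f)) - 1)"
        unfolding Let_def V_def Tf_def .
      with L2(1) u show "\<exists>p :: real \<Rightarrow> 'k. L2_function T p \<and>
        (\<exists>u. mild_solution smul D A B T p u0 u \<and>
             (\<forall>v. mild_solution smul D A B T p u0 v \<longrightarrow> (\<forall>t\<in>{0..T}. v t = u t)) \<and>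
             u T = exp (- lam 1 * T) *\<^sub>R phi 1) \<and>
        (let T\<^sub>\<alpha> = pi\<^sup>2 / 6 * min 1 (1 / \<alpha>\<^sup>2); T\<^sub>f = min T T\<^sub>\<alpha>
         in L2_function_norm T p \<le> exp (- pi\<^sup>2 * 1 / T\<^sub>f) / (exp (2 * pi\<^sup>2 * 1 / (3 * T\<^sub>f)) - 1))"
        by (intro exI[of _ p] conjI)
    qed
  qed simp
qed

end
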